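(* Consider the online risk-averse learning problem and the algorithm (Algorithm 1) described in the context. Assume that: (i) $J(x,\xi)$ is convex in $x$ for every $\xi\in\Xi$; (ii) $J(x,\xi)$ is Lipschitz continuous in $x$ for every $\xi\in\Xi$, i.e. there is a constant $L_0>0$ with $|J(x,\xi)-J(y,\xi)|\le L_0\|x-y\|$ for all $x,y\in\mathcal{X}$; (iii) the distributions satisfy the variation budget $\sum_{t=2}^T W_1(\mathcal{D}_{t-1},\mathcal{D}_t)\le V_D$. Suppose that the sampling numbers $n_t=\phi(\tau)$ satisfy $\sum_{\tau=1}^{\Delta_T}\frac{1}{\sqrt{\phi(\tau)}}\le c\,\Delta_T^{1-\frac a2}$ with a constant $a>0$ and some constant $c>0$. 1. When $a\in(0,1]$, select $\delta=\left(\frac{V_D}{T}\right)^{\frac{a}{4+a}}$, $\eta_t=\left(\frac{V_D}{T}\right)^{\frac{3a}{4+a}}$, $\Delta_T=\left(\frac{T}{V_D}\right)^{\frac{4}{4+a}}$. Then Algorithm 1 achieves $\mathrm{DR}(T)=\tilde{\mathcal{O}}\big(T^{\frac{4}{4+a}}V_D^{\frac{a}{4+a}}\big)$ with high probability. 2. When $a>1$, select $\delta=\left(\frac{V_D}{T}\right)^{\frac15}$, $\eta_t=\left(\frac{V_D}{T}\right)^{\frac35}$, $\Delta_T=\left(\frac{T}{V_D}\right)^{\frac45}$. Then Algorithm 1 achieves $\mathrm{DR}(T)=\tilde{\mathcal{O}}\big(T^{\frac45}V_D^{\frac15}\big)$ with high probability. Here $\tilde{\mathcal{O}}$ hides constants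 and polylogarithmic factors of $T$, and "with high probability" means with probability at least $1-\gamma$ for a given $\gamma\in(0,1)$ (the hidden factors may depend on $\gamma$).
   Context: **Setting.** $\mathcal{X}\subseteq\mathbb{R}^d$ is the admissible set of decisions; it contains the ball $r\mathbb{B}$ of radius $r$ centered at the origin and has diameter $D_x=\sup_{x,y\in\mathcal{X}}\|x-y\|$, where $\|\cdot\|$ is the $\ell_2$ norm. $J:\mathcal{X}\times\Xi\to\mathbb{R}$ is a cost function of the decision $x$ and a random noise $\xi\in\Xi$, bounded by $U>0$: $|J(x,\xi)|\le U$. At iteration $t=1,\dots,T$ the noise is $\xi_t\sim\mathcal{D}_t$, where $\mathcal{D}_1,\dots,\mathcal{D}_T$ are (time-varying) distributions on a metric space. $W_1$ is the Wasserstein distance, given for any fixed $K>0$ by $W_1(\mathcal{D},\mathcal{D}')=\frac1K\sup_{\|f\|_L\le K}\{\mathbb{E}_{x\sim\mathcal{D}}[f(x)]-\mathbb{E}_{y\sim\mathcal{D}'}[f(y)]\}$, with $\|\cdot\|_L$ the Lipschitz norm. **CVaR.** Fix $\alpha\in(0,1]$. For a cost with cumulative distribution function $F$, the $\alpha$-VaR is $J^\alpha=F^{-1}(\alpha):=\inf\{y:F(y)\ge\alpha\}$, and the $\alpha$-CVaR, which describes the expectation of the $\alpha$-fraction of the worst outcomes, is defined as $\mathrm{CVaR}_\alpha[F]=\mathrm{CVaR}_\alpha[J(x,\xi)]=\mathbb{E}_F[J(x,\xi)\mid J(x,\xi)\ge J^\alpha]$. Put $C_t(x)=\mathrm{CVaR}_\alpha[J(x,\xi_t)]$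 with $\xi_t\sim\mathcal{D}_t$. **Algorithm 1.** Inputs: an initial point, the horizon $T$, a batch size $\Delta_T\in(1,T)$, a smoothing parameter $\delta$, the risk level $\alpha$, a sampling function $\phi$ and learning rates $\eta_t$. Let $\mathcal{X}^\delta=\{x\in\mathcal{X}:\frac{1}{1-\delta/r}x\in\mathcal{X}\}$ and $\mathcal{P}_{\mathcal{X}^\delta}(x)=\arg\min_{y\in\mathcal{X}^\delta}\|x-y\|^2$. For $t=1,\dots,T$: - identify the batch $j=\lceil t/\Delta_T\rceil$ and the epoch within the batch $\tau=t-(j-1)\Delta_T$; set $n_t=\phi(\tau)$; - sample $u_t$ uniformly from the unit sphere of $\mathbb{R}^d$ and set $\hat{x}_t=x_t+\delta u_t$; - play $\hat{x}_t$ $n_t$ times, obtaining $J(\hat{x}_t,\xi_t^i)$, $i=1,\dots,n_t$, with $\xi_t^i$ samples of $\xi_t\sim\mathcal{D}_t$, and form $\hat F_t(y)=\frac1{n_t}\sum_{i=1}^{n_t}\mathbf{1}\{J(\hat{x}_t,\xi_t^i)\le y\}$; - set $\hat g_t=\frac{d}{\delta}\mathrm{CVaR}_\alpha[\hat F_t]\,u_t$ and $x_{t+1}=\mathcal{P}_{\mathcal{X}^\delta}(x_t-\eta_t\hat g_t)$. **Dynamic regret.** $\mathrm{DR}(T)=\sum_{t=1}^T C_t(\hat{x}_t)-\sum_{t=1}^T C_t(x_t^* )$ with $x_t^*=\arg\min_{x\in\mathcal{X}}C_t(x)$.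
   Formalization: Added: J(x,ξ) is Lipschitz in ξ with a constant uniform in x (else W_1 does not control C_t and the claim fails). CVaR is read as the average of exactly the worst α-fraction of outcomes, splitting atoms, since conditioning on J ≥ F^{-1}(α) fails for laws with atoms. *)

theory Defs
  imports "HOL-Probability.Probability"
begin

definition VaR :: "(real \<Rightarrow> real) \<Rightarrow> real \<Rightarrow> real" where
  "VaR F p = Inf {y. p \<le> F y}"

(* The expectation over the worst (largest) outcomes, of total probability \<alpha>: if V is uniform
   on (0,1), then VaR F V has distribution function F, and CVaR \<alpha> F is the expectation of
   VaR F V conditioned on V > 1 - \<alpha>.  Conditioning on the rank V rather than on the value splits
   an atom at the quantile, so that the tail has mass exactly \<alpha> also for an empirical distribution
   function.  If the event {y. y \<ge> q}, q = VaR F (1 - \<alpha>), itself has mass \<alpha>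
   (in particular if F is continuous), this is the expectation conditioned on that event, see
   CVaR_eq_conditional_expectation below. *)
definition CVaR :: "real \<Rightarrow> (real \<Rightarrow> real) \<Rightarrow> real" where
  "CVaR \<alpha> F = (LBINT p:{1 - \<alpha><..<1}. VaR F p) / \<alpha>"

lemma CVaR_eq_conditional_expectation:
  fixes M :: "real measure" and \<alpha> :: real
  defines "q \<equiv> VaR (cdf M) (1 - \<alpha>)"
  assumes M: "real_distribution M" and \<alpha>: "0 < \<alpha>" "\<alpha> < 1"
    and tail: "measure M {q..} = \<alpha>"
  shows "CVaR \<alpha> (cdf M) = (LINT y:{q..}|M. y) / measure M {q..}"
proof -
  interpret cdf_distribution M
    using M by (simp add: cdf_distribution_def)
  let ?L = "restrict_space lborel {0<..<1::real}"
  have I: "VaR (cdf M) = I"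
    by (simp add: VaR_def fun_eq_iff)
  let ?A = "{1 - \<alpha><..<1}" and ?B = "{p\<in>{0<..<1}. q \<le> I p}"
  have [measurable]: "I \<in> borel_measurable ?L"
    using measurable_CI by (simp cong: measurable_cong_sets restrict_space_sets_cong)
  have AB: "?A \<subseteq> ?B"
  proof safe
    fix p assume p: "p \<in> ?A"
    then have "p \<le> C (I p)" using pseudoinverse[of p "I p"] \<alpha> by auto
    with p have "1 - \<alpha> \<le> C (I p)" by simp
    then show "q \<le> I p" using pseudoinverse[of "1 - \<alpha>" "I p"] \<alpha> by (simp add: q_def I)
  qed (use \<alpha> in auto)
  have Bsets: "?B \<in> sets ?L"
  proof -
    have "I -` {q..} \<inter> space ?L \<in> sets ?L" by measurable
    also have "I -` {q..} \<inter> space ?L = ?B" by (auto simp: space_restrict_space)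
    finally show ?thesis .
  qed
  have Bl: "?B \<in> sets lborel"
    using Bsets by (auto simp: sets_restrict_space_iff)
  have "measure M {q..} = measure (distr ?L borel I) {q..}"
    by (simp only: distr_I_eq_M)
  also have "\<dots> = measure ?L ?B"
    by (subst measure_distr) (auto simp: space_restrict_space intro!: arg_cong[where f = "measure ?L"])
  also have "\<dots> = measure lborel ?B"
    by (subst measure_restrict_space) auto
  finally have mB: "measure lborel ?B = \<alpha>" using tail by simp
  have fmB: "?B \<in> fmeasurable lborel"
    by (rule fmeasurableI2[of "{0..1::real}"]) (use Bl in \<open>auto simp: fmeasurable_def\<close>)
  have "measure lborel (?B - ?A) = 0"
    using measurable_measure_Diff[OF fmB, of ?A] AB mB \<alpha> by simp
  moreover have fd: "?B - ?A \<in> fmeasurable lborel"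
    by (rule fmeasurable_Diff[OF fmB]) simp
  ultimately have "emeasure lborel (?B - ?A) = 0"
    using emeasure_eq_measure2[OF fd] by (simp only: ennreal_0)
  then have "?B - ?A \<in> null_sets lborel"
    using fmeasurableD[OF fd] by (rule null_setsI)
  then have ae: "AE p in lborel. p \<in> ?A \<longleftrightarrow> p \<in> ?B"
    using AB \<alpha> by (auto dest!: AE_not_in elim!: eventually_mono)
  have "(LINT y:{q..}|M. y) = (LINT y:{q..}|distr ?L borel I. y)"
    by (simp only: distr_I_eq_M)
  also have "\<dots> = (LINT p|?L. indicator {q..} (I p) *\<^sub>R I p)"
    unfolding set_lebesgue_integral_def by (subst integral_distr) auto
  also have "\<dots> = (LBINT p. indicator {0<..<1} p *\<^sub>R (indicator {q..} (I p) *\<^sub>R I p))"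
    by (subst integral_restrict_space) auto
  also have "\<dots> = (LBINT p. indicator ?A p *\<^sub>R I p)"
  proof (rule integral_cong_AE)
    have "(\<lambda>p. indicator {q..} (I p) *\<^sub>R I p) \<in> borel_measurable ?L" by measurable
    then show "(\<lambda>p. indicator {0<..<1} p *\<^sub>R indicator {q..} (I p) *\<^sub>R I p) \<in> borel_measurable lborel"
      by (subst (asm) borel_measurable_restrict_space_iff) auto
    have "(\<lambda>p. indicator ?A p *\<^sub>R I p) \<in> borel_measurable ?L"
      by (intro borel_measurable_scaleR borel_measurable_indicator')
        (auto simp: sets_restrict_space_iff space_restrict_space intro!: measurable_restrict_space1)
    then have "(\<lambda>p. indicator {0<..<1} p *\<^sub>R indicator ?A p *\<^sub>R I p) \<in> borel_measurable lborel"
      by (subst (asm) borel_measurable_restrict_space_iff) auto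
    moreover have "(\<lambda>p. indicator {0<..<1} p *\<^sub>R indicator ?A p *\<^sub>R I p) = (\<lambda>p. indicator ?A p *\<^sub>R I p)"
      using \<alpha> by (auto simp: fun_eq_iff indicator_def)
    ultimately show "(\<lambda>p. indicator ?A p *\<^sub>R I p) \<in> borel_measurable lborel" by simp
  qed (use ae in \<open>eventually_elim, auto simp: indicator_def\<close>)
  finally show ?thesis
    using tail by (simp add: CVaR_def I set_lebesgue_integral_def)
qed

definition cvar_cost :: "real \<Rightarrow> ('a \<Rightarrow> 'b \<Rightarrow> real) \<Rightarrow> 'b measure \<Rightarrow> 'a \<Rightarrow> real" where
  "cvar_cost \<alpha> J D x = CVaR \<alpha> (cdf (distr D borel (J x)))"

(* The supremum ranges over the Lipschitz functions whose two expectations exist; these are all of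
   them if D and D' have finite first moments.  The value does not depend on K, see below. *)
definition wasserstein1 :: "real \<Rightarrow> 'b::metric_space measure \<Rightarrow> 'b measure \<Rightarrow> ereal" where
  "wasserstein1 K D D' =
     ereal (1 / K) * (SUP f \<in> {f. K-lipschitz_on UNIV f \<and> integrable D f \<and> integrable D' f}.
       ereal ((LINT z|D. f z) - (LINT z|D'. f z)))"

lemma wasserstein1_scale:
  assumes "0 < K"
  shows "wasserstein1 K D D' = wasserstein1 1 D D'"
proof -
  let ?S = "\<lambda>K. {f :: 'a \<Rightarrow> real. K-lipschitz_on UNIV f \<and> integrable D f \<and> integrable D' f}"
  let ?d = "\<lambda>f. (LINT z|D. f z) - (LINT z|D'. f z)"
  have *: "?S K = (\<lambda>f z. K * f z) ` ?S 1"
  proof (intro equalityI subsetI)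
    fix f assume f: "f \<in> ?S K"
    have "(\<lambda>z. f z / K) \<in> ?S 1"
      using f assms
      by (simp add: lipschitz_on_def dist_real_def diff_divide_distrib[symmetric] divide_simps mult.commute)
    moreover have "f = (\<lambda>z. K * (f z / K))" using assms by auto
    ultimately show "f \<in> (\<lambda>f z. K * f z) ` ?S 1"
      by (intro image_eqI[where x = "\<lambda>z. f z / K"])
  next
    fix f assume "f \<in> (\<lambda>f z. K * f z) ` ?S 1"
    then obtain g where g: "g \<in> ?S 1" and f: "f = (\<lambda>z. K * g z)"
      by (rule imageE)
    have "dist (f y) (f z) = K * dist (g y) (g z)" for y z
      using assms by (simp add: f dist_real_def right_diff_distrib[symmetric] abs_mult)
    then show "f \<in> ?S K"
      using g assms by (simp add: f lipschitz_on_def)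
  qed
  have "(SUP f \<in> ?S K. ereal (?d f)) = (SUP f \<in> ?S 1. ereal K * ereal (?d f))"
    unfolding * image_image by (simp add: right_diff_distrib[symmetric])
  also have "\<dots> = ereal K * (SUP f \<in> ?S 1. ereal (?d f))"
  proof (rule Sup_ereal_mult_left'[symmetric])
    show "?S 1 \<noteq> {}"
      by (intro ex_in_conv[THEN iffD1] exI[of _ "\<lambda>_. 0"]) (simp add: lipschitz_on_def)
  qed (use assms in auto)
  finally show ?thesis
    using assms by (simp add: wasserstein1_def mult.assoc[symmetric] one_ereal_def)
qed

(* The radial projection of the uniform distribution on the ball is the normalized surface measure
   of the unit sphere. *)
definition uniform_sphere :: "'a::euclidean_space measure" where
  "uniform_sphere = distr (uniform_measure lborel (ball 0 1)) borel sgn"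

definition empirical_cdf :: "nat \<Rightarrow> (nat \<Rightarrow> real) \<Rightarrow> real \<Rightarrow> real" where
  "empirical_cdf n z y = (\<Sum>i = 1..n. if z i \<le> y then 1 else 0) / real n"

definition shrunk_set :: "'a::real_vector set \<Rightarrow> real \<Rightarrow> real \<Rightarrow> 'a set" where
  "shrunk_set X r \<delta> = {x \<in> X. (1 / (1 - \<delta> / r)) *\<^sub>R x \<in> X}"

definition batch :: "nat \<Rightarrow> nat \<Rightarrow> nat" where
  "batch \<Delta> t = nat \<lceil>real t / real \<Delta>\<rceil>"

definition epoch :: "nat \<Rightarrow> nat \<Rightarrow> nat" where
  "epoch \<Delta> t = t - (batch \<Delta> t - 1) * \<Delta>"

definition gradient_estimate ::
  "('a::euclidean_space \<Rightarrow> 'b \<Rightarrow> real) \<Rightarrow> real \<Rightarrow> real \<Rightarrow> nat \<Rightarrow> 'a \<Rightarrow> 'a \<Rightarrow> (nat \<Rightarrow> 'b) \<Rightarrow> 'a" where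
  "gradient_estimate J \<alpha> \<delta> n xhat u \<xi> =
     (real DIM('a) / \<delta> * CVaR \<alpha> (empirical_cdf n (\<lambda>i. J xhat (\<xi> i)))) *\<^sub>R u"

locale zeroth_order_cvar_run = prob_space M
  for M :: "'m measure"
    and X :: "'a::euclidean_space set"
    and J :: "'a \<Rightarrow> 'b::metric_space \<Rightarrow> real"
    and D :: "nat \<Rightarrow> 'b measure"
    and r \<alpha> \<delta> :: real
    and \<eta> :: "nat \<Rightarrow> real"
    and \<phi> :: "nat \<Rightarrow> nat"
    and \<Delta> T :: nat
    and x1 :: 'a
    and u :: "nat \<Rightarrow> 'm \<Rightarrow> 'a"
    and \<xi> :: "nat \<Rightarrow> nat \<Rightarrow> 'm \<Rightarrow> 'b"
    and xhat x :: "nat \<Rightarrow> 'm \<Rightarrow> 'a" +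
  assumes direction: "t \<in> {1..T} \<Longrightarrow> random_variable borel (u t)"
      "t \<in> {1..T} \<Longrightarrow> \<omega> \<in> space M \<Longrightarrow> u t \<omega> \<in> sphere 0 1"
      "t \<in> {1..T} \<Longrightarrow> distr M borel (u t) = uniform_sphere"
    and noise: "t \<in> {1..T} \<Longrightarrow> i \<in> {1..\<phi> (epoch \<Delta> t)} \<Longrightarrow> random_variable borel (\<xi> t i)"
      "t \<in> {1..T} \<Longrightarrow> i \<in> {1..\<phi> (epoch \<Delta> t)} \<Longrightarrow> distr M borel (\<xi> t i) = D t"
    and independent: "indep_sets
      (case_sum (\<lambda>t. {u t -` A \<inter> space M | A. A \<in> sets borel})
                (\<lambda>(t, i). {\<xi> t i -` A \<inter> space M | A. A \<in> sets borel}))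
      ({1..T} <+> (SIGMA t:{1..T}. {1..\<phi> (epoch \<Delta> t)}))"
    and initial: "x1 \<in> shrunk_set X r \<delta>"
      "\<omega> \<in> space M \<Longrightarrow> x 1 \<omega> = x1"
    and played: "t \<in> {1..T} \<Longrightarrow> \<omega> \<in> space M \<Longrightarrow> xhat t \<omega> = x t \<omega> + \<delta> *\<^sub>R u t \<omega>"
    and projected_step: "t \<in> {1..T} \<Longrightarrow> \<omega> \<in> space M \<Longrightarrow>
      is_arg_min
        (\<lambda>y. (norm (x t \<omega> - \<eta> t *\<^sub>R gradient_estimate J \<alpha> \<delta> (\<phi> (epoch \<Delta> t))
                      (xhat t \<omega>) (u t \<omega>) (\<lambda>i. \<xi> t i \<omega>) - y))\<^sup>2)
        (\<lambda>y. y \<in> shrunk_set X r \<delta>) (x (Suc t) \<omega>)"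

definition dynamic_regret ::
  "(nat \<Rightarrow> 'a \<Rightarrow> real) \<Rightarrow> (nat \<Rightarrow> 'a) \<Rightarrow> (nat \<Rightarrow> 'a) \<Rightarrow> nat \<Rightarrow> real" where
  "dynamic_regret C xhat xstar T = (\<Sum>t = 1..T. C t (xhat t)) - (\<Sum>t = 1..T. C t (xstar t))"

end

theory Submission
  imports Defs
begin

text \<open>Since the comparators minimise over \<open>X\<close> and every played point lies in \<open>X\<close>, the regret is
  nonnegative, so Markov's inequality reduces the claim to a bound on the expected regret, with the
  factor \<open>1 / \<gamma>\<close> absorbed into the constant; no logarithm is needed.

  CVaR is the minimum over \<open>c\<close> of \<open>c + \<E> max 0 (Z - c) / \<alpha>\<close>. This makes the risk convex and
  Lipschitz in the decision, bounds its drift by the Wasserstein distance, and bounds the error of the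
  empirical CVaR by an integral of the error of the empirical distribution function, which has
  expectation of order \<open>1 / sqrt n\<close>.

  Against a comparator that is constant on each batch (the shrunken minimiser of the first round of the
  batch), the usual analysis of projected gradient descent applies, with a restart of the telescoping
  sum at each batch. The role of the gradient of the smoothed risk is played by an inequality for convex
  Lipschitz functions, obtained by integrating convexity against a radial weight concentrating near the
  unit sphere.\<close>

section \<open>Conditional value at risk as a minimum over levels\<close>

text \<open>The exponents come from balancing five errors. With \<rho> = V / T, \<delta> = \<rho>^e,
  h = \<delta>^3 and \<Delta> of order \<rho>^(e - 1), smoothing costs T \<delta>, drift inside
  batches V \<Delta>, and the squared gradient estimates T h / \<delta>^2; all three have order T
  \<rho>^e. Restarts cost T / (\<Delta> h), of order T \<rho>^(1 - 4 e), which is small enough as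
  long as e \<le> 1/5. Sampling costs T \<Delta>^(-a/2) / \<delta>, which meets T \<rho>^e exactly
  for e = a / (4 + a). Thus sampling is the bottleneck for a < 1 and the restarts are for a > 1,
  where only the sampling decay of a = 1 is used. Two obstacles shape the rest. The risk need not be
  differentiable, so a one-sided inequality with loss 2 L \<delta> stands in for the gradient
  identity. And \<open>J\<close> is given by its sections while \<open>X\<close> need not be closed,
  so the measurability of the iterates is itself a claim: \<open>J\<close> is replaced by a jointly
  measurable cost agreeing with it on \<open>X\<close>, CVaR becomes a countable infimum, and the
  projection becomes a closest point of a closure.\<close>

text \<open>Sampling from \<open>N\<close> means evaluating the quantile function \<open>I\<close>
  at a uniform p. Then \<alpha> (CVaR - c) integrates I p - c over p > 1 - \<alpha>, while the
  excess integrates the positive part over all p. The two agree if I - c changes sign at 1 -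
  \<alpha>. The range of the optimal level matters later, when excesses are written as integrals
  over levels in [-U, U].\<close>

lemma CVaR_tail_bounds:
  fixes N :: "real measure" and \<alpha> U :: real
  assumes N: "real_distribution N" and supp: "AE z in N. \<bar>z\<bar> \<le> U" and \<alpha>: "0 < \<alpha>" "\<alpha> \<le> 1"
  shows "CVaR \<alpha> (cdf N) \<le> c + (LINT z|N. max 0 (z - c)) / \<alpha>"
    and "\<exists>c\<in>{-U..U}. CVaR \<alpha> (cdf N) = c + (LINT z|N. max 0 (z - c)) / \<alpha>"
proof -
  interpret cdf_distribution N
    using N by (simp add: cdf_distribution_def)
  let ?L = "restrict_space lborel {0<..<1::real}"
  have V: "VaR (cdf N) = I"
    by (simp add: VaR_def fun_eq_iff)
  have [measurable]: "I \<in> borel_measurable ?L"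
    using measurable_CI by (simp cong: measurable_cong_sets restrict_space_sets_cong)
  have CU: "C U = 1"
  proof -
    have "AE z in N. z \<in> {..U}" using supp by eventually_elim auto
    then show ?thesis unfolding cdf_def by (subst (asm) prob_eq_1[symmetric]) auto
  qed
  have CL: "C y = 0" if "y < -U" for y
  proof -
    have "AE z in N. z \<notin> {..y}" using supp by eventually_elim (use that in auto)
    then show ?thesis unfolding cdf_def by (subst prob_eq_0) auto
  qed
  have I_upper: "I p \<le> U" if "0 < p" "p < 1" for p
    using pseudoinverse[OF that, of U] CU that by simp
  have I_lower: "-U \<le> I p" if "0 < p" "p < 1" for p
  proof (rule ccontr)
    assume "\<not> -U \<le> I p"
    then obtain y where y: "I p \<le> y" "y < -U" by (meson le_less_linear dense_le not_le_imp_less less_imp_le dense)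
    then have "p \<le> C y" using pseudoinverse[OF that, of y] by simp
    then show False using CL[OF y(2)] that by simp
  qed
  have U0: "-U \<le> U" using I_upper[of "1/2"] I_lower[of "1/2"] by simp
  interpret L: prob_space ?L
    by (auto simp add: emeasure_restrict_space space_restrict_space intro!: prob_spaceI)
  have int_fI: "integrable ?L (\<lambda>p. f (I p))" if f: "continuous_on UNIV f" for f :: "real \<Rightarrow> real"
  proof -
    have "compact (f ` {-U..U})"
      by (intro compact_continuous_image continuous_on_subset[OF f]) auto
    then obtain B where "\<forall>y\<in>f ` {-U..U}. norm y \<le> B"
      using compact_imp_bounded bounded_iff by metis
    then have B: "norm (f y) \<le> B" if "y \<in> {-U..U}" for y using that by auto
    have [measurable]: "f \<in> borel_measurable borel"
      using f by (simp add: borel_measurable_continuous_onI)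
    show ?thesis
      by (rule L.integrable_const_bound[where B = B])
        (auto intro!: AE_I2 B[unfolded real_norm_def] I_upper I_lower simp: space_restrict_space)
  qed
  define g where "g c p = indicator {1 - \<alpha><..<1} p * (I p - c)" for c p
  have A_sets: "{1 - \<alpha><..<1} \<in> sets ?L"
    using \<alpha> by (auto simp: sets_restrict_space_iff)
  have int_max: "(LINT z|N. max 0 (z - c)) = (LINT p|?L. max 0 (I p - c))" for c
  proof -
    have "(LINT z|N. max 0 (z - c)) = (LINT z|distr ?L borel I. max 0 (z - c))"
      by (simp only: distr_I_eq_M)
    then show ?thesis by (subst (asm) integral_distr) auto
  qed
  have int_g: "integrable ?L (g c)" for c
  proof (rule Bochner_Integration.integrable_bound[OF int_fI[of "\<lambda>y. y - c"]])
    have [measurable]: "indicator {1 - \<alpha><..<1} \<in> borel_measurable ?L"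
      using A_sets by (rule borel_measurable_indicator)
    show "g c \<in> borel_measurable ?L" unfolding g_def[abs_def] by measurable
  qed (auto intro!: continuous_intros AE_I2 simp: g_def indicator_def)
  have CVaR_g: "\<alpha> * CVaR \<alpha> (cdf N) = \<alpha> * c + (LINT p|?L. g c p)" for c
  proof -
    have "\<alpha> * CVaR \<alpha> (cdf N) = (LINT p|?L. g 0 p)"
      using \<alpha> unfolding CVaR_def V g_def set_lebesgue_integral_def
      by (subst integral_restrict_space) (auto intro!: Bochner_Integration.integral_cong simp: indicator_def)
    also have "\<dots> = (LINT p|?L. c * indicator {1 - \<alpha><..<1} p + g c p)"
      by (intro Bochner_Integration.integral_cong) (auto simp: g_def indicator_def)
    also have "\<dots> = c * (LINT p|?L. indicator {1 - \<alpha><..<1} p) + (LINT p|?L. g c p)"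
      using A_sets by (subst Bochner_Integration.integral_add) (auto simp: int_g L.emeasure_eq_measure)
    also have "(LINT p|?L. indicator {1 - \<alpha><..<1} p) = (LBINT p. indicator {1 - \<alpha><..<1} p :: real)"
    proof (subst integral_restrict_space)
      show "(LBINT p. indicator {0<..<1} p *\<^sub>R indicator {1 - \<alpha><..<1} p)
          = (LBINT p. indicator {1 - \<alpha><..<1} p :: real)"
        by (rule Bochner_Integration.integral_cong) (use \<alpha> in \<open>auto simp: indicator_def\<close>)
    qed simp
    also have "\<dots> = \<alpha>"
      using \<alpha> by simp
    finally show ?thesis by simp
  qed
  have int_m: "integrable ?L (\<lambda>p. max 0 (I p - c))" for c
    by (intro int_fI[of "\<lambda>y. max 0 (y - c)"] continuous_intros)
  have "(LINT p|?L. g c p) \<le> (LINT p|?L. max 0 (I p - c))"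
    by (intro integral_mono int_g int_m) (auto simp: g_def indicator_def)
  then have "\<alpha> * CVaR \<alpha> (cdf N) \<le> \<alpha> * (c + (LINT z|N. max 0 (z - c)) / \<alpha>)"
    using CVaR_g[of c] \<alpha> by (simp add: int_max distrib_left)
  then show "CVaR \<alpha> (cdf N) \<le> c + (LINT z|N. max 0 (z - c)) / \<alpha>"
    using \<alpha> by simp
  \<comment> \<open>For \<alpha> = 1 the quantile at 1 - \<alpha> = 0 would be the infimum of the
    whole real line, an unspecified value. The lower end -U of the support does the job: no positive
    part is cut off there.\<close>
  define c0 where "c0 = (if \<alpha> = 1 then -U else I (1 - \<alpha>))"
  have c0: "c0 \<in> {-U..U}" using I_lower[of "1-\<alpha>"] I_upper[of "1-\<alpha>"] \<alpha> U0 by (auto simp: c0_def)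
  have "g c0 p = max 0 (I p - c0)" if p: "0 < p" "p < 1" for p
  proof (cases "\<alpha> = 1")
    case True then show ?thesis using I_lower[OF p] p by (auto simp: g_def c0_def)
  next
    case False
    then have "p > 1 - \<alpha> \<Longrightarrow> I (1 - \<alpha>) \<le> I p" "p \<le> 1 - \<alpha> \<Longrightarrow> I p \<le> I (1 - \<alpha>)"
      using mono_I p \<alpha> by (auto simp: mono_on_def)
    then show ?thesis using p False by (auto simp: g_def c0_def indicator_def)
  qed
  then have "(LINT p|?L. g c0 p) = (LINT p|?L. max 0 (I p - c0))"
    by (intro Bochner_Integration.integral_cong) (auto simp: space_restrict_space)
  then have "\<alpha> * CVaR \<alpha> (cdf N) = \<alpha> * (c0 + (LINT z|N. max 0 (z - c0)) / \<alpha>)"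
    using CVaR_g[of c0] \<alpha> by (simp add: int_max distrib_left)
  then show "\<exists>c\<in>{-U..U}. CVaR \<alpha> (cdf N) = c + (LINT z|N. max 0 (z - c)) / \<alpha>"
    using \<alpha> c0 by (intro bexI[of _ c0]) auto
qed

text \<open>The Rockafellar-Uryasev objective in the level \<open>c\<close>.\<close>

definition tail_cost :: "real \<Rightarrow> ('w \<Rightarrow> real) \<Rightarrow> 'w measure \<Rightarrow> real \<Rightarrow> real" where
  "tail_cost \<alpha> Z M c = c + (LINT \<omega>|M. max 0 (Z \<omega> - c)) / \<alpha>"

text \<open>Used with a noise distribution for the true risk and with the uniform distribution on
  sample indices for the empirical one, so that both share the facts below.\<close>

locale bounded_cost = prob_space M for M :: "'w measure" +
  fixes Z :: "'w \<Rightarrow> real" and U \<alpha> :: real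
  assumes measurable_Z [measurable]: "Z \<in> borel_measurable M"
    and bounded_Z: "\<And>\<omega>. \<omega> \<in> space M \<Longrightarrow> \<bar>Z \<omega>\<bar> \<le> U"
    and level: "0 < \<alpha>" "\<alpha> \<le> 1"
begin

lemma integrable_Z: "integrable M Z"
  by (rule integrable_const_bound[where B = U]) (auto intro!: AE_I2 bounded_Z)

lemma integrable_excess: "integrable M (\<lambda>\<omega>. max 0 (Z \<omega> - c))"
  by (intro integrable_max integrable_Z Bochner_Integration.integrable_diff) auto

abbreviation "cvar \<equiv> CVaR \<alpha> (cdf (distr M borel Z))"

lemma cvar_le: "cvar \<le> tail_cost \<alpha> Z M c"
  and cvar_attained: "\<exists>c\<in>{-U..U}. cvar = tail_cost \<alpha> Z M c"
proof -
  have N: "real_distribution (distr M borel Z)" by simp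
  have supp: "AE z in distr M borel Z. \<bar>z\<bar> \<le> U"
    by (subst AE_distr_iff) (auto intro!: AE_I2 bounded_Z)
  have eq: "(LINT z|distr M borel Z. max 0 (z - c)) = (LINT \<omega>|M. max 0 (Z \<omega> - c))" for c
    by (subst integral_distr) auto
  show "cvar \<le> tail_cost \<alpha> Z M c"
    using CVaR_tail_bounds(1)[OF N supp level, of c] by (simp add: eq tail_cost_def)
  show "\<exists>c\<in>{-U..U}. cvar = tail_cost \<alpha> Z M c"
    using CVaR_tail_bounds(2)[OF N supp level] by (simp add: eq tail_cost_def)
qed

lemma abs_cvar_le: "\<bar>cvar\<bar> \<le> U"
proof -
  have "tail_cost \<alpha> Z M U = U"
    unfolding tail_cost_def
    by (subst Bochner_Integration.integral_cong[where g = "\<lambda>_. 0" and N = M]) (auto dest: bounded_Z)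
  then have "cvar \<le> U" using cvar_le[of U] by simp
  \<comment> \<open>CVaR dominates the mean: dividing a nonnegative excess by \<alpha> \<le> 1 can
    only enlarge it.\<close>
  moreover have "-U \<le> cvar"
  proof -
    obtain c where c: "cvar = tail_cost \<alpha> Z M c" using cvar_attained by auto
    have "-U \<le> (LINT \<omega>|M. Z \<omega>)"
      by (rule integral_ge_const[OF integrable_Z]) (use bounded_Z in \<open>force intro!: AE_I2\<close>)
    also have "\<dots> = c + (LINT \<omega>|M. Z \<omega> - c)"
      using integrable_Z by (simp add: prob_space)
    also have "(LINT \<omega>|M. Z \<omega> - c) \<le> (LINT \<omega>|M. max 0 (Z \<omega> - c))"
      by (intro integral_mono integrable_excess Bochner_Integration.integrable_diff integrable_Z) auto
    also have "\<dots> \<le> (LINT \<omega>|M. max 0 (Z \<omega> - c)) / \<alpha>"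
      using level mult_right_le_one_le[of "LINT \<omega>|M. max 0 (Z \<omega> - c)" \<alpha>] by (simp add: le_divide_eq)
    finally show ?thesis unfolding c by (simp add: tail_cost_def)
  qed
  ultimately show ?thesis by simp
qed

lemma tail_cost_lipschitz_level: "tail_cost \<alpha> Z M c \<le> tail_cost \<alpha> Z M c' + \<bar>c - c'\<bar> * (1 + 1 / \<alpha>)"
proof -
  have "(LINT \<omega>|M. max 0 (Z \<omega> - c)) \<le> (LINT \<omega>|M. max 0 (Z \<omega> - c') + \<bar>c - c'\<bar>)"
    by (intro integral_mono integrable_excess Bochner_Integration.integrable_add) auto
  also have "\<dots> = (LINT \<omega>|M. max 0 (Z \<omega> - c')) + \<bar>c - c'\<bar>"
    using integrable_excess by (simp add: prob_space)
  finally have "(LINT \<omega>|M. max 0 (Z \<omega> - c)) / \<alpha>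
      \<le> ((LINT \<omega>|M. max 0 (Z \<omega> - c')) + \<bar>c - c'\<bar>) / \<alpha>"
    using level by (intro divide_right_mono) auto
  then show ?thesis by (simp add: tail_cost_def add_divide_distrib distrib_left)
qed

text \<open>The objective is Lipschitz in the level, so rational levels come arbitrarily close to
  the minimum. Countability is the purpose: it makes CVaR a measurable function of decision and
  samples.\<close>

lemma cvar_eq_INF_rat: "cvar = (INF q::rat. tail_cost \<alpha> Z M (of_rat q))"
proof (rule antisym)
  show "cvar \<le> (INF q::rat. tail_cost \<alpha> Z M (of_rat q))"
    by (rule cINF_greatest) (auto intro: cvar_le)
  obtain c where c: "cvar = tail_cost \<alpha> Z M c" using cvar_attained by auto
  have bdd: "bdd_below (range (\<lambda>q::rat. tail_cost \<alpha> Z M (of_rat q)))"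
    by (rule bdd_belowI[of _ cvar]) (auto intro: cvar_le)
  show "(INF q::rat. tail_cost \<alpha> Z M (of_rat q)) \<le> cvar"
  proof (rule field_le_epsilon)
    fix e :: real assume e: "0 < e"
    define k where "k = e / (1 + 1 / \<alpha>)"
    have pos: "0 < 1 + 1 / \<alpha>" using level by (simp add: add_pos_pos)
    then have k: "0 < k" using e by (simp add: k_def)
    then obtain q where q: "c < of_rat q" "of_rat q < c + k"
      using of_rat_dense[of c "c + k"] by auto
    have "(INF q::rat. tail_cost \<alpha> Z M (of_rat q)) \<le> tail_cost \<alpha> Z M (of_rat q)"
      by (rule cINF_lower[OF bdd]) simp
    also have "\<dots> \<le> tail_cost \<alpha> Z M c + \<bar>of_rat q - c\<bar> * (1 + 1 / \<alpha>)"
      by (rule tail_cost_lipschitz_level)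
    also have "\<bar>of_rat q - c\<bar> * (1 + 1 / \<alpha>) \<le> k * (1 + 1 / \<alpha>)"
      using q pos by (intro mult_right_mono) auto
    also have "k * (1 + 1 / \<alpha>) = e" using pos by (simp add: k_def)
    finally show "(INF q::rat. tail_cost \<alpha> Z M (of_rat q)) \<le> cvar + e" using c by simp
  qed
qed

end

text \<open>The optimal level of \<open>Y\<close> is an admissible test level for \<open>Z\<close>.
  Hence excesses are compared only at levels in [-U, U], and the two costs may live on different
  probability spaces.\<close>

lemma cvar_diff_le:
  assumes P: "bounded_cost M Z U \<alpha>" and Q: "bounded_cost N Y U \<alpha>"
    and e: "\<And>c. c \<in> {-U..U} \<Longrightarrow> (LINT \<omega>|M. max 0 (Z \<omega> - c)) \<le> (LINT \<omega>|N. max 0 (Y \<omega> - c)) + e"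
  shows "CVaR \<alpha> (cdf (distr M borel Z)) \<le> CVaR \<alpha> (cdf (distr N borel Y)) + e / \<alpha>"
proof -
  interpret P: bounded_cost M Z U \<alpha> by fact
  interpret Q: bounded_cost N Y U \<alpha> by fact
  obtain c where c: "c \<in> {-U..U}" "Q.cvar = tail_cost \<alpha> Y N c" using Q.cvar_attained by auto
  have "P.cvar \<le> tail_cost \<alpha> Z M c" by (rule P.cvar_le)
  also have "\<dots> \<le> tail_cost \<alpha> Y N c + e / \<alpha>"
    using e[OF c(1)] P.level by (simp add: tail_cost_def add_divide_distrib[symmetric] divide_right_mono)
  finally show ?thesis using c(2) by simp
qed

text \<open>The map (z, c) \<mapsto> c + max 0 (z - c) / \<alpha> is jointly convex, so the convex
  combination of the two optimal levels is a good enough level for \<open>W\<close>.\<close>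

lemma cvar_convex_comb:
  assumes P: "bounded_cost M Z U \<alpha>" and Q: "bounded_cost M Y U \<alpha>" and R: "bounded_cost M W U \<alpha>"
    and ab: "0 \<le> s" "0 \<le> t" "s + t = 1"
    and conv: "\<And>\<omega>. \<omega> \<in> space M \<Longrightarrow> W \<omega> \<le> s * Z \<omega> + t * Y \<omega>"
  shows "CVaR \<alpha> (cdf (distr M borel W))
    \<le> s * CVaR \<alpha> (cdf (distr M borel Z)) + t * CVaR \<alpha> (cdf (distr M borel Y))"
proof -
  interpret P: bounded_cost M Z U \<alpha> by fact
  interpret Q: bounded_cost M Y U \<alpha> by fact
  interpret R: bounded_cost M W U \<alpha> by fact
  obtain c where c: "P.cvar = tail_cost \<alpha> Z M c" using P.cvar_attained by auto
  obtain c' where c': "Q.cvar = tail_cost \<alpha> Y M c'" using Q.cvar_attained by auto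
  have "R.cvar \<le> tail_cost \<alpha> W M (s * c + t * c')" by (rule R.cvar_le)
  also have "(LINT \<omega>|M. max 0 (W \<omega> - (s * c + t * c')))
      \<le> (LINT \<omega>|M. s * max 0 (Z \<omega> - c) + t * max 0 (Y \<omega> - c'))"
  proof (intro integral_mono R.integrable_excess Bochner_Integration.integrable_add
      integrable_mult_right P.integrable_excess Q.integrable_excess)
    fix \<omega> assume "\<omega> \<in> space M"
    from conv[OF this] have "W \<omega> - (s * c + t * c') \<le> s * (Z \<omega> - c) + t * (Y \<omega> - c')"
      by (simp add: algebra_simps)
    moreover have "s * (Z \<omega> - c) \<le> s * max 0 (Z \<omega> - c)" "t * (Y \<omega> - c') \<le> t * max 0 (Y \<omega> - c')"
      "0 \<le> s * max 0 (Z \<omega> - c)" "0 \<le> t * max 0 (Y \<omega> - c')"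
      using ab by (auto intro!: mult_left_mono)
    ultimately show "max 0 (W \<omega> - (s * c + t * c')) \<le> s * max 0 (Z \<omega> - c) + t * max 0 (Y \<omega> - c')"
      by simp
  qed
  then have "tail_cost \<alpha> W M (s * c + t * c') \<le> s * c + t * c' +
      (LINT \<omega>|M. s * max 0 (Z \<omega> - c) + t * max 0 (Y \<omega> - c')) / \<alpha>"
    using P.level by (simp add: tail_cost_def divide_right_mono)
  also have "\<dots> = s * tail_cost \<alpha> Z M c + t * tail_cost \<alpha> Y M c'"
    using P.integrable_excess Q.integrable_excess by (simp add: tail_cost_def algebra_simps add_divide_distrib)
  finally show ?thesis using c c' by simp
qed

lemma integral_diff_le_wasserstein1:
  fixes f :: "'b::metric_space \<Rightarrow> real"
  assumes K: "0 < K" and L: "0 < L" "L-lipschitz_on UNIV f" and int: "integrable D f" "integrable D' f"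
  shows "ereal ((LINT z|D. f z) - (LINT z|D'. f z)) \<le> ereal L * wasserstein1 K D D'"
proof -
  define g where "g z = f z / L" for z
  have "1-lipschitz_on UNIV g"
    using L by (simp add: lipschitz_on_def dist_real_def g_def diff_divide_distrib[symmetric] divide_simps mult.commute)
  then have g: "g \<in> {f. 1-lipschitz_on UNIV f \<and> integrable D f \<and> integrable D' f}"
    using int by (simp add: g_def[abs_def])
  have "ereal ((LINT z|D. g z) - (LINT z|D'. g z)) \<le> wasserstein1 1 D D'"
    unfolding wasserstein1_def using SUP_upper[OF g, of "\<lambda>f. ereal ((LINT z|D. f z) - (LINT z|D'. f z))"]
    by (simp add: one_ereal_def[symmetric])
  then have "ereal L * ereal ((LINT z|D. g z) - (LINT z|D'. g z)) \<le> ereal L * wasserstein1 1 D D'"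
    using L by (intro ereal_mult_left_mono) auto
  moreover have "(LINT z|D. f z) - (LINT z|D'. f z) = L * ((LINT z|D. g z) - (LINT z|D'. g z))"
    using L by (simp add: g_def diff_divide_distrib[symmetric])
  ultimately show ?thesis using wasserstein1_scale[OF K, of D D'] by simp
qed

lemma wasserstein1_nonneg: "0 < K \<Longrightarrow> 0 \<le> wasserstein1 K D D'"
  unfolding wasserstein1_def
  by (intro ereal_0_le_mult SUP_upper2[of "\<lambda>_. 0"]) (auto simp: lipschitz_on_def)

section \<open>A subgradient inequality for averages over the sphere\<close>

text \<open>The risk is convex and Lipschitz on \<open>X\<close> only, whereas the averaging
  argument translates its argument over the whole space. The McShane extension, the infimum of f q +
  L |x - q| over q, keeps convexity because this expression is jointly convex in (x, q).\<close>

lemma convex_lipschitz_extension: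
  fixes f :: "'a::real_normed_vector \<Rightarrow> real"
  assumes conv: "convex_on S f" and lip: "L-lipschitz_on S f" and ne: "S \<noteq> {}"
  obtains g where "convex_on UNIV g" "L-lipschitz_on UNIV g" "\<And>x. x \<in> S \<Longrightarrow> g x = f x"
proof
  have L: "0 \<le> L" using lip by (rule lipschitz_on_nonneg)
  define g where "g x = (INF q\<in>S. f q + L * norm (x - q))" for x
  have lower: "f p - L * norm (x - p) \<le> f q + L * norm (x - q)" if "p \<in> S" "q \<in> S" for x p q
  proof -
    have "f p - f q \<le> L * norm (p - q)"
      using lipschitz_onD[OF lip that] by (simp add: dist_norm)
    also have "\<dots> \<le> L * (norm (x - p) + norm (x - q))"
      using norm_triangle_ineq4[of "x - q" "x - p"] L by (intro mult_left_mono) auto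
    finally show ?thesis by (simp add: algebra_simps)
  qed
  obtain p where p: "p \<in> S" using ne by auto
  have bdd: "bdd_below ((\<lambda>q. f q + L * norm (x - q)) ` S)" for x
    by (rule bdd_belowI2[of _ "f p - L * norm (x - p)"]) (rule lower[OF p])
  have g_le: "g x \<le> f q + L * norm (x - q)" if "q \<in> S" for x q
    unfolding g_def by (rule cINF_lower[OF bdd that])
  have g_approx: "\<exists>q\<in>S. f q + L * norm (x - q) \<le> g x + e" if "0 < e" for x e
  proof -
    have "g x < g x + e" using that by simp
    then show ?thesis
      unfolding g_def cINF_less_iff[OF ne bdd] by (meson less_imp_le)
  qed
  show "g x = f x" if "x \<in> S" for x
  proof (rule antisym)
    show "g x \<le> f x" using g_le[OF that, of x] by simp
    show "f x \<le> g x"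
      unfolding g_def using lower[OF that, of _ x] by (intro cINF_greatest ne) auto
  qed
  show "L-lipschitz_on UNIV g"
  proof (rule lipschitz_onI)
    fix x y :: 'a
    have *: "g x \<le> g y + L * norm (x - y)" for x y
    proof (rule field_le_epsilon)
      fix e :: real assume "0 < e"
      then obtain q where q: "q \<in> S" "f q + L * norm (y - q) \<le> g y + e" using g_approx by blast
      have "L * norm (x - q) \<le> L * (norm (x - y) + norm (y - q))"
        using norm_triangle_ineq[of "x - y" "y - q"] L by (intro mult_left_mono) auto
      then show "g x \<le> g y + L * norm (x - y) + e"
        using g_le[OF q(1), of x] q(2) by (simp add: algebra_simps)
    qed
    show "dist (g x) (g y) \<le> L * dist x y"
      using *[of x y] *[of y x] by (simp add: dist_real_def dist_norm norm_minus_commute abs_le_iff)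
  qed (rule L)
  show "convex_on UNIV g"
  proof (rule convex_onI)
    fix t :: real and x y :: 'a assume t: "0 < t" "t < 1"
    show "g ((1 - t) *\<^sub>R x + t *\<^sub>R y) \<le> (1 - t) * g x + t * g y"
    proof (rule field_le_epsilon)
      fix e :: real assume e: "0 < e"
      obtain q where q: "q \<in> S" "f q + L * norm (x - q) \<le> g x + e" using g_approx[OF e] by blast
      obtain q' where q': "q' \<in> S" "f q' + L * norm (y - q') \<le> g y + e" using g_approx[OF e] by blast
      let ?q = "(1 - t) *\<^sub>R q + t *\<^sub>R q'"
      have "convex S" using conv by (rule convex_on_imp_convex)
      then have "?q \<in> S" using q q' t by (simp add: convexD)
      have "norm (((1 - t) *\<^sub>R x + t *\<^sub>R y) - ?q) = norm ((1 - t) *\<^sub>R (x - q) + t *\<^sub>R (y - q'))"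
        by (simp add: algebra_simps)
      also have "\<dots> \<le> (1 - t) * norm (x - q) + t * norm (y - q')"
        using t by (intro order_trans[OF norm_triangle_ineq]) auto
      finally have n: "norm (((1 - t) *\<^sub>R x + t *\<^sub>R y) - ?q) \<le> (1 - t) * norm (x - q) + t * norm (y - q')" .
      have "g ((1 - t) *\<^sub>R x + t *\<^sub>R y) \<le> f ?q + L * norm (((1 - t) *\<^sub>R x + t *\<^sub>R y) - ?q)"
        by (rule g_le) fact
      also have "\<dots> \<le> ((1 - t) * f q + t * f q') + L * ((1 - t) * norm (x - q) + t * norm (y - q'))"
        using convex_onD[OF conv, of t q q'] t q q' mult_left_mono[OF n L] by simp
      also have "\<dots> = (1 - t) * (f q + L * norm (x - q)) + t * (f q' + L * norm (y - q'))"
        by (simp add: algebra_simps)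
      also have "\<dots> \<le> (1 - t) * (g x + e) + t * (g y + e)"
        using q(2) q'(2) t by (intro add_mono[OF mult_left_mono mult_left_mono]) auto
      finally show "g ((1 - t) *\<^sub>R x + t *\<^sub>R y) \<le> (1 - t) * g x + t * g y + e"
        by (simp add: algebra_simps)
    qed
  qed simp
qed

section \<open>Radial integrals and the uniform distribution on the sphere\<close>

text \<open>The only piece of polar coordinates needed: \<open>sgn\<close> is invariant under
  positive scaling, so the radius enters through the Jacobian alone.\<close>

lemma integral_ball_radial:
  fixes f :: "'a::euclidean_space \<Rightarrow> real"
  assumes [measurable]: "f \<in> borel_measurable borel" and \<rho>: "0 < \<rho>"
  shows "(LBINT v. indicator (ball 0 \<rho>) v * f (sgn v)) = \<rho> ^ DIM('a) * (LBINT v. indicator (ball 0 1) v * f (sgn v))"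
proof -
  have [measurable]: "(\<lambda>v. indicator (ball 0 \<rho>) v * f (sgn v)) \<in> borel_measurable borel"
    by (intro borel_measurable_times borel_measurable_indicator) auto
  have "(LBINT v. indicator (ball 0 \<rho>) v * f (sgn v)) =
      integral\<^sup>L (density (distr lborel borel (\<lambda>v. 0 + \<rho> *\<^sub>R v)) (\<lambda>_. \<bar>\<rho>\<bar> ^ DIM('a)))
        (\<lambda>v. indicator (ball 0 \<rho>) v * f (sgn v))"
    using \<rho> by (subst lborel_affine[of \<rho> 0]) auto
  also have "\<dots> = (LBINT v. \<rho> ^ DIM('a) * (indicator (ball 0 \<rho>) (\<rho> *\<^sub>R v) * f (sgn (\<rho> *\<^sub>R v))))"
    using \<rho> by (subst integral_density[where g = "\<lambda>_. \<bar>\<rho>\<bar> ^ DIM('a)"]) (simp_all add: integral_distr)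
  also have "\<dots> = (LBINT v. \<rho> ^ DIM('a) * (indicator (ball 0 1) v * f (sgn v)))"
    using \<rho> by (intro Bochner_Integration.integral_cong) (auto simp: indicator_def sgn_scaleR)
  finally show ?thesis by simp
qed

lemma measure_unit_ball_pos: "0 < measure lborel (ball (0::'a::euclidean_space) 1)"
  using content_ball_pos[of 1 "0::'a"] by simp

lemma prob_space_uniform_sphere: "prob_space (uniform_sphere :: 'a::euclidean_space measure)"
proof -
  have "emeasure lborel (ball (0::'a) 1) \<noteq> 0" "emeasure lborel (ball (0::'a) 1) \<noteq> \<infinity>"
    using measure_unit_ball_pos[where 'a = 'a] emeasure_lborel_ball_finite[of "0::'a" 1]
    by (auto simp: measure_def)
  then interpret prob_space "uniform_measure lborel (ball (0::'a) 1)"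
    by (rule prob_space_uniform_measure)
  show ?thesis
    unfolding uniform_sphere_def by (rule prob_space_distr) simp
qed

lemma sets_uniform_sphere [measurable_cong, simp]: "sets uniform_sphere = sets borel"
  by (simp add: uniform_sphere_def)

lemma space_uniform_sphere [simp]: "space uniform_sphere = UNIV"
  by (simp add: uniform_sphere_def)

lemma integral_uniform_sphere:
  fixes f :: "'a::euclidean_space \<Rightarrow> real"
  assumes [measurable]: "f \<in> borel_measurable borel"
  shows "(LBINT v. indicator (ball 0 1) v * f (sgn v)) =
    measure lborel (ball (0::'a) 1) * (LINT u|uniform_sphere. f u)"
proof -
  let ?m = "measure lborel (ball (0::'a) 1)"
  have fin: "emeasure lborel (ball (0::'a) 1) = ennreal ?m"
    using emeasure_lborel_ball_finite[of "0::'a" 1] by (simp add: emeasure_eq_ennreal_measure)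
  have "uniform_measure lborel (ball (0::'a) 1) = density lborel (\<lambda>v. ennreal (indicator (ball 0 1) v / ?m))"
    unfolding uniform_measure_def fin using measure_unit_ball_pos[where 'a = 'a]
    by (intro density_cong) (auto simp: indicator_def divide_ennreal ennreal_1[symmetric] simp del: ennreal_1)
  then have "(LINT u|uniform_sphere. f u) = (LBINT v. (indicator (ball 0 1) v / ?m) * f (sgn v))"
    unfolding uniform_sphere_def
    by (subst integral_distr, simp, simp, simp, subst integral_density)
      (auto intro!: borel_measurable_divide borel_measurable_indicator simp del: indicator_simps)
  also have "\<dots> = (LBINT v. indicator (ball 0 1) v * f (sgn v)) / ?m"
    by simp
  finally show ?thesis using measure_unit_ball_pos[where 'a = 'a] by simp
qed

text \<open>The inequality also covers the centre of the ball, where \<open>sgn 0 = 0\<close>. It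
  suffices for boundedness of integrands and for keeping perturbed points inside
  \<open>X\<close>.\<close>

lemma AE_uniform_sphere: "AE u in (uniform_sphere :: 'a::euclidean_space measure). norm u \<le> 1"
  unfolding uniform_sphere_def by (subst AE_distr_iff) (auto intro!: AE_I2 simp: norm_sgn)

lemma integrable_bounded_ball:
  fixes f :: "'a::euclidean_space \<Rightarrow> real"
  assumes "f \<in> borel_measurable borel" "\<And>v. norm v \<le> R \<Longrightarrow> \<bar>f v\<bar> \<le> B" "\<And>v. R < norm v \<Longrightarrow> f v = 0"
  shows "integrable lborel f"
  by (rule integrableI_bounded_set[of "cball 0 R" _ _ B])
    (use assms emeasure_lborel_cball_finite[of "0::'a" R] in \<open>auto intro!: AE_I2\<close>)

text \<open>Here \<open>w\<close> is a radial cutoff: 1 up to radius 1 - \<epsilon>, then linear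
  down to 0 at radius 1, with gradient - sgn v / \<epsilon> in the shell. Formally, convexity bounds
  G v - G (v - k) by the derivative of G along k, and integration by parts moves the derivative to
  \<open>w\<close>. As G need not be differentiable, difference quotients are used and translation
  invariance replaces integration by parts.\<close>

lemma smoothed_subgradient_shell:
  fixes G :: "'a::euclidean_space \<Rightarrow> real" and k :: 'a
  assumes conv: "convex_on UNIV G" and lip: "\<Lambda>-lipschitz_on UNIV G" and \<epsilon>: "0 < \<epsilon>" "\<epsilon> < 1"
  defines "w \<equiv> \<lambda>v. max 0 (min 1 ((1 - norm v) / \<epsilon>))"
  shows "(LBINT v. w v * (G v - G (v - k))) \<le>
    (LBINT v. (indicator (ball 0 1) v - indicator (ball 0 (1 - \<epsilon>)) v) * (G v * (sgn v \<bullet> k)) / \<epsilon>)"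
proof -
  have \<Lambda>: "0 \<le> \<Lambda>" using lip by (rule lipschitz_on_nonneg)
  have cG: "continuous_on UNIV G" using lip by (rule lipschitz_on_continuous_on)
  have [measurable]: "G \<in> borel_measurable borel" using cG by (rule borel_measurable_continuous_onI)
  have [measurable]: "w \<in> borel_measurable borel" unfolding w_def by measurable
  have G_bound: "\<bar>G v\<bar> \<le> \<bar>G 0\<bar> + \<Lambda> * norm v" for v
    using lipschitz_onD[OF lip, of v 0] by (simp add: dist_real_def)
  have w01: "0 \<le> w v" "w v \<le> 1" for v by (auto simp: w_def)
  have w_out: "w v = 0" if "1 \<le> norm v" for v using that \<epsilon> by (simp add: w_def divide_le_0_iff min_def max_def zero_le_divide_iff)
  have w_in: "w v = 1" if "norm v \<le> 1 - \<epsilon>" for v using that \<epsilon> by (simp add: w_def le_divide_eq)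
  have w_mid: "w v = (1 - norm v) / \<epsilon>" if "1 - \<epsilon> \<le> norm v" "norm v \<le> 1" for v
    using that \<epsilon> by (simp add: w_def divide_le_eq)
  have w_lip: "\<bar>w v - w v'\<bar> \<le> norm (v - v') / \<epsilon>" for v v'
  proof -
    have clamp: "\<bar>max 0 (min 1 a) - max 0 (min 1 b)\<bar> \<le> \<bar>a - b\<bar>" for a b :: real
      by (auto simp: max_def min_def)
    have "\<bar>w v - w v'\<bar> \<le> \<bar>(1 - norm v) / \<epsilon> - (1 - norm v') / \<epsilon>\<bar>"
      unfolding w_def by (rule clamp)
    also have "\<dots> = \<bar>norm v' - norm v\<bar> / \<epsilon>"
      using \<epsilon> by (simp add: diff_divide_distrib[symmetric])
    also have "\<dots> \<le> norm (v - v') / \<epsilon>"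
      using \<epsilon> norm_triangle_ineq3[of v' v] by (intro divide_right_mono) (auto simp: norm_minus_commute)
    finally show ?thesis .
  qed
  have int_w: "integrable lborel (\<lambda>v. w v * G (v - z))" for z
  proof (rule integrable_bounded_ball[where R = 1 and B = "\<bar>G 0\<bar> + \<Lambda> * (1 + norm z)"])
    fix v :: 'a assume "norm v \<le> 1"
    then have "norm (v - z) \<le> 1 + norm z" using norm_triangle_ineq4[of v z] by simp
    then have "\<bar>G (v - z)\<bar> \<le> \<bar>G 0\<bar> + \<Lambda> * (1 + norm z)"
      using G_bound[of "v - z"] mult_left_mono[OF _ \<Lambda>] by (meson add_left_mono order_trans)
    then show "\<bar>w v * G (v - z)\<bar> \<le> \<bar>G 0\<bar> + \<Lambda> * (1 + norm z)"
      using mult_mono[OF w01(2)[of v] _ _ , of "\<bar>G (v - z)\<bar>"] w01(1)[of v] by (simp add: abs_mult)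
  qed (auto simp: w_out)
  define t where "t n = 1 / (real n + 1)" for n :: nat
  have t: "0 < t n" "t n \<le> 1" for n by (auto simp: t_def)
  define q where "q n v = (w v - w (v + t n *\<^sub>R k)) / t n * G v" for n v
  have [measurable]: "q n \<in> borel_measurable borel" for n unfolding q_def[abs_def] by measurable
  have shift: "(LBINT v. w (v + z) * G v) = (LBINT v. w v * G (v - z))"
    and int_shift: "integrable lborel (\<lambda>v. w (v + z) * G v)" for z
  proof -
    have "(LBINT v. w v * G (v - z)) = integral\<^sup>L (distr lborel borel ((+) z)) (\<lambda>v. w v * G (v - z))"
      by (simp add: lborel_distr_plus)
    also have "\<dots> = (LBINT v. w (v + z) * G v)"
      by (subst integral_distr) (auto simp: add.commute)
    finally show "(LBINT v. w (v + z) * G v) = (LBINT v. w v * G (v - z))" by simp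
    have "integrable (distr lborel borel ((+) z)) (\<lambda>v. w v * G (v - z))"
      using int_w[of z] by (simp add: lborel_distr_plus)
    then show "integrable lborel (\<lambda>v. w (v + z) * G v)"
      by (subst (asm) integrable_distr_eq) (auto simp: add.commute)
  qed
  \<comment> \<open>By convexity the backward quotient of step \<open>t n\<close> dominates the one
    of step 1; a translation then carries the shift from \<open>G\<close> over to
    \<open>w\<close>.\<close>
  have le: "(LBINT v. w v * (G v - G (v - k))) \<le> (LBINT v. q n v)" for n
  proof -
    have "(LBINT v. w v * (G v - G (v - k))) \<le> (LBINT v. (w v * G v - w v * G (v - t n *\<^sub>R k)) / t n)"
    proof (rule integral_mono)
      fix v :: 'a
      have "v - t n *\<^sub>R k = (1 - t n) *\<^sub>R v + t n *\<^sub>R (v - k)" by (simp add: algebra_simps)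
      then have "G (v - t n *\<^sub>R k) \<le> (1 - t n) * G v + t n * G (v - k)"
        using convex_onD[OF conv, of "t n" v "v - k"] t[of n] by (simp add: less_imp_le)
      then have "G v - G (v - k) \<le> (G v - G (v - t n *\<^sub>R k)) / t n"
        using t[of n] by (simp add: le_divide_eq algebra_simps)
      then have "w v * (G v - G (v - k)) \<le> w v * ((G v - G (v - t n *\<^sub>R k)) / t n)"
        using w01 by (intro mult_left_mono) auto
      then show "w v * (G v - G (v - k)) \<le> (w v * G v - w v * G (v - t n *\<^sub>R k)) / t n"
        by (simp add: algebra_simps)
    next
      show "integrable lborel (\<lambda>v. w v * (G v - G (v - k)))"
        using Bochner_Integration.integrable_diff[OF int_w[of 0] int_w[of k]] by (simp add: right_diff_distrib)
    qed (use int_w[of 0] int_w in \<open>auto intro!: Bochner_Integration.integrable_diff\<close>)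
    also have "\<dots> = ((LBINT v. w v * G v) - (LBINT v. w v * G (v - t n *\<^sub>R k))) / t n"
      using int_w[of 0] int_w by (simp add: Bochner_Integration.integral_diff)
    also have "\<dots> = (LBINT v. (w v * G v - w (v + t n *\<^sub>R k) * G v) / t n)"
      unfolding shift[symmetric] using int_w[of 0] int_shift by (simp add: Bochner_Integration.integral_diff)
    also have "\<dots> = (LBINT v. q n v)"
      by (intro Bochner_Integration.integral_cong) (auto simp: q_def left_diff_distrib diff_divide_distrib)
    finally show ?thesis .
  qed
  let ?s = "\<lambda>v. (indicator (ball 0 1) v - indicator (ball 0 (1 - \<epsilon>)) v) * (G v * (sgn v \<bullet> k)) / \<epsilon>"
  have t_lim: "t \<longlonglongrightarrow> 0"
    using LIMSEQ_inverse_real_of_nat unfolding t_def[abs_def] by (simp add: inverse_eq_divide add.commute)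
  \<comment> \<open>The excluded radii are the kinks of \<open>w\<close>; these two spheres have
    measure zero.\<close>
  have lim: "(\<lambda>n. q n v) \<longlonglongrightarrow> ?s v" if v: "norm v \<noteq> 1" "norm v \<noteq> 1 - \<epsilon>" for v
  proof -
    have "(\<lambda>n. v + t n *\<^sub>R k) \<longlonglongrightarrow> v + 0 *\<^sub>R k" by (intro tendsto_intros t_lim)
    then have nl: "(\<lambda>n. norm (v + t n *\<^sub>R k)) \<longlonglongrightarrow> norm v" by (simp add: tendsto_norm)
    consider "norm v < 1 - \<epsilon>" | "1 < norm v" | "1 - \<epsilon> < norm v" "norm v < 1" using v by linarith
    then show ?thesis
    proof cases
      case 1
      have "eventually (\<lambda>n. q n v = 0) sequentially"
        using order_tendstoD(2)[OF nl 1] by eventually_elim (use 1 in \<open>simp add: q_def w_in\<close>)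
      then have "(\<lambda>n. q n v) \<longlonglongrightarrow> 0" by (rule tendsto_eventually)
      then show ?thesis using 1 \<epsilon> by (simp add: indicator_def)
    next
      case 2
      have "eventually (\<lambda>n. q n v = 0) sequentially"
        using order_tendstoD(1)[OF nl 2] by eventually_elim (use 2 in \<open>simp add: q_def w_out\<close>)
      then have "(\<lambda>n. q n v) \<longlonglongrightarrow> 0" by (rule tendsto_eventually)
      then show ?thesis using 2 \<epsilon> by (simp add: indicator_def)
    next
      case 3
      then have v0: "v \<noteq> 0" using \<epsilon> by auto
      have "((\<lambda>x. norm (v + x *\<^sub>R k)) has_derivative (\<lambda>x. sgn v \<bullet> (x *\<^sub>R k))) (at 0)"
      proof -
        have 1: "((\<lambda>x. v + x *\<^sub>R k) has_derivative (\<lambda>x. x *\<^sub>R k)) (at (0::real))"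
          by (auto intro!: derivative_eq_intros)
        have 2: "(norm has_derivative (\<lambda>h. h \<bullet> sgn v)) (at (v + 0 *\<^sub>R k))"
          using has_derivative_norm[OF v0] by simp
        show ?thesis
          using has_derivative_compose[OF 1 2] by (simp add: inner_commute)
      qed
      then have "((\<lambda>x. norm (v + x *\<^sub>R k)) has_field_derivative (sgn v \<bullet> k)) (at 0)"
        by (simp add: has_field_derivative_def mult_commute_abs)
      then have "((\<lambda>x. (norm (v + x *\<^sub>R k) - norm v) / x) \<longlongrightarrow> sgn v \<bullet> k) (at 0)"
        unfolding has_field_derivative_iff by simp
      moreover have "filterlim t (at 0) sequentially"
        using t_lim t(1) by (intro filterlim_atI) (auto intro!: always_eventually simp: less_imp_neq[symmetric])
      ultimately have "(\<lambda>n. (norm (v + t n *\<^sub>R k) - norm v) / t n) \<longlonglongrightarrow> sgn v \<bullet> k"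
        by (rule filterlim_compose)
      then have "(\<lambda>n. (norm (v + t n *\<^sub>R k) - norm v) / t n * G v / \<epsilon>) \<longlonglongrightarrow> (sgn v \<bullet> k) * G v / \<epsilon>"
        using \<epsilon> by (intro tendsto_intros) auto
      moreover have "eventually (\<lambda>n. q n v = (norm (v + t n *\<^sub>R k) - norm v) / t n * G v / \<epsilon>) sequentially"
        using order_tendstoD(1)[OF nl 3(1)] order_tendstoD(2)[OF nl 3(2)]
      proof eventually_elim
        case (elim n)
        have "w v - w (v + t n *\<^sub>R k) = (norm (v + t n *\<^sub>R k) - norm v) / \<epsilon>"
          using 3 elim by (simp add: w_mid diff_divide_distrib[symmetric])
        then show ?case by (simp add: q_def)
      qed
      ultimately have "(\<lambda>n. q n v) \<longlonglongrightarrow> (sgn v \<bullet> k) * G v / \<epsilon>"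
        by (subst tendsto_cong) auto
      then show ?thesis using 3 by (simp add: indicator_def mult.commute)
    qed
  qed
  have null: "AE v in (lborel :: 'a measure). norm v \<noteq> c" for c :: real
  proof -
    have "sphere (0::'a) c \<in> null_sets lborel"
      using negligible_sphere[of "0::'a" c] by (auto simp: null_sets_completion_iff negligible_iff_null_sets)
    then show ?thesis by (rule AE_I') auto
  qed
  \<comment> \<open>A dominating function: \<open>w\<close> is Lipschitz with constant 1 /
    \<epsilon>, so the quotient is at most norm k / \<epsilon>, and since \<open>t n\<close> \<le> 1
    both \<open>w\<close> terms vanish beyond radius 1 + norm k.\<close>
  let ?B = "\<lambda>v::'a. indicator (cball 0 (1 + norm k)) v * (norm k / \<epsilon> * (\<bar>G 0\<bar> + \<Lambda> * (1 + norm k)))"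
  have "(\<lambda>n. LBINT v. q n v) \<longlonglongrightarrow> (LBINT v. ?s v)"
  proof (rule integral_dominated_convergence)
    show "integrable lborel ?B"
      using emeasure_lborel_cball_finite[of "0::'a" "1 + norm k"]
      by (intro integrable_mult_left integrable_real_indicator) auto
    show "AE v in lborel. (\<lambda>n. q n v) \<longlonglongrightarrow> ?s v"
      using null[of 1] null[of "1 - \<epsilon>"] by eventually_elim (rule lim)
    show "AE v in lborel. norm (q n v) \<le> ?B v" for n
    proof (rule AE_I2)
      fix v :: 'a
      show "norm (q n v) \<le> ?B v"
      proof (cases "norm v \<le> 1 + norm k")
        case True
        have "\<bar>w v - w (v + t n *\<^sub>R k)\<bar> \<le> t n * norm k / \<epsilon>"
          using w_lip[of v "v + t n *\<^sub>R k"] t[of n] by simp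
        then have "\<bar>(w v - w (v + t n *\<^sub>R k)) / t n\<bar> \<le> norm k / \<epsilon>"
          using t[of n] by (simp add: abs_divide divide_le_eq mult.commute)
        moreover have "\<bar>G v\<bar> \<le> \<bar>G 0\<bar> + \<Lambda> * (1 + norm k)"
          using G_bound[of v] mult_left_mono[OF True \<Lambda>] by simp
        ultimately have "\<bar>(w v - w (v + t n *\<^sub>R k)) / t n\<bar> * \<bar>G v\<bar> \<le> norm k / \<epsilon> * (\<bar>G 0\<bar> + \<Lambda> * (1 + norm k))"
          using \<epsilon> by (intro mult_mono) auto
        then show ?thesis using True by (simp add: q_def abs_mult)
      next
        case False
        have "norm v \<le> norm (v + t n *\<^sub>R k) + norm k"
        proof -
          have "norm v \<le> norm (v + t n *\<^sub>R k) + norm (t n *\<^sub>R k)"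
            using norm_triangle_ineq4[of "v + t n *\<^sub>R k" "t n *\<^sub>R k"] by simp
          also have "norm (t n *\<^sub>R k) \<le> norm k"
            using t[of n] by (simp add: mult_left_le_one_le)
          finally show ?thesis by simp
        qed
        then have "q n v = 0" using False w_out[of v] w_out[of "v + t n *\<^sub>R k"] norm_ge_zero[of k]
          by (simp add: q_def del: norm_ge_zero)
        then show ?thesis using False by simp
      qed
    qed
    show "?s \<in> borel_measurable lborel"
      by (intro borel_measurable_divide borel_measurable_times borel_measurable_diff borel_measurable_indicator) auto
  qed auto
  then show ?thesis by (rule LIMSEQ_le_const) (use le in auto)
qed

text \<open>The limit \<epsilon> \<rightarrow> 0 of the shell inequality, divided by the volume of
  the ball. \<open>\<kappa> \<epsilon>\<close> is the fraction of the volume lying in the shell, and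
  \<kappa> \<epsilon> / \<epsilon> tends to the dimension; this is the origin of the factor
  \<open>DIM('a)\<close>. The loss 2 \<Lambda> pays for moving from v and v - k to the centres 0 and
  - k, at most \<Lambda> each inside the unit ball.\<close>

lemma smoothed_subgradient:
  fixes G :: "'a::euclidean_space \<Rightarrow> real" and k :: 'a
  assumes conv: "convex_on UNIV G" and lip: "\<Lambda>-lipschitz_on UNIV G"
  shows "G 0 - G (- k) - 2 * \<Lambda> \<le> real DIM('a) * (LINT u|uniform_sphere. G u * (u \<bullet> k))"
proof -
  let ?d = "DIM('a)" and ?m = "measure lborel (ball (0::'a) 1)"
  let ?I = "LINT u|uniform_sphere. G u * (u \<bullet> k)"
  define a where "a = G 0 - G (- k) - 2 * \<Lambda>"
  define \<kappa> where "\<kappa> \<epsilon> = 1 - (1 - \<epsilon>) ^ ?d" for \<epsilon> :: real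
  have \<Lambda>: "0 \<le> \<Lambda>" using lip by (rule lipschitz_on_nonneg)
  have m: "0 < ?m" by (rule measure_unit_ball_pos)
  have cG: "continuous_on UNIV G" using lip by (rule lipschitz_on_continuous_on)
  have [measurable]: "G \<in> borel_measurable borel" using cG by (rule borel_measurable_continuous_onI)
  interpret S: prob_space "uniform_sphere :: 'a measure" by (rule prob_space_uniform_sphere)
  have G_bound: "\<bar>G v\<bar> \<le> \<bar>G 0\<bar> + \<Lambda> * norm v" for v
    using lipschitz_onD[OF lip, of v 0] by (simp add: dist_real_def)
  have int_S: "integrable uniform_sphere (\<lambda>u. G u * (u \<bullet> k))"
  proof (rule S.integrable_const_bound[where B = "(\<bar>G 0\<bar> + \<Lambda>) * norm k"])
    show "AE u in uniform_sphere. norm (G u * (u \<bullet> k)) \<le> (\<bar>G 0\<bar> + \<Lambda>) * norm k"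
      using AE_uniform_sphere
    proof eventually_elim
      fix u :: 'a assume u: "norm u \<le> 1"
      have "\<bar>G u\<bar> \<le> \<bar>G 0\<bar> + \<Lambda>" using G_bound[of u] mult_left_mono[OF u \<Lambda>] by simp
      moreover have "\<bar>u \<bullet> k\<bar> \<le> norm k"
        using Cauchy_Schwarz_ineq2[of u k] mult_right_mono[OF u norm_ge_zero[of k]] by simp
      ultimately show "norm (G u * (u \<bullet> k)) \<le> (\<bar>G 0\<bar> + \<Lambda>) * norm k"
        by (simp add: abs_mult mult_mono)
    qed
  qed simp
  \<comment> \<open>Both corrections vanish with \<epsilon>: |a| \<kappa> \<epsilon> accounts for
    the mass missing where w < 1, and \<Lambda> \<epsilon> norm k for evaluating \<open>G\<close> at
    \<open>sgn v\<close> in place of a point v of the shell.\<close>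
  have key: "a - \<bar>a\<bar> * \<kappa> \<epsilon> \<le> \<kappa> \<epsilon> / \<epsilon> * (?I + \<Lambda> * \<epsilon> * norm k)" if \<epsilon>: "0 < \<epsilon>" "\<epsilon> < 1" for \<epsilon>
  proof -
    define w where "w v = max 0 (min 1 ((1 - norm v) / \<epsilon>))" for v :: 'a
    define f where "f u = G u * (u \<bullet> k) + \<Lambda> * \<epsilon> * norm k" for u :: 'a
    define sh :: "'a \<Rightarrow> real" where "sh v = indicator (ball 0 1) v - indicator (ball 0 (1 - \<epsilon>)) v" for v
    have w_out: "w v = 0" if "1 \<le> norm v" for v using that \<epsilon> by (simp add: w_def divide_le_0_iff min_def max_def zero_le_divide_iff)
    have w_in: "w v = 1" if "norm v \<le> 1 - \<epsilon>" for v using that \<epsilon> by (simp add: w_def le_divide_eq)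
    have w01: "0 \<le> w v" "w v \<le> 1" for v by (auto simp: w_def)
    have sh_eq: "sh v = (if 1 - \<epsilon> \<le> norm v \<and> norm v < 1 then 1 else 0)" for v
      using \<epsilon> by (auto simp: sh_def indicator_def)
    have [measurable]: "w \<in> borel_measurable borel" unfolding w_def[abs_def] by measurable
    have [measurable]: "f \<in> borel_measurable borel" unfolding f_def[abs_def] by measurable
    have [measurable]: "sh \<in> borel_measurable borel" unfolding sh_def[abs_def]
      by (intro borel_measurable_diff borel_measurable_indicator) auto
    have int_w: "integrable lborel w"
      by (rule integrable_bounded_ball[where R = 1 and B = 1]) (auto simp: w_out w01)
    define B where "B = \<bar>G 0\<bar> + \<Lambda> * (1 + norm k)"
    have G_B: "\<bar>G v\<bar> \<le> B" if "norm v \<le> 1 + norm k" for v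
      using G_bound[of v] mult_left_mono[OF that \<Lambda>] by (simp add: B_def)
    have B0: "0 \<le> B" using \<Lambda> by (simp add: B_def)
    have u_k: "\<bar>u \<bullet> k\<bar> \<le> norm k" if "norm u \<le> 1" for u :: 'a
      using Cauchy_Schwarz_ineq2[of u k] mult_right_mono[OF that norm_ge_zero[of k]] by simp
    have n_sgn: "norm (sgn v) \<le> 1" for v :: 'a by (simp add: norm_sgn)
    define B' where "B' = B * norm k + \<Lambda> * \<epsilon> * norm k"
    have B'0: "0 \<le> B'" using B0 \<Lambda> \<epsilon> by (simp add: B'_def)
    have f_B: "\<bar>f (sgn v)\<bar> \<le> B'" for v
    proof -
      have "\<bar>G (sgn v)\<bar> * \<bar>sgn v \<bullet> k\<bar> \<le> B * norm k"
        using n_sgn[of v] norm_ge_zero[of k] by (intro mult_mono G_B u_k B0) (auto intro: order_trans)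
      then have "\<bar>G (sgn v) * (sgn v \<bullet> k)\<bar> \<le> B * norm k" by (simp only: abs_mult)
      moreover have "0 \<le> \<Lambda> * \<epsilon> * norm k" using \<Lambda> \<epsilon> by simp
      ultimately show ?thesis unfolding f_def B'_def by linarith
    qed
    have "a * (LBINT v. w v) = (LBINT v. a * w v)" by simp
    also have "\<dots> \<le> (LBINT v. w v * (G v - G (v - k)))"
    proof (rule integral_mono)
      show "integrable lborel (\<lambda>v. w v * (G v - G (v - k)))"
      proof (rule integrable_bounded_ball[where R = 1 and B = "2 * B"])
        fix v :: 'a assume v: "norm v \<le> 1"
        have "norm v \<le> 1 + norm k" "norm (v - k) \<le> 1 + norm k"
          using v norm_triangle_ineq4[of v k] norm_ge_zero[of k] by linarith+
        then have "\<bar>G v - G (v - k)\<bar> \<le> 2 * B" using G_B[of v] G_B[of "v - k"] by linarith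
        then have "w v * \<bar>G v - G (v - k)\<bar> \<le> 1 * (2 * B)"
          using B0 by (intro mult_mono w01) auto
        then show "\<bar>w v * (G v - G (v - k))\<bar> \<le> 2 * B"
          using w01 by (simp add: abs_mult)
      qed (auto simp: w_out)
      fix v :: 'a
      show "a * w v \<le> w v * (G v - G (v - k))"
      proof (cases "norm v \<le> 1")
        case True
        have "\<bar>G v - G 0\<bar> \<le> \<Lambda> * norm v" "\<bar>G (v - k) - G (- k)\<bar> \<le> \<Lambda> * norm v"
          using lipschitz_onD[OF lip, of v 0] lipschitz_onD[OF lip, of "v - k" "- k"]
          by (auto simp: dist_real_def dist_norm)
        then have "a \<le> G v - G (v - k)" using mult_left_mono[OF True \<Lambda>] by (simp add: a_def)
        from mult_right_mono[OF this w01(1)[of v]] show ?thesis by (simp add: mult.commute)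
      qed (simp add: w_out)
    qed (use int_w in auto)
    also have "\<dots> \<le> (LBINT v. sh v * (G v * (sgn v \<bullet> k)) / \<epsilon>)"
      using smoothed_subgradient_shell[OF conv lip \<epsilon>, of k] by (simp add: w_def sh_def)
    also have "\<dots> \<le> (LBINT v. sh v * f (sgn v) / \<epsilon>)"
    proof (rule integral_mono)
      show "integrable lborel (\<lambda>v. sh v * (G v * (sgn v \<bullet> k)) / \<epsilon>)"
      proof (rule integrable_bounded_ball[where R = 1 and B = "B * norm k / \<epsilon>"])
        fix v :: 'a assume v: "norm v \<le> 1"
        have "norm v \<le> 1 + norm k" using v norm_ge_zero[of k] by linarith
        then have "\<bar>G v\<bar> * \<bar>sgn v \<bullet> k\<bar> \<le> B * norm k"
          by (intro mult_mono G_B u_k B0 n_sgn) auto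
        then show "\<bar>sh v * (G v * (sgn v \<bullet> k)) / \<epsilon>\<bar> \<le> B * norm k / \<epsilon>"
          using \<epsilon> B0 by (simp add: sh_eq abs_mult divide_right_mono)
      qed (auto simp: sh_eq)
      show "integrable lborel (\<lambda>v. sh v * f (sgn v) / \<epsilon>)"
        by (rule integrable_bounded_ball[where R = 1 and B = "B' / \<epsilon>"])
          (use \<epsilon> B'0 f_B in \<open>auto simp: sh_eq abs_mult divide_right_mono\<close>)
      fix v :: 'a
      show "sh v * (G v * (sgn v \<bullet> k)) / \<epsilon> \<le> sh v * f (sgn v) / \<epsilon>"
      proof (cases "1 - \<epsilon> \<le> norm v \<and> norm v < 1")
        case True
        then have v0: "v \<noteq> 0" using \<epsilon> by auto
        have "v - sgn v = - ((1 - norm v) *\<^sub>R sgn v)"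
          using v0 by (simp add: sgn_div_norm algebra_simps)
        then have "norm (v - sgn v) \<le> \<epsilon>"
          using True v0 by (simp add: norm_sgn)
        from mult_left_mono[OF this \<Lambda>] have "\<bar>G v - G (sgn v)\<bar> \<le> \<Lambda> * \<epsilon>"
          using lipschitz_onD[OF lip, of v "sgn v"] by (simp add: dist_real_def dist_norm)
        then have "\<bar>G v - G (sgn v)\<bar> * \<bar>sgn v \<bullet> k\<bar> \<le> \<Lambda> * \<epsilon> * norm k"
          using \<Lambda> \<epsilon> by (intro mult_mono u_k n_sgn) auto
        then have "(G v - G (sgn v)) * (sgn v \<bullet> k) \<le> \<Lambda> * \<epsilon> * norm k"
          by (metis abs_ge_self abs_mult order_trans)
        then show ?thesis using True \<epsilon> by (simp add: sh_eq f_def divide_right_mono algebra_simps)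
      next
        case False
        then have "sh v = 0" by (simp only: sh_eq if_False)
        then show ?thesis by simp
      qed
    qed
    also have "\<dots> = ((LBINT v. indicator (ball 0 1) v * f (sgn v)) - (LBINT v. indicator (ball 0 (1 - \<epsilon>)) v * f (sgn v))) / \<epsilon>"
    proof -
      have "integrable lborel (\<lambda>v. indicator (ball 0 \<rho>) v * f (sgn v))" for \<rho>
      proof (rule integrable_bounded_ball[where R = \<rho> and B = B'])
        show "(\<lambda>v. indicator (ball 0 \<rho>) v * f (sgn v)) \<in> borel_measurable borel"
          by (intro borel_measurable_times borel_measurable_indicator) auto
      qed (use f_B B'0 in \<open>auto simp: indicator_def\<close>)
      then show ?thesis unfolding sh_def left_diff_distrib by simp
    qed
    also have "\<dots> = ?m * (\<kappa> \<epsilon> / \<epsilon> * (LINT u|uniform_sphere. f u))"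
    proof -
      have "0 < 1 - \<epsilon>" using \<epsilon> by simp
      then have "(LBINT v. indicator (ball 0 (1 - \<epsilon>)) v * f (sgn v)) =
          (1 - \<epsilon>) ^ ?d * (LBINT v. indicator (ball 0 1) v * f (sgn v))"
        by (intro integral_ball_radial) simp_all
      moreover have "(LBINT v. indicator (ball 0 1) v * f (sgn v)) = ?m * (LINT u|uniform_sphere. f u)"
        by (rule integral_uniform_sphere) simp
      ultimately show ?thesis unfolding \<kappa>_def by (simp only:) (simp add: algebra_simps)
    qed
    also have "(LINT u|uniform_sphere. f u) = ?I + \<Lambda> * \<epsilon> * norm k"
      unfolding f_def using int_S S.prob_space by simp
    finally have 1: "a * (LBINT v. w v) \<le> ?m * (\<kappa> \<epsilon> / \<epsilon> * (?I + \<Lambda> * \<epsilon> * norm k))" .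
    have int_ind: "integrable lborel (\<lambda>v. indicator (ball (0::'a) \<rho>) v :: real)" for \<rho>
      using emeasure_lborel_ball_finite[of "0::'a" \<rho>] by (intro integrable_real_indicator) auto
    have "(LBINT v. w v) \<le> (LBINT v. indicator (ball (0::'a) 1) v)"
      by (rule integral_mono[OF int_w int_ind]) (auto simp: indicator_def w01 w_out)
    then have W1: "(LBINT v. w v) \<le> ?m" by simp
    have "(LBINT v. indicator (ball (0::'a) (1 - \<epsilon>)) v) \<le> (LBINT v. w v)"
      by (rule integral_mono[OF int_ind int_w]) (auto simp: indicator_def w01 w_in)
    moreover have "(LBINT v. indicator (ball (0::'a) (1 - \<epsilon>)) v) = (1 - \<kappa> \<epsilon>) * ?m"
      using integral_ball_radial[of "\<lambda>_::'a. 1" "1 - \<epsilon>"] \<epsilon> by (simp add: \<kappa>_def)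
    ultimately have W2: "(1 - \<kappa> \<epsilon>) * ?m \<le> (LBINT v. w v)" by simp
    \<comment> \<open>The sign of \<open>a\<close> is unknown, so the lost mass is charged with the
      factor |a|.\<close>
    have "\<bar>a\<bar> * (?m - (LBINT v. w v)) \<le> \<bar>a\<bar> * (\<kappa> \<epsilon> * ?m)"
      using W2 by (intro mult_left_mono) (auto simp: algebra_simps)
    moreover have "a * (?m - (LBINT v. w v)) \<le> \<bar>a\<bar> * (?m - (LBINT v. w v))"
      using W1 by (intro mult_right_mono) auto
    ultimately have "?m * (a - \<bar>a\<bar> * \<kappa> \<epsilon>) \<le> a * (LBINT v. w v)" by (simp add: algebra_simps)
    then have "?m * (a - \<bar>a\<bar> * \<kappa> \<epsilon>) \<le> ?m * (\<kappa> \<epsilon> / \<epsilon> * (?I + \<Lambda> * \<epsilon> * norm k))" using 1 by simp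
    then show ?thesis using m by (rule mult_left_le_imp_le)
  qed
  have "((\<lambda>\<epsilon>. - ((1 - \<epsilon>) ^ ?d)) has_field_derivative real ?d) (at 0)"
    by (auto intro!: derivative_eq_intros)
  then have "((\<lambda>\<epsilon>. \<kappa> \<epsilon> / \<epsilon>) \<longlongrightarrow> real ?d) (at 0)"
    unfolding has_field_derivative_iff \<kappa>_def by (simp add: add.commute)
  then have l1: "((\<lambda>\<epsilon>. \<kappa> \<epsilon> / \<epsilon>) \<longlongrightarrow> real ?d) (at_right 0)"
    by (rule tendsto_mono[OF at_le[OF subset_UNIV]])
  have "(\<kappa> \<longlongrightarrow> 1 - (1 - 0) ^ ?d) (at_right 0)" unfolding \<kappa>_def[abs_def] by (intro tendsto_intros)
  then have l2: "(\<kappa> \<longlongrightarrow> 0) (at_right 0)" by simp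
  have L: "((\<lambda>\<epsilon>. \<kappa> \<epsilon> / \<epsilon> * (?I + \<Lambda> * \<epsilon> * norm k)) \<longlongrightarrow> real ?d * (?I + \<Lambda> * 0 * norm k)) (at_right 0)"
    by (intro tendsto_intros l1)
  have R: "((\<lambda>\<epsilon>. a - \<bar>a\<bar> * \<kappa> \<epsilon>) \<longlongrightarrow> a - \<bar>a\<bar> * 0) (at_right 0)"
    by (intro tendsto_intros l2)
  have "eventually (\<lambda>\<epsilon>::real. \<epsilon> \<in> {0<..<1}) (at_right 0)"
    by (rule eventually_at_right_real) simp
  then have "eventually (\<lambda>\<epsilon>. a - \<bar>a\<bar> * \<kappa> \<epsilon> \<le> \<kappa> \<epsilon> / \<epsilon> * (?I + \<Lambda> * \<epsilon> * norm k)) (at_right 0)"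
    by eventually_elim (rule key, simp_all)
  from tendsto_le[OF _ L R this] show ?thesis by (simp add: a_def)
qed

text \<open>Rescaling by \<delta> turns the Lipschitz constant into L \<delta>. The right-hand side
  is the mean inner product of x - y with the one-point gradient estimate built from exact values of
  \<open>g\<close>, so the lemma says that this estimate acts as an approximate subgradient.\<close>

lemma sphere_gradient_inequality:
  fixes g :: "'a::euclidean_space \<Rightarrow> real"
  assumes conv: "convex_on UNIV g" and lip: "L-lipschitz_on UNIV g" and \<delta>: "0 < \<delta>"
  shows "g x - g y - 2 * L * \<delta> \<le> real DIM('a) / \<delta> * (LINT u|uniform_sphere. g (x + \<delta> *\<^sub>R u) * (u \<bullet> (x - y)))"
proof -
  define G where "G v = g (x + \<delta> *\<^sub>R v)" for v
  have "convex_on UNIV G"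
  proof (rule convex_onI)
    fix t :: real and v w :: 'a assume "0 < t" "t < 1"
    moreover have "x + \<delta> *\<^sub>R ((1 - t) *\<^sub>R v + t *\<^sub>R w) = (1 - t) *\<^sub>R (x + \<delta> *\<^sub>R v) + t *\<^sub>R (x + \<delta> *\<^sub>R w)"
      by (simp add: algebra_simps)
    ultimately show "G ((1 - t) *\<^sub>R v + t *\<^sub>R w) \<le> (1 - t) * G v + t * G w"
      using convex_onD[OF conv, of t "x + \<delta> *\<^sub>R v" "x + \<delta> *\<^sub>R w"] by (simp add: G_def)
  qed simp
  moreover have "(L * \<delta>)-lipschitz_on UNIV G"
  proof (rule lipschitz_onI)
    show "0 \<le> L * \<delta>" using lipschitz_on_nonneg[OF lip] \<delta> by simp
    fix v w :: 'a
    have "dist (G v) (G w) \<le> L * dist (x + \<delta> *\<^sub>R v) (x + \<delta> *\<^sub>R w)"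
      unfolding G_def by (rule lipschitz_onD[OF lip]) auto
    also have "dist (x + \<delta> *\<^sub>R v) (x + \<delta> *\<^sub>R w) = \<delta> * dist v w"
      using \<delta> by (simp add: dist_norm scaleR_diff_right[symmetric])
    finally show "dist (G v) (G w) \<le> L * \<delta> * dist v w" by (simp add: mult_ac)
  qed
  ultimately have "G 0 - G (- ((x - y) /\<^sub>R \<delta>)) - 2 * (L * \<delta>)
      \<le> real DIM('a) * (LINT u|uniform_sphere. G u * (u \<bullet> ((x - y) /\<^sub>R \<delta>)))"
    by (rule smoothed_subgradient)
  moreover have "G 0 = g x" "G (- ((x - y) /\<^sub>R \<delta>)) = g y" using \<delta> by (auto simp: G_def)
  moreover have "(LINT u|uniform_sphere. G u * (u \<bullet> ((x - y) /\<^sub>R \<delta>))) =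
      (LINT u|uniform_sphere. G u * (u \<bullet> (x - y))) / \<delta>"
  proof -
    have "(LINT u|uniform_sphere. G u * (u \<bullet> ((x - y) /\<^sub>R \<delta>))) =
        (LINT u|uniform_sphere. G u * (u \<bullet> (x - y)) / \<delta>)"
      by (intro Bochner_Integration.integral_cong) (auto simp: divide_inverse mult_ac)
    then show ?thesis by simp
  qed
  ultimately show ?thesis by (simp add: G_def)
qed

section \<open>Error of the empirical risk\<close>

text \<open>The library's \<open>indep_var\<close> forces both variables to have the same type of values.\<close>

definition (in prob_space) indep_pair ::
  "'x measure \<Rightarrow> ('a \<Rightarrow> 'x) \<Rightarrow> 'y measure \<Rightarrow> ('a \<Rightarrow> 'y) \<Rightarrow> bool" where
  "indep_pair S A T B \<longleftrightarrow> A \<in> measurable M S \<and> B \<in> measurable M T \<and>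
     distr M S A \<Otimes>\<^sub>M distr M T B = distr M (S \<Otimes>\<^sub>M T) (\<lambda>\<omega>. (A \<omega>, B \<omega>))"

lemma (in prob_space) indep_pairI:
  assumes A [measurable]: "A \<in> measurable M S" and B [measurable]: "B \<in> measurable M T"
    and indep: "indep_set \<A> \<B>"
    and \<A>: "\<And>X. X \<in> sets S \<Longrightarrow> A -` X \<inter> space M \<in> \<A>"
    and \<B>: "\<And>X. X \<in> sets T \<Longrightarrow> B -` X \<inter> space M \<in> \<B>"
  shows "indep_pair S A T B"
proof -
  interpret P: prob_space "distr M S A" by (rule prob_space_distr) simp
  interpret Q: prob_space "distr M T B" by (rule prob_space_distr) simp
  have "distr M S A \<Otimes>\<^sub>M distr M T B = distr M (S \<Otimes>\<^sub>M T) (\<lambda>\<omega>. (A \<omega>, B \<omega>))"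
  proof (rule pair_measure_eqI)
    fix X Y assume "X \<in> sets (distr M S A)" "Y \<in> sets (distr M T B)"
    then have X [measurable]: "X \<in> sets S" and Y [measurable]: "Y \<in> sets T" by auto
    have "prob ((A -` X \<inter> space M) \<inter> (B -` Y \<inter> space M)) = prob (A -` X \<inter> space M) * prob (B -` Y \<inter> space M)"
      using indep \<A>[OF X] \<B>[OF Y] unfolding indep_sets2_eq by blast
    moreover have "(\<lambda>\<omega>. (A \<omega>, B \<omega>)) -` (X \<times> Y) \<inter> space M = (A -` X \<inter> space M) \<inter> (B -` Y \<inter> space M)"
      by auto
    ultimately show "emeasure (distr M S A) X * emeasure (distr M T B) Y =
        emeasure (distr M (S \<Otimes>\<^sub>M T) (\<lambda>\<omega>. (A \<omega>, B \<omega>))) (X \<times> Y)"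
      by (simp add: emeasure_distr emeasure_eq_measure ennreal_mult)
  qed (auto intro: P.sigma_finite_measure_axioms Q.sigma_finite_measure_axioms)
  then show ?thesis by (simp add: indep_pair_def)
qed

text \<open>Fubini on the product law; it serves as conditioning on \<open>A\<close>, with
  \<open>B\<close> averaged out.\<close>

lemma (in prob_space) integral_indep_pair:
  fixes f :: "'x \<times> 'y \<Rightarrow> real"
  assumes indep: "indep_pair S A T B" and f: "f \<in> borel_measurable (S \<Otimes>\<^sub>M T)"
    and int: "integrable M (\<lambda>\<omega>. f (A \<omega>, B \<omega>))"
  shows "(LINT \<omega>|M. f (A \<omega>, B \<omega>)) = (LINT \<omega>|M. LINT b|distr M T B. f (A \<omega>, b))"
    and "integrable M (\<lambda>\<omega>. LINT b|distr M T B. f (A \<omega>, b))"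
proof -
  have A [measurable]: "A \<in> measurable M S" and B [measurable]: "B \<in> measurable M T"
    and eq: "distr M S A \<Otimes>\<^sub>M distr M T B = distr M (S \<Otimes>\<^sub>M T) (\<lambda>\<omega>. (A \<omega>, B \<omega>))"
    using indep by (simp_all add: indep_pair_def)
  note f [measurable]
  interpret P: prob_space "distr M S A" by (rule prob_space_distr) simp
  interpret Q: prob_space "distr M T B" by (rule prob_space_distr) simp
  interpret PQ: pair_prob_space "distr M S A" "distr M T B" ..
  have int': "integrable (distr M S A \<Otimes>\<^sub>M distr M T B) f"
    unfolding eq by (subst integrable_distr_eq) (use int in auto)
  have m: "(\<lambda>a. LINT b|distr M T B. f (a, b)) \<in> borel_measurable S"
    by (rule Q.borel_measurable_lebesgue_integral) simp
  have "(LINT \<omega>|M. f (A \<omega>, B \<omega>)) = integral\<^sup>L (distr M S A \<Otimes>\<^sub>M distr M T B) f"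
    unfolding eq by (subst integral_distr) auto
  also have "\<dots> = (LINT a|distr M S A. LINT b|distr M T B. f (a, b))"
    by (rule PQ.integral_fst'[OF int', symmetric])
  also have "\<dots> = (LINT \<omega>|M. LINT b|distr M T B. f (A \<omega>, b))"
    by (subst integral_distr[OF A m]) simp
  finally show "(LINT \<omega>|M. f (A \<omega>, B \<omega>)) = (LINT \<omega>|M. LINT b|distr M T B. f (A \<omega>, b))" .
  show "integrable M (\<lambda>\<omega>. LINT b|distr M T B. f (A \<omega>, b))"
    using PQ.integrable_fst'[OF int'] by (subst (asm) integrable_distr_eq[OF A]) (use m in auto)
qed

text \<open>The terms of the empirical mean are conditionally centred given \<open>A\<close>, so the cross terms of the
  second moment vanish; the first moment follows from \<open>2 \<bar>S\<bar> \<le> sqrt n * S\<^sup>2 + 1 / sqrt n\<close>.\<close>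

lemma (in prob_space) empirical_mean_error:
  fixes h :: "'x \<times> 'y \<Rightarrow> real" and \<xi> :: "nat \<Rightarrow> 'a \<Rightarrow> 'y"
  assumes n: "1 \<le> n" and A [measurable]: "A \<in> measurable M S"
    and \<xi> [measurable]: "\<And>i. i \<in> {1..n} \<Longrightarrow> \<xi> i \<in> measurable M T"
    and D: "\<And>i. i \<in> {1..n} \<Longrightarrow> distr M T (\<xi> i) = D"
    and indep: "\<And>i j. i \<in> {1..n} \<Longrightarrow> j \<in> {1..n} \<Longrightarrow> i \<noteq> j \<Longrightarrow>
      indep_pair (S \<Otimes>\<^sub>M T) (\<lambda>\<omega>. (A \<omega>, \<xi> i \<omega>)) T (\<xi> j)"
    and h [measurable]: "h \<in> borel_measurable (S \<Otimes>\<^sub>M T)" and h01: "\<And>v. 0 \<le> h v" "\<And>v. h v \<le> 1"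
  shows "(LINT \<omega>|M. \<bar>(\<Sum>i = 1..n. h (A \<omega>, \<xi> i \<omega>)) / real n - (LINT z|D. h (A \<omega>, z))\<bar>) \<le> 1 / sqrt (real n)"
proof -
  have one: "1 \<in> {1..n}" using n by simp
  have "prob_space D" unfolding D[OF one, symmetric] by (rule prob_space_distr) (rule \<xi>[OF one])
  then interpret D: prob_space D .
  have sets_D [measurable_cong]: "sets D = sets T" unfolding D[OF one, symmetric] by simp
  define p where "p a = (LINT z|D. h (a, z))" for a
  have p [measurable]: "p \<in> borel_measurable S" unfolding p_def[abs_def] by measurable
  have int_h: "integrable D (\<lambda>z. h (a, z))" if "a \<in> space S" for a
    by (rule D.integrable_const_bound[where B = 1]) (use h01 that in \<open>auto intro!: AE_I2\<close>)
  have p01: "0 \<le> p a" "p a \<le> 1" if "a \<in> space S" for a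
    unfolding p_def using int_h[OF that] h01
    by (auto intro!: integral_nonneg D.integral_le_const AE_I2)
  define V where "V i \<omega> = h (A \<omega>, \<xi> i \<omega>) - p (A \<omega>)" for i \<omega>
  have V [measurable]: "V i \<in> borel_measurable M" if "i \<in> {1..n}" for i
    unfolding V_def[abs_def] using that by measurable
  have A_sp: "A \<omega> \<in> space S" if "\<omega> \<in> space M" for \<omega> using measurable_space[OF A that] .
  have V1: "\<bar>V i \<omega>\<bar> \<le> 1" if "\<omega> \<in> space M" for i \<omega>
    unfolding V_def using h01[of "(A \<omega>, \<xi> i \<omega>)"] p01[OF A_sp[OF that]] by (auto simp: abs_le_iff)
  have VV: "\<bar>V i \<omega> * V j \<omega>\<bar> \<le> 1" if "\<omega> \<in> space M" for i j \<omega>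
    using mult_mono[OF V1[OF that, of i] V1[OF that, of j]] by (simp add: abs_mult)
  have int_VV: "integrable M (\<lambda>\<omega>. V i \<omega> * V j \<omega>)" if "i \<in> {1..n}" "j \<in> {1..n}" for i j
    by (rule integrable_const_bound[where B = 1]) (use that VV in \<open>auto intro!: AE_I2\<close>)
  have cross: "(LINT \<omega>|M. V i \<omega> * V j \<omega>) = 0" if ij: "i \<in> {1..n}" "j \<in> {1..n}" "i \<noteq> j" for i j
  proof -
    define f where "f v = (h (fst v) - p (fst (fst v))) * (h (fst (fst v), snd v) - p (fst (fst v)))"
      for v :: "('x \<times> 'y) \<times> 'y"
    have f: "f \<in> borel_measurable ((S \<Otimes>\<^sub>M T) \<Otimes>\<^sub>M T)" unfolding f_def[abs_def] by measurable
    have "(LINT \<omega>|M. V i \<omega> * V j \<omega>) = (LINT \<omega>|M. f ((A \<omega>, \<xi> i \<omega>), \<xi> j \<omega>))"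
      by (simp add: f_def V_def)
    also have "\<dots> = (LINT \<omega>|M. LINT z|distr M T (\<xi> j). f ((A \<omega>, \<xi> i \<omega>), z))"
      by (rule integral_indep_pair(1)[OF indep[OF ij] f])
        (use int_VV[OF ij(1,2)] in \<open>simp add: f_def V_def\<close>)
    also have "\<dots> = (LINT \<omega>|M. 0)"
    proof (rule Bochner_Integration.integral_cong[OF refl])
      fix \<omega> assume "\<omega> \<in> space M"
      then have a: "A \<omega> \<in> space S" by (rule A_sp)
      show "(LINT z|distr M T (\<xi> j). f ((A \<omega>, \<xi> i \<omega>), z)) = 0"
        unfolding D[OF ij(2)] f_def using int_h[OF a] by (simp add: D.prob_space p_def)
    qed
    finally show ?thesis by simp
  qed
  define E where "E \<omega> = (\<Sum>i = 1..n. V i \<omega>) / real n" for \<omega>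
  have E_eq: "(\<Sum>i = 1..n. h (A \<omega>, \<xi> i \<omega>)) / real n - (LINT z|D. h (A \<omega>, z)) = E \<omega>" for \<omega>
    using n by (simp add: E_def V_def sum_subtractf diff_divide_distrib p_def)
  have [measurable]: "E \<in> borel_measurable M" unfolding E_def[abs_def] by measurable
  have E1: "\<bar>E \<omega>\<bar> \<le> 1" if "\<omega> \<in> space M" for \<omega>
  proof -
    have "\<bar>\<Sum>i = 1..n. V i \<omega>\<bar> \<le> (\<Sum>i = 1..n. \<bar>V i \<omega>\<bar>)" by (rule sum_abs)
    also have "\<dots> \<le> (\<Sum>i = 1..n. 1)" by (intro sum_mono V1 that)
    finally show ?thesis using n by (simp add: E_def divide_le_eq)
  qed
  have int_E: "integrable M (\<lambda>\<omega>. \<bar>E \<omega>\<bar>)"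
    by (rule integrable_const_bound[where B = 1]) (use E1 in \<open>auto intro!: AE_I2\<close>)
  have E_sq: "(E \<omega>)\<^sup>2 = (\<Sum>i = 1..n. \<Sum>j = 1..n. V i \<omega> * V j \<omega>) / (real n)\<^sup>2" for \<omega>
    by (simp add: E_def power_divide power2_eq_square sum_product)
  have int_E2: "integrable M (\<lambda>\<omega>. (E \<omega>)\<^sup>2)"
    unfolding E_sq by (intro integrable_divide_zero Bochner_Integration.integrable_sum int_VV)
  have "(LINT \<omega>|M. (E \<omega>)\<^sup>2) = (\<Sum>i = 1..n. \<Sum>j = 1..n. LINT \<omega>|M. V i \<omega> * V j \<omega>) / (real n)\<^sup>2"
  proof -
    have "(LINT \<omega>|M. (\<Sum>i = 1..n. \<Sum>j = 1..n. V i \<omega> * V j \<omega>)) = (\<Sum>i = 1..n. LINT \<omega>|M. (\<Sum>j = 1..n. V i \<omega> * V j \<omega>))"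
      by (intro Bochner_Integration.integral_sum Bochner_Integration.integrable_sum int_VV)
    also have "\<dots> = (\<Sum>i = 1..n. \<Sum>j = 1..n. LINT \<omega>|M. V i \<omega> * V j \<omega>)"
      by (intro sum.cong[OF refl] Bochner_Integration.integral_sum int_VV)
    finally show ?thesis unfolding E_sq by simp
  qed
  also have "(\<Sum>i = 1..n. \<Sum>j = 1..n. LINT \<omega>|M. V i \<omega> * V j \<omega>) = (\<Sum>i = 1..n. LINT \<omega>|M. V i \<omega> * V i \<omega>)"
  proof (rule sum.cong[OF refl])
    fix i assume i: "i \<in> {1..n}"
    have "(\<Sum>j = 1..n. LINT \<omega>|M. V i \<omega> * V j \<omega>) = (\<Sum>j = 1..n. if j = i then LINT \<omega>|M. V i \<omega> * V i \<omega> else 0)"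
      by (rule sum.cong) (use i cross in auto)
    then show "(\<Sum>j = 1..n. LINT \<omega>|M. V i \<omega> * V j \<omega>) = (LINT \<omega>|M. V i \<omega> * V i \<omega>)"
      using i by simp
  qed
  also have "\<dots> \<le> (\<Sum>i = 1..n. 1)"
  proof (rule sum_mono)
    fix i assume i: "i \<in> {1..n}"
    show "(LINT \<omega>|M. V i \<omega> * V i \<omega>) \<le> 1"
      using VV by (intro integral_le_const int_VV i AE_I2) (metis abs_le_D1)
  qed
  finally have E2: "(LINT \<omega>|M. (E \<omega>)\<^sup>2) \<le> 1 / real n"
    using n by (simp add: divide_right_mono power2_eq_square field_simps)
  let ?s = "sqrt (real n)"
  have s: "0 < ?s" using n by simp
  have amgm: "\<bar>E \<omega>\<bar> \<le> (?s * (E \<omega>)\<^sup>2 + 1 / ?s) / 2" for \<omega>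
  proof -
    have "0 \<le> (?s * \<bar>E \<omega>\<bar> - 1)\<^sup>2" by simp
    then have "2 * (?s * \<bar>E \<omega>\<bar>) \<le> ?s * (?s * (E \<omega>)\<^sup>2 + 1 / ?s)"
      using s by (simp add: power2_eq_square algebra_simps)
    then have "?s * (2 * \<bar>E \<omega>\<bar>) \<le> ?s * (?s * (E \<omega>)\<^sup>2 + 1 / ?s)" by (simp add: mult_ac)
    from mult_left_le_imp_le[OF this s] show ?thesis by simp
  qed
  have "(LINT \<omega>|M. \<bar>E \<omega>\<bar>) \<le> (LINT \<omega>|M. (?s * (E \<omega>)\<^sup>2 + 1 / ?s) / 2)"
    by (intro integral_mono int_E amgm) (use int_E2 in auto)
  also have "\<dots> = (?s * (LINT \<omega>|M. (E \<omega>)\<^sup>2) + 1 / ?s) / 2"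
    using int_E2 by (simp add: prob_space)
  also have "\<dots> \<le> (?s * (1 / real n) + 1 / ?s) / 2"
    using E2 s by (intro divide_right_mono add_right_mono mult_left_mono) auto
  also have "?s * (1 / real n) = 1 / ?s"
    using n by (simp add: divide_simps)
  finally show ?thesis unfolding E_eq by simp
qed

section \<open>Empirical tails integrated over levels\<close>

text \<open>Lebesgue measure on [-U, U], given as a density so that its space remains the whole line
  and Borel measurability carries over directly.\<close>

definition level_measure :: "real \<Rightarrow> real measure" where
  "level_measure U = density lborel (indicator {-U..U})"

lemma sets_level_measure [measurable_cong, simp]: "sets (level_measure U) = sets borel"
  and space_level_measure [simp]: "space (level_measure U) = UNIV"
  by (simp_all add: level_measure_def)

lemma emeasure_level_measure: "A \<in> sets borel \<Longrightarrow> emeasure (level_measure U) A = emeasure lborel ({-U..U} \<inter> A)"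
  unfolding level_measure_def
  by (subst emeasure_density)
    (auto intro!: nn_integral_cong simp: indicator_def simp flip: nn_integral_indicator)

lemma finite_measure_level_measure: "finite_measure (level_measure U)"
  by standard (simp add: emeasure_level_measure emeasure_lborel_Icc_eq)

text \<open>The integrand is the indicator of [c, z), which lies inside [-U, U] under the two
  bounds. The excess thereby becomes linear in the tail indicators, and errors of the tails transfer
  to all levels \<open>c\<close> at once.\<close>

lemma excess_eq_level_integral:
  assumes "c \<in> {-U..U}" "\<bar>z\<bar> \<le> U"
  shows "max 0 (z - c) = (LINT y|level_measure U. of_bool (c \<le> y) * of_bool (y < z))"
proof -
  have "(LINT y|level_measure U. of_bool (c \<le> y) * of_bool (y < z)) =
      (LINT y|level_measure U. indicator {c..<z} y :: real)"
    by (intro Bochner_Integration.integral_cong) (auto simp: indicator_def)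
  also have "\<dots> = measure (level_measure U) {c..<z}" by simp
  also have "\<dots> = measure lborel {c..<z}"
  proof -
    have "{-U..U} \<inter> {c..<z} = {c..<z}" using assms by auto
    then show ?thesis by (simp add: measure_def emeasure_level_measure)
  qed
  finally show ?thesis by (simp add: max_def)
qed

lemma empirical_cdf_eq_cdf:
  assumes "1 \<le> n"
  shows "empirical_cdf n z = cdf (distr (measure_pmf (pmf_of_set {1..n})) borel z)"
proof
  fix y
  have "cdf (distr (measure_pmf (pmf_of_set {1..n})) borel z) y
      = measure (measure_pmf (pmf_of_set {1..n})) (z -` {..y})"
    by (simp add: cdf_def measure_distr)
  also have "\<dots> = real (card ({1..n} \<inter> z -` {..y})) / real n"
    using assms by (subst measure_pmf_of_set) auto
  also have "real (card ({1..n} \<inter> z -` {..y})) = (\<Sum>i = 1..n. if z i \<le> y then 1 else 0)"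
    by (subst sum.If_cases) (auto simp: vimage_def Int_def)
  finally show "empirical_cdf n z y = cdf (distr (measure_pmf (pmf_of_set {1..n})) borel z) y"
    by (simp add: empirical_cdf_def)
qed

text \<open>The bound is required at every decision, not only on \<open>X\<close>; the instance used
  later is an extension of the given cost.\<close>

locale measurable_cost =
  fixes J :: "'a::euclidean_space \<Rightarrow> 'b::metric_space \<Rightarrow> real" and U \<alpha> :: real
  assumes measurable_J [measurable]: "case_prod J \<in> borel_measurable (borel \<Otimes>\<^sub>M borel)"
    and bounded_J: "\<And>x z. \<bar>J x z\<bar> \<le> U"
    and level: "0 < \<alpha>" "\<alpha> \<le> 1"
begin

lemma bounded_cost_J: "prob_space D \<Longrightarrow> sets D = sets borel \<Longrightarrow> bounded_cost D (J x) U \<alpha>"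
  unfolding bounded_cost_def bounded_cost_axioms_def using bounded_J level
  by (auto cong: measurable_cong_sets)

lemma bounded_cost_empirical: "bounded_cost (measure_pmf (pmf_of_set {1..n})) (\<lambda>i. J x (z i)) U \<alpha>"
  unfolding bounded_cost_def bounded_cost_axioms_def using bounded_J level
  by (auto simp: prob_space_measure_pmf)

lemma U_nonneg: "0 \<le> U" using bounded_J[of undefined undefined] by linarith

lemma abs_cvar_cost_le: "prob_space D \<Longrightarrow> sets D = sets borel \<Longrightarrow> \<bar>cvar_cost \<alpha> J D x\<bar> \<le> U"
  unfolding cvar_cost_def by (rule bounded_cost.abs_cvar_le[OF bounded_cost_J])

lemma abs_empirical_cvar_le: "1 \<le> n \<Longrightarrow> \<bar>CVaR \<alpha> (empirical_cdf n (\<lambda>i. J x (z i)))\<bar> \<le> U"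
  unfolding empirical_cdf_eq_cdf by (rule bounded_cost.abs_cvar_le[OF bounded_cost_empirical])

lemma measurable_cvar_cost:
  assumes "prob_space D" and sets_D: "sets D = sets borel"
  shows "cvar_cost \<alpha> J D \<in> borel_measurable borel"
proof -
  interpret D: prob_space D by fact
  note sets_D[measurable_cong]
  have "cvar_cost \<alpha> J D = (\<lambda>x. INF q::rat. tail_cost \<alpha> (J x) D (of_rat q))"
    unfolding cvar_cost_def by (rule ext) (rule bounded_cost.cvar_eq_INF_rat[OF bounded_cost_J[OF assms]])
  also have "\<dots> \<in> borel_measurable borel"
    unfolding tail_cost_def by measurable
  finally show ?thesis .
qed

lemma tail_cost_empirical:
  assumes "1 \<le> n"
  shows "tail_cost \<alpha> (\<lambda>i. J x (z i)) (measure_pmf (pmf_of_set {1..n})) c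
    = c + ((\<Sum>i = 1..n. max 0 (J x (z i) - c)) / real n) / \<alpha>"
  using assms by (simp add: tail_cost_def integral_pmf_of_set)

lemma measurable_empirical_cvar:
  assumes n: "1 \<le> n" and [measurable]: "X \<in> borel_measurable N" "\<And>i. i \<in> {1..n} \<Longrightarrow> \<xi> i \<in> borel_measurable N"
  shows "(\<lambda>\<omega>. CVaR \<alpha> (empirical_cdf n (\<lambda>i. J (X \<omega>) (\<xi> i \<omega>)))) \<in> borel_measurable N"
proof -
  have "(\<lambda>\<omega>. CVaR \<alpha> (empirical_cdf n (\<lambda>i. J (X \<omega>) (\<xi> i \<omega>)))) =
      (\<lambda>\<omega>. INF q::rat. of_rat q + ((\<Sum>i = 1..n. max 0 (case_prod J (X \<omega>, \<xi> i \<omega>) - of_rat q)) / real n) / \<alpha>)"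
  proof
    fix \<omega>
    show "CVaR \<alpha> (empirical_cdf n (\<lambda>i. J (X \<omega>) (\<xi> i \<omega>))) =
      (INF q::rat. of_rat q + ((\<Sum>i = 1..n. max 0 (case_prod J (X \<omega>, \<xi> i \<omega>) - of_rat q)) / real n) / \<alpha>)"
      unfolding empirical_cdf_eq_cdf[OF n] bounded_cost.cvar_eq_INF_rat[OF bounded_cost_empirical]
        tail_cost_empirical[OF n] by simp
  qed
  also have "\<dots> \<in> borel_measurable N"
    by measurable
  finally show ?thesis .
qed

text \<open>At each \<omega> the CVaR error is at most 1 / \<alpha> times the integral over levels y
  of \<open>e \<omega> y\<close>, the deviation of the empirical tail from the true one. After
  Fubini each level contributes at most 1 / sqrt n, and the levels fill an interval of length 2 U.
  Since the tail errors are integrated rather than maximised over y, no uniform deviation bound for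
  the empirical distribution function is involved.\<close>

lemma sampling_error:
  fixes M :: "'m measure" and X :: "'m \<Rightarrow> 'a" and \<xi> :: "nat \<Rightarrow> 'm \<Rightarrow> 'b"
  assumes M: "prob_space M" and n: "1 \<le> n"
    and X [measurable]: "X \<in> borel_measurable M"
    and \<xi> [measurable]: "\<And>i. i \<in> {1..n} \<Longrightarrow> \<xi> i \<in> borel_measurable M"
    and D: "\<And>i. i \<in> {1..n} \<Longrightarrow> distr M borel (\<xi> i) = D"
    and indep: "\<And>i j. i \<in> {1..n} \<Longrightarrow> j \<in> {1..n} \<Longrightarrow> i \<noteq> j \<Longrightarrow>
      prob_space.indep_pair M (borel \<Otimes>\<^sub>M borel) (\<lambda>\<omega>. (X \<omega>, \<xi> i \<omega>)) borel (\<xi> j)"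
  shows "(LINT \<omega>|M. \<bar>CVaR \<alpha> (empirical_cdf n (\<lambda>i. J (X \<omega>) (\<xi> i \<omega>))) - cvar_cost \<alpha> J D (X \<omega>)\<bar>)
    \<le> 2 * U / \<alpha> / sqrt (real n)"
proof -
  interpret prob_space M by fact
  have one: "1 \<in> {1..n}" using n by simp
  have PD: "prob_space D" unfolding D[OF one, symmetric] by (rule prob_space_distr) (rule \<xi>[OF one])
  then interpret D: prob_space D .
  have sets_D [measurable_cong]: "sets D = sets borel" unfolding D[OF one, symmetric] by simp
  let ?Y = "level_measure U"
  interpret Y: finite_measure ?Y by (rule finite_measure_level_measure)
  interpret DY: pair_sigma_finite D ?Y ..
  interpret MY: pair_sigma_finite M ?Y ..
  interpret DYf: finite_measure "D \<Otimes>\<^sub>M ?Y"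
    by (rule finite_measure_pair_measure) unfold_locales
  interpret MYf: finite_measure "M \<Otimes>\<^sub>M ?Y"
    by (rule finite_measure_pair_measure) unfold_locales
  define h where "h y v = (of_bool (y < case_prod J v) :: real)" for y v
  define p where "p y x = (LINT z|D. h y (x, z))" for y x
  define e where "e \<omega> y = \<bar>(\<Sum>i = 1..n. h y (X \<omega>, \<xi> i \<omega>)) / real n - p y (X \<omega>)\<bar>" for \<omega> y
  have h01: "0 \<le> h y v" "h y v \<le> 1" for y v by (auto simp: h_def)
  have h_m: "(\<lambda>w. h (fst w) (snd w)) \<in> borel_measurable (borel \<Otimes>\<^sub>M (borel \<Otimes>\<^sub>M borel))"
    unfolding h_def by measurable
  have h_y: "h y \<in> borel_measurable (borel \<Otimes>\<^sub>M borel)" for y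
    using measurable_compose[OF _ h_m, of "\<lambda>v. (y, v)"] by simp
  have h_pair: "(\<lambda>w. h (fst w) (f w, g w)) \<in> borel_measurable (borel \<Otimes>\<^sub>M N)"
    if "f \<in> borel_measurable (borel \<Otimes>\<^sub>M N)" "g \<in> borel_measurable (borel \<Otimes>\<^sub>M N)" for f g and N :: "'n measure"
    using measurable_compose[OF _ h_m, of "\<lambda>w. (fst w, (f w, g w))" "borel \<Otimes>\<^sub>M N"] that by simp
  have p_m: "(\<lambda>w. p (fst w) (snd w)) \<in> borel_measurable (borel \<Otimes>\<^sub>M borel)"
  proof -
    have "(\<lambda>w. h (fst (fst w)) (snd (fst w), snd w)) \<in> borel_measurable ((borel \<Otimes>\<^sub>M borel) \<Otimes>\<^sub>M D)"
      using measurable_compose[OF _ h_m, of "\<lambda>w. (fst (fst w), (snd (fst w), snd w))"] by simp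
    then show ?thesis unfolding p_def
      by (intro D.borel_measurable_lebesgue_integral) (simp add: case_prod_beta')
  qed
  have e_m: "case_prod e \<in> borel_measurable (M \<Otimes>\<^sub>M ?Y)"
  proof -
    have "(\<lambda>w. h (snd w) (X (fst w), \<xi> i (fst w))) \<in> borel_measurable (M \<Otimes>\<^sub>M ?Y)" if "i \<in> {1..n}" for i
      using that by (intro measurable_compose[OF _ h_m, of "\<lambda>w. (snd w, (X (fst w), \<xi> i (fst w)))", simplified]) measurable
    moreover have "(\<lambda>w. p (snd w) (X (fst w))) \<in> borel_measurable (M \<Otimes>\<^sub>M ?Y)"
      by (intro measurable_compose[OF _ p_m, of "\<lambda>w. (snd w, X (fst w))", simplified]) measurable
    ultimately show ?thesis
      unfolding e_def case_prod_beta' by measurable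
  qed
  have p01: "0 \<le> p y x" "p y x \<le> 1" for x y
  proof -
    have m: "(\<lambda>z. h y (x, z)) \<in> borel_measurable D"
      using measurable_compose[OF _ h_y, of "\<lambda>z. (x, z)"] by simp
    have "integrable D (\<lambda>z. h y (x, z))"
      by (rule D.integrable_const_bound[where B = 1]) (use h01 m in \<open>auto intro!: AE_I2\<close>)
    then show "0 \<le> p y x" "p y x \<le> 1"
      unfolding p_def using h01 by (auto intro!: integral_nonneg D.integral_le_const AE_I2)
  qed
  have mean01: "0 \<le> (\<Sum>i = 1..n. h y (X \<omega>, \<xi> i \<omega>)) / real n" "(\<Sum>i = 1..n. h y (X \<omega>, \<xi> i \<omega>)) / real n \<le> 1" for \<omega> y
    using sum_mono[of "{1..n}" "\<lambda>i. h y (X \<omega>, \<xi> i \<omega>)" "\<lambda>_. 1"] h01 n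
    by (auto intro!: sum_nonneg divide_nonneg_nonneg simp: divide_le_eq)
  have e01: "0 \<le> e \<omega> y" "e \<omega> y \<le> 1" for \<omega> y
    using p01[of y "X \<omega>"] mean01[of y \<omega>] by (auto simp: e_def abs_le_iff)
  have int_e: "integrable (M \<Otimes>\<^sub>M ?Y) (case_prod e)"
    by (rule MYf.integrable_const_bound[where B = 1]) (use e01 e_m in \<open>auto intro!: AE_I2\<close>)
  have e_y: "e \<omega> \<in> borel_measurable borel" if "\<omega> \<in> space M" for \<omega>
    using measurable_compose[OF _ e_m, of "\<lambda>y. (\<omega>, y)" ?Y] that by (simp cong: measurable_cong_sets)
  have int_e_y: "integrable ?Y (e \<omega>)" if "\<omega> \<in> space M" for \<omega>
    by (rule Y.integrable_const_bound[where B = 1]) (use e01 e_y[OF that] in \<open>auto intro!: AE_I2\<close>)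
  have excess_D: "(LINT z|D. max 0 (J x z - c)) = (LINT y|?Y. of_bool (c \<le> y) * p y x)"
    if c: "c \<in> {-U..U}" for x c
  proof -
    have m: "(\<lambda>w. of_bool (c \<le> snd w) * h (snd w) (x, fst w)) \<in> borel_measurable (D \<Otimes>\<^sub>M ?Y)"
      by (intro borel_measurable_times measurable_compose[OF _ h_m, of "\<lambda>w. (snd w, (x, fst w))", simplified]) measurable
    have "(LINT z|D. max 0 (J x z - c)) = (LINT z|D. LINT y|?Y. of_bool (c \<le> y) * h y (x, z))"
      by (simp add: excess_eq_level_integral[OF c bounded_J] h_def)
    also have "\<dots> = (LINT y|?Y. LINT z|D. of_bool (c \<le> y) * h y (x, z))"
    proof (rule DY.Fubini_integral[symmetric])
      show "integrable (D \<Otimes>\<^sub>M ?Y) (\<lambda>(z, y). of_bool (c \<le> y) * h y (x, z))"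
        by (rule DYf.integrable_const_bound[where B = 1])
          (use m h01 in \<open>auto intro!: AE_I2 simp: case_prod_beta'\<close>)
    qed
    finally show ?thesis by (simp add: p_def)
  qed
  have excess_n: "(\<Sum>i = 1..n. max 0 (J (X \<omega>) (\<xi> i \<omega>) - c)) / real n =
      (LINT y|?Y. of_bool (c \<le> y) * ((\<Sum>i = 1..n. h y (X \<omega>, \<xi> i \<omega>)) / real n))"
    and int_excess_n: "integrable ?Y (\<lambda>y. of_bool (c \<le> y) * ((\<Sum>i = 1..n. h y (X \<omega>, \<xi> i \<omega>)) / real n))"
    if c: "c \<in> {-U..U}" for \<omega> c
  proof -
    have m: "(\<lambda>y. h y v) \<in> borel_measurable borel" for v
      unfolding h_def by measurable
    have int: "integrable ?Y (\<lambda>y. of_bool (c \<le> y) * h y v)" for v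
      by (rule Y.integrable_const_bound[where B = 1]) (use h01 m in \<open>auto intro!: AE_I2\<close>)
    have eq: "of_bool (c \<le> y) * ((\<Sum>i = 1..n. h y (X \<omega>, \<xi> i \<omega>)) / real n) =
        (\<Sum>i = 1..n. of_bool (c \<le> y) * h y (X \<omega>, \<xi> i \<omega>)) / real n" for y
      by (simp add: sum_distrib_left)
    show "(\<Sum>i = 1..n. max 0 (J (X \<omega>) (\<xi> i \<omega>) - c)) / real n =
      (LINT y|?Y. of_bool (c \<le> y) * ((\<Sum>i = 1..n. h y (X \<omega>, \<xi> i \<omega>)) / real n))"
    proof -
      have "max 0 (J x z - c) = (LINT y|?Y. of_bool (c \<le> y) * h y (x, z))" for x z
        by (simp add: excess_eq_level_integral[OF c bounded_J] h_def)
      then have "(\<Sum>i = 1..n. max 0 (J (X \<omega>) (\<xi> i \<omega>) - c)) =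
          (LINT y|?Y. (\<Sum>i = 1..n. of_bool (c \<le> y) * h y (X \<omega>, \<xi> i \<omega>)))"
        by (subst Bochner_Integration.integral_sum[OF int]) (simp only:)
      then show ?thesis unfolding eq by simp
    qed
    show "integrable ?Y (\<lambda>y. of_bool (c \<le> y) * ((\<Sum>i = 1..n. h y (X \<omega>, \<xi> i \<omega>)) / real n))"
      unfolding eq using int by (intro integrable_divide_zero Bochner_Integration.integrable_sum) auto
  qed
  have int_excess_D: "integrable ?Y (\<lambda>y. of_bool (c \<le> y) * p y x)" for c x
  proof (rule Y.integrable_const_bound[where B = 1])
    have "(\<lambda>y. p y x) \<in> borel_measurable borel"
      by (intro measurable_compose[OF _ p_m, of "\<lambda>y. (y, x)", simplified]) measurable
    then show "(\<lambda>y. of_bool (c \<le> y) * p y x) \<in> borel_measurable ?Y" by measurable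
  qed (use p01 in \<open>auto intro!: AE_I2\<close>)
  \<comment> \<open>The level \<open>c\<close> enters only through
    \<open>of_bool (c \<le> y)\<close>, which is at most 1, so one integral controls all
    levels.\<close>
  have diff: "\<bar>(\<Sum>i = 1..n. max 0 (J (X \<omega>) (\<xi> i \<omega>) - c)) / real n - (LINT z|D. max 0 (J (X \<omega>) z - c))\<bar>
      \<le> (LINT y|?Y. e \<omega> y)" if c: "c \<in> {-U..U}" and \<omega>: "\<omega> \<in> space M" for c \<omega>
  proof -
    have "\<bar>(\<Sum>i = 1..n. max 0 (J (X \<omega>) (\<xi> i \<omega>) - c)) / real n - (LINT z|D. max 0 (J (X \<omega>) z - c))\<bar> =
        \<bar>LINT y|?Y. of_bool (c \<le> y) * ((\<Sum>i = 1..n. h y (X \<omega>, \<xi> i \<omega>)) / real n) - of_bool (c \<le> y) * p y (X \<omega>)\<bar>"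
      unfolding excess_n[OF c] excess_D[OF c]
      by (subst Bochner_Integration.integral_diff[OF int_excess_n[OF c] int_excess_D]) simp
    also have "\<dots> \<le> (LINT y|?Y. \<bar>of_bool (c \<le> y) * ((\<Sum>i = 1..n. h y (X \<omega>, \<xi> i \<omega>)) / real n) - of_bool (c \<le> y) * p y (X \<omega>)\<bar>)"
      by (rule integral_abs_bound)
    also have "\<dots> \<le> (LINT y|?Y. e \<omega> y)"
      by (intro integral_mono integrable_abs Bochner_Integration.integrable_diff int_excess_n[OF c] int_excess_D int_e_y \<omega>)
        (auto simp: e_def)
    finally show ?thesis .
  qed
  have cvar_diff: "\<bar>CVaR \<alpha> (empirical_cdf n (\<lambda>i. J (X \<omega>) (\<xi> i \<omega>))) - cvar_cost \<alpha> J D (X \<omega>)\<bar>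
      \<le> (LINT y|?Y. e \<omega> y) / \<alpha>" if \<omega>: "\<omega> \<in> space M" for \<omega>
  proof -
    let ?N = "measure_pmf (pmf_of_set {1..n})" and ?Z = "\<lambda>i. J (X \<omega>) (\<xi> i \<omega>)"
    have eq: "(LINT i|?N. max 0 (?Z i - c)) = (\<Sum>i = 1..n. max 0 (J (X \<omega>) (\<xi> i \<omega>) - c)) / real n" for c
      using n by (simp add: integral_pmf_of_set)
    note BD = bounded_cost_J[OF PD sets_D, of "X \<omega>"]
    have "CVaR \<alpha> (cdf (distr ?N borel ?Z)) \<le> CVaR \<alpha> (cdf (distr D borel (J (X \<omega>)))) + (LINT y|?Y. e \<omega> y) / \<alpha>"
    proof (rule cvar_diff_le[OF bounded_cost_empirical BD])
      fix c assume "c \<in> {-U..U}"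
      from diff[OF this \<omega>] show "(LINT i|?N. max 0 (?Z i - c)) \<le> (LINT z|D. max 0 (J (X \<omega>) z - c)) + (LINT y|?Y. e \<omega> y)"
        unfolding eq by linarith
    qed
    moreover have "CVaR \<alpha> (cdf (distr D borel (J (X \<omega>)))) \<le> CVaR \<alpha> (cdf (distr ?N borel ?Z)) + (LINT y|?Y. e \<omega> y) / \<alpha>"
    proof (rule cvar_diff_le[OF BD bounded_cost_empirical])
      fix c assume "c \<in> {-U..U}"
      from diff[OF this \<omega>] show "(LINT z|D. max 0 (J (X \<omega>) z - c)) \<le> (LINT i|?N. max 0 (?Z i - c)) + (LINT y|?Y. e \<omega> y)"
        unfolding eq by linarith
    qed
    ultimately show ?thesis unfolding empirical_cdf_eq_cdf[OF n] cvar_cost_def by linarith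
  qed
  have e_mean: "(LINT \<omega>|M. e \<omega> y) \<le> 1 / sqrt (real n)" for y
    unfolding e_def p_def
    by (rule empirical_mean_error[OF n X \<xi> D indep h_y h01])
  have int_e1: "integrable M (\<lambda>\<omega>. LINT y|?Y. e \<omega> y)"
    by (rule MY.integrable_fst[OF int_e])
  \<comment> \<open>The rule used here asks for integrability of the nonnegative majorant only; a
    left integrand that is not integrable would have integral 0.\<close>
  have "(LINT \<omega>|M. \<bar>CVaR \<alpha> (empirical_cdf n (\<lambda>i. J (X \<omega>) (\<xi> i \<omega>))) - cvar_cost \<alpha> J D (X \<omega>)\<bar>)
      \<le> (LINT \<omega>|M. (LINT y|?Y. e \<omega> y) / \<alpha>)"
    by (rule integral_mono_AE')
      (use int_e1 cvar_diff e01 level in \<open>auto intro!: AE_I2 divide_nonneg_pos integral_nonneg\<close>)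
  also have "\<dots> = (LINT \<omega>|M. LINT y|?Y. e \<omega> y) / \<alpha>" by simp
  also have "(LINT \<omega>|M. LINT y|?Y. e \<omega> y) = (LINT y|?Y. LINT \<omega>|M. e \<omega> y)"
    by (rule MY.Fubini_integral[symmetric, OF int_e])
  also have "\<dots> \<le> (LINT y|?Y. 1 / sqrt (real n))"
    by (rule integral_mono[OF MY.integrable_snd[OF int_e]]) (auto intro: e_mean)
  also have "\<dots> = 2 * U * (1 / sqrt (real n))"
    using U_nonneg by (simp add: measure_def emeasure_level_measure)
  finally show ?thesis using level by (simp add: divide_right_mono mult_ac)
qed

end

section \<open>Batches and measurable extensions\<close>

text \<open>For a non-separable noise space, continuity of \<open>J\<close> gives no measurability with respect to the
  product \<open>\<sigma>\<close>-algebra; the infimum over a countable dense set of decisions does.\<close>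

lemma jointly_measurable_extension:
  fixes J :: "'a::euclidean_space \<Rightarrow> 'b::topological_space \<Rightarrow> real"
  assumes ne: "X \<noteq> {}" and U: "\<And>x z. x \<in> X \<Longrightarrow> \<bar>J x z\<bar> \<le> U"
    and L: "0 \<le> L" "\<And>z x y. x \<in> X \<Longrightarrow> y \<in> X \<Longrightarrow> \<bar>J x z - J y z\<bar> \<le> L * norm (x - y)"
    and meas: "\<And>x. x \<in> X \<Longrightarrow> J x \<in> borel_measurable borel"
  obtains J' where "case_prod J' \<in> borel_measurable (borel \<Otimes>\<^sub>M borel)"
    "\<And>x z. \<bar>J' x z\<bar> \<le> U" "\<And>x z. x \<in> X \<Longrightarrow> J' x z = J x z"
proof -
  obtain Q where Q: "countable Q" "Q \<subseteq> X" "X \<subseteq> closure Q" using separable by blast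
  have U0: "0 \<le> U" using ne U abs_ge_zero by (metis all_not_in_conv order_trans)
  have Qne: "Q \<noteq> {}" using Q ne by auto
  \<comment> \<open>The McShane formula over the countable set \<open>Q\<close>; clamping its value
    to [-U, U] in \<open>J'\<close> then keeps the bound at decisions outside
    \<open>X\<close>.\<close>
  define H where "H x z = (INF q\<in>Q. J q z + L * norm (x - q))" for x z
  define J' where "J' x z = max (-U) (min U (H x z))" for x z
  have "H x z = J x z" if x: "x \<in> X" for x z
  proof (rule antisym)
    have low: "J x z \<le> J q z + L * norm (x - q)" if "q \<in> Q" for q
      using L(2)[OF x, of q z] Q that by auto
    then have bdd: "bdd_below ((\<lambda>q. J q z + L * norm (x - q)) ` Q)"
      by (rule bdd_belowI2)
    show "J x z \<le> H x z" unfolding H_def by (rule cINF_greatest[OF Qne low])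
    show "H x z \<le> J x z"
    proof (rule field_le_epsilon)
      fix e :: real assume e: "0 < e"
      \<comment> \<open>The summand 1 keeps the denominator positive when L = 0.\<close>
      then have "0 < e / (2 * L + 1)" using L(1) by simp
      then obtain q where q: "q \<in> Q" "dist q x < e / (2 * L + 1)"
        using Q(3) x closure_approachable by blast
      have "H x z \<le> J q z + L * norm (x - q)" unfolding H_def by (rule cINF_lower[OF bdd q(1)])
      also have "\<dots> \<le> J x z + 2 * L * norm (x - q)"
        using L(2)[OF x, of q z] Q q by auto
      also have "2 * L * norm (x - q) \<le> (2 * L + 1) * (e / (2 * L + 1))"
        using q L(1) by (intro mult_mono) (auto simp: dist_norm norm_minus_commute)
      also have "\<dots> = e" using L(1) by simp
      finally show "H x z \<le> J x z + e" by simp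
    qed
  qed
  then have "J' x z = J x z" if "x \<in> X" for x z
    using that U[OF that, of z] by (simp add: J'_def abs_le_iff max_def min_def)
  moreover have "case_prod J' \<in> borel_measurable (borel \<Otimes>\<^sub>M borel)"
  proof -
    have [measurable]: "J q \<in> borel_measurable borel" if "q \<in> Q" for q using meas Q that by auto
    show ?thesis
      unfolding J'_def[abs_def] H_def[abs_def] case_prod_beta'
      by (intro borel_measurable_max borel_measurable_min borel_measurable_cINF_real Q(1)) measurable
  qed
  moreover have "\<bar>J' x z\<bar> \<le> U" for x z using U0 by (auto simp: J'_def)
  ultimately show ?thesis using that by blast
qed

section \<open>Arithmetic of batches\<close>

text \<open>Rounds and batches are counted from 1; shifting both by one turns the ceiling into
  \<open>div\<close>, and likewise the epoch into \<open>mod\<close>.\<close>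

lemma batch_eq: "1 \<le> \<Delta> \<Longrightarrow> 1 \<le> t \<Longrightarrow> batch \<Delta> t = Suc ((t - 1) div \<Delta>)"
proof -
  assume \<Delta>: "1 \<le> \<Delta>" and t: "1 \<le> t"
  define q m where "q = (t - 1) div \<Delta>" and "m = (t - 1) mod \<Delta>"
  have "t = q * \<Delta> + m + 1" using t by (simp add: q_def m_def)
  then have rt: "real t = real q * real \<Delta> + real m + 1" by simp
  have m: "m < \<Delta>" using \<Delta> by (simp add: m_def)
  have "\<lceil>real t / real \<Delta>\<rceil> = int (Suc q)"
  proof (rule ceiling_unique)
    show "of_int (int (Suc q)) - 1 < real t / real \<Delta>"
      using \<Delta> by (simp add: less_divide_eq rt)
    have "real m + 1 \<le> real \<Delta>" using m by linarith
    then show "real t / real \<Delta> \<le> of_int (int (Suc q))"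
      using \<Delta> by (simp add: divide_le_eq rt algebra_simps)
  qed
  then show ?thesis by (simp add: batch_def q_def)
qed

lemma epoch_eq: "1 \<le> \<Delta> \<Longrightarrow> 1 \<le> t \<Longrightarrow> epoch \<Delta> t = Suc ((t - 1) mod \<Delta>)"
proof -
  assume \<Delta>: "1 \<le> \<Delta>" and t: "1 \<le> t"
  have "t = (t - 1) div \<Delta> * \<Delta> + (t - 1) mod \<Delta> + 1" using t by simp
  then have "t - (t - 1) div \<Delta> * \<Delta> = Suc ((t - 1) mod \<Delta>)" by linarith
  then show ?thesis unfolding epoch_def batch_eq[OF \<Delta> t] by simp
qed

lemma epoch_in_range: "1 \<le> \<Delta> \<Longrightarrow> 1 \<le> t \<Longrightarrow> epoch \<Delta> t \<in> {1..\<Delta>}"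
  using mod_less_divisor[of \<Delta> "t - 1"] by (simp add: epoch_eq Suc_le_eq)

text \<open>Completing the last, possibly truncated batch only adds nonnegative terms.\<close>

lemma sum_epoch_le:
  fixes f :: "nat \<Rightarrow> real"
  assumes \<Delta>: "1 \<le> \<Delta>" and f: "\<And>\<tau>. 0 \<le> f \<tau>"
  shows "(\<Sum>t = 1..T. f (epoch \<Delta> t)) \<le> real (Suc ((T - 1) div \<Delta>)) * (\<Sum>\<tau> = 1..\<Delta>. f \<tau>)"
proof -
  let ?N = "Suc ((T - 1) div \<Delta>)"
  have "(\<Sum>t = 1..T. f (epoch \<Delta> t)) = (\<Sum>t = 1..T. f (Suc ((t - 1) mod \<Delta>)))"
    using \<Delta> by (intro sum.cong) (auto simp: epoch_eq)
  also have "\<dots> = (\<Sum>t<T. f (Suc (t mod \<Delta>)))"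
    by (rule sum.reindex_bij_witness[where i = Suc and j = "\<lambda>t. t - 1"]) auto
  also have "\<dots> \<le> (\<Sum>t<?N * \<Delta>. f (Suc (t mod \<Delta>)))"
  proof (rule sum_mono2)
    have "T \<le> ?N * \<Delta>"
    proof (cases "T = 0")
      case False
      have "T - 1 < ?N * \<Delta>" using \<Delta> dividend_less_div_times[of \<Delta> "T - 1"] by simp
      then show ?thesis using False by linarith
    qed simp
    then show "{..<T} \<subseteq> {..<?N * \<Delta>}" by auto
  qed (use f in auto)
  also have "\<dots> = (\<Sum>m<?N. \<Sum>t = m * \<Delta>..<m * \<Delta> + \<Delta>. f (Suc (t mod \<Delta>)))"
    by (rule sum.nat_group[symmetric])
  also have "\<dots> = (\<Sum>m<?N. \<Sum>\<tau> = 1..\<Delta>. f \<tau>)"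
  proof (rule sum.cong[OF refl])
    fix m
    show "(\<Sum>t = m * \<Delta>..<m * \<Delta> + \<Delta>. f (Suc (t mod \<Delta>))) = (\<Sum>\<tau> = 1..\<Delta>. f \<tau>)"
    proof (rule sum.reindex_bij_witness[where i = "\<lambda>\<tau>. m * \<Delta> + (\<tau> - 1)" and j = "\<lambda>t. Suc (t - m * \<Delta>)"])
      fix t assume t: "t \<in> {m * \<Delta>..<m * \<Delta> + \<Delta>}"
      then have "t mod \<Delta> = t - m * \<Delta>"
        by (metis add_less_cancel_left atLeastLessThan_iff le_add_diff_inverse mod_less mod_mult_self3)
      then show "f (Suc (t - m * \<Delta>)) = f (Suc (t mod \<Delta>))" by simp
    qed (use \<Delta> in auto)
  qed
  also have "\<dots> = real ?N * (\<Sum>\<tau> = 1..\<Delta>. f \<tau>)" by simp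
  finally show ?thesis .
qed

text \<open>The condition in \<open>step\<close> says that rounds t and t + 1 lie in the same batch.
  Inside a batch consecutive terms cancel, and each new batch starts with a fresh term of at most
  \<open>B\<close>.\<close>

lemma batched_telescope_le:
  fixes a b :: "nat \<Rightarrow> real"
  assumes a: "\<And>t. t \<in> {1..T} \<Longrightarrow> a t \<le> B" and b: "\<And>t. t \<in> {1..T} \<Longrightarrow> 0 \<le> b t"
    and B: "0 \<le> B" and T: "1 \<le> T"
    and step: "\<And>t. 1 \<le> t \<Longrightarrow> Suc t \<le> T \<Longrightarrow> t div \<Delta> = (t - 1) div \<Delta> \<Longrightarrow> a (Suc t) = b t"
  shows "(\<Sum>t = 1..T. a t - b t) \<le> B * real (Suc ((T - 1) div \<Delta>))"
proof -
  \<comment> \<open>The term \<open>- b n\<close> is kept in the induction claim because it cancels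
    \<open>a (Suc n)\<close> in the next round of the same batch.\<close>
  have "(\<Sum>t = 1..n. a t - b t) \<le> B * real (Suc ((n - 1) div \<Delta>)) - b n" if "1 \<le> n" "n \<le> T" for n
    using that
  proof (induction n rule: dec_induct)
    case base
    then show ?case using a[of 1] by simp
  next
    case (step n)
    have IH: "(\<Sum>t = 1..n. a t - b t) \<le> B * real (Suc ((n - 1) div \<Delta>)) - b n" using step by simp
    have mono: "(n - 1) div \<Delta> \<le> n div \<Delta>" by (rule div_le_mono) simp
    show ?case
    proof (cases "n div \<Delta> = (n - 1) div \<Delta>")
      case True
      then have "a (Suc n) = b n" using assms(5) step by simp
      then show ?thesis using IH True step by simp
    next
      case False
      then have "Suc ((n - 1) div \<Delta>) \<le> n div \<Delta>" using mono by simp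
      then have "B * real (Suc (Suc ((n - 1) div \<Delta>))) \<le> B * real (Suc (n div \<Delta>))"
        using B by (intro mult_left_mono) auto
      moreover have "a (Suc n) \<le> B" "0 \<le> b n" using a b step by auto
      ultimately show ?thesis using IH step by (simp add: algebra_simps)
    qed
  qed
  from this[of T] T b[of T] show ?thesis by simp
qed

text \<open>After exchanging the sums, \<open>W k\<close> is counted once for every round t with s t
  < k \<le> t. Such t satisfy k \<le> t < k + \<Delta>, so there are at most \<Delta> of
  them.\<close>

lemma batch_window_sum_le:
  fixes W :: "nat \<Rightarrow> real"
  assumes W: "\<And>k. 0 \<le> W k" and s: "\<And>t. t \<in> {1..T} \<Longrightarrow> 1 \<le> s t \<and> t < s t + \<Delta>"
  shows "(\<Sum>t = 1..T. \<Sum>k = Suc (s t)..t. W k) \<le> real \<Delta> * (\<Sum>k = 2..T. W k)"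
proof -
  have "(\<Sum>t = 1..T. \<Sum>k = Suc (s t)..t. W k) = (\<Sum>t = 1..T. \<Sum>k = 2..T. if s t < k \<and> k \<le> t then W k else 0)"
  proof (rule sum.cong[OF refl])
    fix t assume "t \<in> {1..T}"
    then have "{Suc (s t)..t} = {k \<in> {2..T}. s t < k \<and> k \<le> t}" using s[of t] by auto
    then show "(\<Sum>k = Suc (s t)..t. W k) = (\<Sum>k = 2..T. if s t < k \<and> k \<le> t then W k else 0)"
      by (simp only: sum.inter_filter[OF finite_atLeastAtMost])
  qed
  also have "\<dots> = (\<Sum>k = 2..T. \<Sum>t = 1..T. if s t < k \<and> k \<le> t then W k else 0)"
    by (rule sum.swap)
  also have "\<dots> \<le> (\<Sum>k = 2..T. real \<Delta> * W k)"
  proof (rule sum_mono)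
    fix k
    have "(\<Sum>t = 1..T. if s t < k \<and> k \<le> t then W k else 0) = (\<Sum>t\<in>{t \<in> {1..T}. s t < k \<and> k \<le> t}. W k)"
      by (simp only: sum.inter_filter[OF finite_atLeastAtMost])
    also have "\<dots> = real (card {t \<in> {1..T}. s t < k \<and> k \<le> t}) * W k" by simp
    also have "card {t \<in> {1..T}. s t < k \<and> k \<le> t} \<le> card {k..<k + \<Delta>}"
      by (rule card_mono) (use s in fastforce)+
    then have "real (card {t \<in> {1..T}. s t < k \<and> k \<le> t}) * W k \<le> real \<Delta> * W k"
      using W[of k] by (intro mult_right_mono) auto
    finally show "(\<Sum>t = 1..T. if s t < k \<and> k \<le> t then W k else 0) \<le> real \<Delta> * W k" .
  qed
  also have "\<dots> = real \<Delta> * (\<Sum>k = 2..T. W k)" by (simp add: sum_distrib_left)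
  finally show ?thesis .
qed

section \<open>Expected regret of the algorithm\<close>

text \<open>With s = 1 - \<delta> / r, the point x + \<delta> u is the convex combination of x / s
  and r u with weights s and 1 - s, as (1 - s) r = \<delta>.\<close>

lemma shrunk_set_ball:
  assumes X: "convex X" "cball 0 r \<subseteq> X" and \<delta>: "0 < \<delta>" "\<delta> < r"
    and x: "x \<in> shrunk_set X r \<delta>" and u: "norm u \<le> 1"
  shows "x + \<delta> *\<^sub>R u \<in> X"
proof -
  define s where "s = 1 - \<delta> / r"
  have s: "0 < s" "s < 1" and sr: "(1 - s) * r = \<delta>" using \<delta> by (auto simp: s_def divide_less_eq)
  have "norm (r *\<^sub>R u) \<le> r" using u \<delta> by (simp add: mult_left_le)
  then have "r *\<^sub>R u \<in> X" using X(2) by auto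
  moreover have "(1 / s) *\<^sub>R x \<in> X" using x by (simp add: shrunk_set_def s_def)
  ultimately have "s *\<^sub>R ((1 / s) *\<^sub>R x) + (1 - s) *\<^sub>R (r *\<^sub>R u) \<in> X"
    using X(1) s by (intro convexD) auto
  then show ?thesis using s by (simp add: sr)
qed

lemma convex_shrunk_set: "convex X \<Longrightarrow> convex (shrunk_set X r \<delta>)"
proof (rule convexI)
  fix x y and a b :: real
  assume X: "convex X" and xy: "x \<in> shrunk_set X r \<delta>" "y \<in> shrunk_set X r \<delta>" and ab: "0 \<le> a" "0 \<le> b" "a + b = 1"
  define k where "k = 1 / (1 - \<delta> / r)"
  have eq: "k *\<^sub>R (a *\<^sub>R x + b *\<^sub>R y) = a *\<^sub>R (k *\<^sub>R x) + b *\<^sub>R (k *\<^sub>R y)"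
    by (simp add: algebra_simps)
  have "x \<in> X" "y \<in> X" "k *\<^sub>R x \<in> X" "k *\<^sub>R y \<in> X"
    using xy by (simp_all add: shrunk_set_def k_def)
  then have "a *\<^sub>R x + b *\<^sub>R y \<in> X" "a *\<^sub>R (k *\<^sub>R x) + b *\<^sub>R (k *\<^sub>R y) \<in> X"
    using X ab by (simp_all only: convexD)
  then show "a *\<^sub>R x + b *\<^sub>R y \<in> shrunk_set X r \<delta>"
    unfolding shrunk_set_def k_def[symmetric] mem_Collect_eq eq by simp
qed

lemma shrink_in_shrunk_set:
  assumes X: "convex X" "0 \<in> X" and \<delta>: "0 < \<delta>" "\<delta> < r" and x: "x \<in> X"
  shows "(1 - \<delta> / r) *\<^sub>R x \<in> shrunk_set X r \<delta>"
proof -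
  have s: "0 < 1 - \<delta> / r" "1 - \<delta> / r < 1" using \<delta> by (auto simp: divide_less_eq)
  have "(1 - \<delta> / r) *\<^sub>R x + (\<delta> / r) *\<^sub>R 0 \<in> X" using X x s \<delta> by (intro convexD) auto
  then show ?thesis using s x X(2) by (auto simp: shrunk_set_def)
qed

text \<open>\<open>S\<close> need not be closed, so the library facts about closest points are
  applied to its closure; a minimiser over \<open>S\<close> also minimises there. This makes the
  projected step unique, nonexpansive and a continuous function of its argument.\<close>

lemma arg_min_dist_eq_closest_point:
  fixes S :: "'a::euclidean_space set"
  assumes S: "convex S" and p: "is_arg_min (\<lambda>y. (norm (a - y))\<^sup>2) (\<lambda>y. y \<in> S) p"
  shows "p = closest_point (closure S) a"
proof (rule closest_point_unique)
  show "convex (closure S)" using S by (rule convex_closure)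
  show "closed (closure S)" by simp
  show "p \<in> closure S" using p closure_subset by (auto simp: is_arg_min_def)
  have min: "dist a p \<le> dist a z" if "z \<in> S" for z
  proof -
    have "(norm (a - p))\<^sup>2 \<le> (norm (a - z))\<^sup>2" using p that by (auto simp: is_arg_min_def not_less)
    then show ?thesis by (simp add: dist_norm)
  qed
  show "\<forall>z\<in>closure S. dist a p \<le> dist a z"
  proof (rule ballI, rule field_le_epsilon)
    fix z and e :: real assume "z \<in> closure S" "0 < e"
    then obtain z' where z': "z' \<in> S" "dist z' z < e" using closure_approachable by blast
    have "dist a p \<le> dist a z'" using z' by (intro min)
    also have "\<dots> \<le> dist a z + dist z' z" by (metis dist_commute dist_triangle)
    finally show "dist a p \<le> dist a z + e" using z' by simp
  qed
qed

text \<open>The comparator is its own projection, so nonexpansiveness gives norm (p - y) \<le> norm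
  (x - \<eta> g - y); expanding the square isolates the inner product.\<close>

lemma projection_step_le:
  fixes S :: "'a::euclidean_space set"
  assumes S: "convex S" and p: "is_arg_min (\<lambda>y. (norm (x - \<eta> *\<^sub>R g - y))\<^sup>2) (\<lambda>y. y \<in> S) p"
    and y: "y \<in> S" and \<eta>: "0 < \<eta>" and g: "norm g \<le> B"
  shows "g \<bullet> (x - y) \<le> ((norm (x - y))\<^sup>2 - (norm (p - y))\<^sup>2) / (2 * \<eta>) + \<eta> / 2 * B\<^sup>2"
proof -
  have yc: "closest_point (closure S) y = y"
    using y closure_subset by (intro closest_point_self) auto
  have "norm (p - y) \<le> norm (x - \<eta> *\<^sub>R g - y)"
    using closest_point_lipschitz[OF convex_closure[OF S] closed_closure, of "x - \<eta> *\<^sub>R g" y] y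
      arg_min_dist_eq_closest_point[OF S p] yc by (auto simp: dist_norm)
  then have "(norm (p - y))\<^sup>2 \<le> (norm ((x - y) - \<eta> *\<^sub>R g))\<^sup>2"
    by (intro power_mono) (auto simp: algebra_simps)
  also have "\<dots> = (norm (x - y))\<^sup>2 - 2 * \<eta> * (g \<bullet> (x - y)) + \<eta>\<^sup>2 * (norm g)\<^sup>2"
    unfolding power2_norm_eq_inner by (simp add: inner_diff inner_commute power2_eq_square algebra_simps)
  also have "\<eta>\<^sup>2 * (norm g)\<^sup>2 \<le> \<eta>\<^sup>2 * B\<^sup>2" using g by (intro mult_left_mono power_mono) auto
  finally have "2 * \<eta> * (g \<bullet> (x - y)) \<le> (norm (x - y))\<^sup>2 - (norm (p - y))\<^sup>2 + \<eta>\<^sup>2 * B\<^sup>2" by simp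
  then have "g \<bullet> (x - y) \<le> ((norm (x - y))\<^sup>2 - (norm (p - y))\<^sup>2 + \<eta>\<^sup>2 * B\<^sup>2) / (2 * \<eta>)"
    using \<eta> by (simp add: le_divide_eq mult_ac)
  also have "\<dots> = ((norm (x - y))\<^sup>2 - (norm (p - y))\<^sup>2) / (2 * \<eta>) + \<eta> / 2 * B\<^sup>2"
    using \<eta> by (simp add: field_simps power2_eq_square)
  finally show ?thesis .
qed

lemma Int_stable_vimage: "Int_stable {f -` A \<inter> \<Omega> | A. A \<in> sets N}"
proof (rule Int_stableI)
  fix a b assume "a \<in> {f -` A \<inter> \<Omega> | A. A \<in> sets N}" "b \<in> {f -` A \<inter> \<Omega> | A. A \<in> sets N}"
  then obtain A B where "A \<in> sets N" "a = f -` A \<inter> \<Omega>" "B \<in> sets N" "b = f -` B \<inter> \<Omega>" by auto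
  then show "a \<inter> b \<in> {f -` A \<inter> \<Omega> | A. A \<in> sets N}"
    by (intro CollectI exI[of _ "A \<inter> B"]) auto
qed

text \<open>The algorithm evaluates \<open>J\<close>, the analysis \<open>J'\<close>. As every
  played point lies in \<open>X\<close>, where the two coincide, the gradient estimates and risks
  met along a run are the same.\<close>

locale bounded_risk_run = zeroth_order_cvar_run M X J D r \<alpha> \<delta> \<eta> \<phi> \<Delta> T x1 u \<xi> xhat x +
    measurable_cost J' U \<alpha>
  for M :: "'m measure"
    and X :: "'a::euclidean_space set"
    and J :: "'a \<Rightarrow> 'b::metric_space \<Rightarrow> real"
    and D :: "nat \<Rightarrow> 'b measure"
    and r \<alpha> \<delta> :: real and \<eta> :: "nat \<Rightarrow> real" and \<phi> :: "nat \<Rightarrow> nat" and \<Delta> T :: nat and x1 :: 'a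
    and u :: "nat \<Rightarrow> 'm \<Rightarrow> 'a" and \<xi> :: "nat \<Rightarrow> nat \<Rightarrow> 'm \<Rightarrow> 'b" and xhat x :: "nat \<Rightarrow> 'm \<Rightarrow> 'a"
    and J' :: "'a \<Rightarrow> 'b \<Rightarrow> real" and U :: real +
  fixes R L :: real
  assumes \<delta>: "0 < \<delta>" "\<delta> < r" and ball: "cball 0 r \<subseteq> X" and norm_X: "\<And>x. x \<in> X \<Longrightarrow> norm x \<le> R"
    and J'_eq: "\<And>x z. x \<in> X \<Longrightarrow> J' x z = J x z"
    and convex: "convex X" and \<Delta>: "1 \<le> \<Delta>" and \<phi>: "\<And>\<tau>. \<tau> \<in> {1..\<Delta>} \<Longrightarrow> 1 \<le> \<phi> \<tau>"
    and prob_D: "\<And>t. t \<in> {1..T} \<Longrightarrow> prob_space (D t)" and sets_D: "\<And>t. t \<in> {1..T} \<Longrightarrow> sets (D t) = sets borel"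
    and convex_C: "\<And>t. t \<in> {1..T} \<Longrightarrow> convex_on X (cvar_cost \<alpha> J (D t))"
    and lipschitz_C: "\<And>t. t \<in> {1..T} \<Longrightarrow> L-lipschitz_on X (cvar_cost \<alpha> J (D t))"
begin

abbreviation "S \<equiv> shrunk_set X r \<delta>"
abbreviation "C t \<equiv> cvar_cost \<alpha> J (D t)"
abbreviation "C' t \<equiv> cvar_cost \<alpha> J' (D t)"
abbreviation "samples t \<equiv> \<phi> (epoch \<Delta> t)"
abbreviation "Chat t \<omega> \<equiv> CVaR \<alpha> (empirical_cdf (samples t) (\<lambda>i. J' (xhat t \<omega>) (\<xi> t i \<omega>)))"
abbreviation "ghat t \<omega> \<equiv>
  gradient_estimate J \<alpha> \<delta> (samples t) (xhat t \<omega>) (u t \<omega>) (\<lambda>i. \<xi> t i \<omega>)"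

lemma samples_pos: "t \<in> {1..T} \<Longrightarrow> 1 \<le> samples t"
  using \<phi> epoch_in_range \<Delta> by auto

lemma S_subset: "y \<in> S \<Longrightarrow> y \<in> X" by (simp add: shrunk_set_def)

lemma C'_eq: "y \<in> X \<Longrightarrow> C' t y = C t y"
  by (simp add: cvar_cost_def J'_eq cong: arg_cong[where f = "distr (D t) borel"]) (metis J'_eq ext)

lemma iterate_in_S: "\<omega> \<in> space M \<Longrightarrow> t \<in> {1..Suc T} \<Longrightarrow> x t \<omega> \<in> S"
proof (cases "t = 1")
  case True
  assume "\<omega> \<in> space M"
  then show ?thesis using initial True by simp
next
  case False
  assume \<omega>: "\<omega> \<in> space M" and t: "t \<in> {1..Suc T}"
  then obtain s where s: "t = Suc s" "s \<in> {1..T}" using False by (cases t) auto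
  show ?thesis using projected_step[OF s(2) \<omega>] s by (simp add: is_arg_min_def)
qed

lemma norm_u: "\<omega> \<in> space M \<Longrightarrow> t \<in> {1..T} \<Longrightarrow> norm (u t \<omega>) = 1"
  using direction(2) by simp

lemma xhat_in_X: "\<omega> \<in> space M \<Longrightarrow> t \<in> {1..T} \<Longrightarrow> xhat t \<omega> \<in> X"
  using shrunk_set_ball[OF convex ball \<delta> iterate_in_S[of \<omega> t], of "u t \<omega>"] played norm_u by simp

lemma ghat_eq: "\<omega> \<in> space M \<Longrightarrow> t \<in> {1..T} \<Longrightarrow> ghat t \<omega> = (real DIM('a) / \<delta> * Chat t \<omega>) *\<^sub>R u t \<omega>"
  using J'_eq[OF xhat_in_X] by (simp add: gradient_estimate_def)

section \<open>Information carried by the random inputs\<close>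

text \<open>\<open>Inl t\<close> stands for the direction of round t and \<open>Inr (t, i)\<close>
  for the i-th sample of that round: the index set of the assumption
  \<open>independent\<close>.\<close>

definition sources :: "(nat + nat \<times> nat) set" where
  "sources = {1..T} <+> (SIGMA t:{1..T}. {1..samples t})"

definition source_events :: "nat + nat \<times> nat \<Rightarrow> 'm set set" where
  "source_events = case_sum (\<lambda>t. {u t -` A \<inter> space M | A. A \<in> sets borel})
    (\<lambda>(t, i). {\<xi> t i -` A \<inter> space M | A. A \<in> sets borel})"

definition info :: "(nat + nat \<times> nat) set \<Rightarrow> 'm measure" where
  "info I = sigma (space M) (\<Union>i\<in>I. source_events i)"

definition past :: "nat \<Rightarrow> (nat + nat \<times> nat) set" where
  "past t = {i \<in> sources. case_sum id fst i < t}"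

lemma source_events_Pow: "source_events i \<subseteq> Pow (space M)"
  by (auto simp: source_events_def split: sum.splits)

lemma space_info [simp]: "space (info I) = space M"
  unfolding info_def using source_events_Pow by (intro space_measure_of) auto

lemma sets_info: "sets (info I) = sigma_sets (space M) (\<Union>i\<in>I. source_events i)"
  unfolding info_def using source_events_Pow by (intro sets_measure_of) auto

lemma info_mono: "I \<subseteq> I' \<Longrightarrow> f \<in> measurable (info I) N \<Longrightarrow> f \<in> measurable (info I') N"
proof -
  assume I: "I \<subseteq> I'" and f: "f \<in> measurable (info I) N"
  have "sets (info I) \<subseteq> sets (info I')"
    unfolding sets_info by (rule sigma_sets_mono') (use I in auto)
  then show ?thesis using f unfolding measurable_def by auto
qed

lemma source_events_subset: "i \<in> sources \<Longrightarrow> source_events i \<subseteq> events"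
  using independent unfolding indep_sets_def sources_def source_events_def by blast

lemma info_measurable: "I \<subseteq> sources \<Longrightarrow> f \<in> measurable (info I) N \<Longrightarrow> f \<in> measurable M N"
proof -
  assume I: "I \<subseteq> sources" and f: "f \<in> measurable (info I) N"
  have "sets (info I) \<subseteq> events"
    unfolding sets_info using I source_events_subset by (intro sets.sigma_sets_subset) auto
  then show ?thesis using f unfolding measurable_def by auto
qed

lemma source_events_info: "i \<in> I \<Longrightarrow> A \<in> source_events i \<Longrightarrow> A \<in> sets (info I)"
  unfolding sets_info by (intro sigma_sets.Basic) auto

lemma u_info: "Inl t \<in> I \<Longrightarrow> u t \<in> borel_measurable (info I)"
proof (rule measurableI)
  fix A :: "'a set" assume "Inl t \<in> I" "A \<in> sets borel"
  then show "u t -` A \<inter> space (info I) \<in> sets (info I)"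
    by (intro source_events_info[of "Inl t"]) (auto simp: source_events_def)
qed simp

lemma \<xi>_info: "Inr (t, i) \<in> I \<Longrightarrow> \<xi> t i \<in> borel_measurable (info I)"
proof (rule measurableI)
  fix A :: "'b set" assume "Inr (t, i) \<in> I" "A \<in> sets borel"
  then show "\<xi> t i -` A \<inter> space (info I) \<in> sets (info I)"
    by (intro source_events_info[of "Inr (t, i)"]) (auto simp: source_events_def)
qed simp

text \<open>Independent families that are stable under intersection may be grouped: disjoint groups
  generate independent \<sigma>-algebras. The two groups are indexed by booleans to match
  \<open>indep_set\<close>.\<close>

lemma indep_info:
  assumes I: "I \<subseteq> sources" "I' \<subseteq> sources" "I \<inter> I' = {}"
    and A: "A \<in> measurable (info I) N" and B: "B \<in> measurable (info I') N'"
  shows "indep_pair N A N' B"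
proof (rule indep_pairI)
  have "indep_sets (\<lambda>b. sigma_sets (space M) (\<Union>i\<in>case_bool I I' b. source_events i)) UNIV"
  proof (rule indep_sets_collect_sigma)
    show "indep_sets source_events (\<Union>b. case_bool I I' b)"
      using independent unfolding source_events_def[symmetric] sources_def[symmetric]
      by (rule indep_sets_mono_index[rotated]) (use I in \<open>auto split: bool.splits\<close>)
    show "disjoint_family_on (case_bool I I') UNIV"
      using I(3) by (auto simp: disjoint_family_on_def split: bool.splits)
    fix b i
    show "Int_stable (source_events i)"
      by (cases i) (auto simp: source_events_def Int_stable_vimage)
  qed
  moreover have "(\<lambda>b. sigma_sets (space M) (\<Union>i\<in>case_bool I I' b. source_events i)) =
      case_bool (sets (info I)) (sets (info I'))"
    by (auto simp: sets_info fun_eq_iff split: bool.splits)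
  ultimately show "indep_set (sets (info I)) (sets (info I'))"
    unfolding indep_set_def by simp
  show "A -` Z \<inter> space M \<in> sets (info I)" if "Z \<in> sets N" for Z
    using measurable_sets[OF A that] by simp
  show "B -` Z \<inter> space M \<in> sets (info I')" if "Z \<in> sets N'" for Z
    using measurable_sets[OF B that] by simp
qed (use A B I info_measurable in blast)+

text \<open>\<open>past t\<close> stops before round t, so measurability with respect to it is what
  makes \<open>x t\<close> independent of the direction and the samples drawn in round t. The
  induction rewrites the update with \<open>J'\<close>, for which joint measurability is
  available.\<close>

lemma iterate_info: "t \<in> {1..T} \<Longrightarrow> x t \<in> borel_measurable (info (past t))"
proof (induction t)
  case (Suc t)
  show ?case
  proof (cases "t = 0")
    case True
    have "(\<lambda>\<omega>. x1) \<in> borel_measurable (info (past (Suc t)))" by simp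
    then show ?thesis
      by (rule measurable_cong[THEN iffD1, rotated]) (use True initial in simp)
  next
    case False
    then have t: "t \<in> {1..T}" using Suc by auto
    let ?F = "info (past (Suc t))"
    have xt [measurable]: "x t \<in> borel_measurable ?F"
      by (rule info_mono[OF _ Suc.IH[OF t]]) (auto simp: past_def)
    have ut [measurable]: "u t \<in> borel_measurable ?F"
      by (rule u_info) (use t in \<open>auto simp: past_def sources_def\<close>)
    have \<xi>t [measurable]: "\<xi> t i \<in> borel_measurable ?F" if "i \<in> {1..samples t}" for i
      by (rule \<xi>_info) (use t that in \<open>auto simp: past_def sources_def\<close>)
    have [measurable]: "(\<lambda>\<omega>. CVaR \<alpha> (empirical_cdf (samples t) (\<lambda>i. J' (x t \<omega> + \<delta> *\<^sub>R u t \<omega>) (\<xi> t i \<omega>)))) \<in> borel_measurable ?F"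
      by (rule measurable_empirical_cvar[OF samples_pos[OF t]]) measurable
    \<comment> \<open>The next iterate is specified only as some minimiser; identifying it with the
      closest point of the closure makes it a continuous function of the unprojected point.\<close>
    have cp: "closest_point (closure S) \<in> borel_measurable borel"
    proof (rule borel_measurable_continuous_onI, rule continuous_on_closest_point)
      show "closure S \<noteq> {}" using initial(1) closure_subset by auto
    qed (auto intro: convex_closure convex_shrunk_set convex)
    have "(\<lambda>\<omega>. closest_point (closure S) (x t \<omega> - \<eta> t *\<^sub>R ((real DIM('a) / \<delta> *
        CVaR \<alpha> (empirical_cdf (samples t) (\<lambda>i. J' (x t \<omega> + \<delta> *\<^sub>R u t \<omega>) (\<xi> t i \<omega>)))) *\<^sub>R u t \<omega>)))
        \<in> borel_measurable ?F"
      by (rule measurable_compose[OF _ cp]) measurable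
    then show ?thesis
    proof (rule measurable_cong[THEN iffD1, rotated])
      fix \<omega> assume "\<omega> \<in> space ?F"
      then have \<omega>: "\<omega> \<in> space M" by simp
      show "closest_point (closure S) (x t \<omega> - \<eta> t *\<^sub>R ((real DIM('a) / \<delta> *
        CVaR \<alpha> (empirical_cdf (samples t) (\<lambda>i. J' (x t \<omega> + \<delta> *\<^sub>R u t \<omega>) (\<xi> t i \<omega>)))) *\<^sub>R u t \<omega>)) = x (Suc t) \<omega>"
        using arg_min_dist_eq_closest_point[OF convex_shrunk_set[OF convex] projected_step[OF t \<omega>]]
          ghat_eq[OF \<omega> t] played[OF t \<omega>] by simp
    qed
  qed
qed simp

lemma past_subset: "past t \<subseteq> sources" by (auto simp: past_def)

lemma measurable_iterate: "t \<in> {1..T} \<Longrightarrow> x t \<in> borel_measurable M"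
  using iterate_info past_subset info_measurable by blast

lemma xhat_info: "t \<in> {1..T} \<Longrightarrow> Inl t \<in> I \<Longrightarrow> past t \<subseteq> I \<Longrightarrow> xhat t \<in> borel_measurable (info I)"
proof -
  assume t: "t \<in> {1..T}" and I: "Inl t \<in> I" "past t \<subseteq> I"
  have [measurable]: "x t \<in> borel_measurable (info I)" using info_mono[OF I(2) iterate_info[OF t]] .
  have [measurable]: "u t \<in> borel_measurable (info I)" using u_info[OF I(1)] .
  have "(\<lambda>\<omega>. x t \<omega> + \<delta> *\<^sub>R u t \<omega>) \<in> borel_measurable (info I)" by measurable
  then show ?thesis by (rule measurable_cong[THEN iffD1, rotated]) (use played[OF t] in simp)
qed

lemma measurable_xhat: "t \<in> {1..T} \<Longrightarrow> xhat t \<in> borel_measurable M"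
  by (rule info_measurable[OF subset_refl xhat_info[OF _ _ past_subset]]) (auto simp: sources_def)

lemma measurable_\<xi>: "t \<in> {1..T} \<Longrightarrow> i \<in> {1..samples t} \<Longrightarrow> \<xi> t i \<in> borel_measurable M"
  using noise(1) .

lemma measurable_C': "t \<in> {1..T} \<Longrightarrow> C' t \<in> borel_measurable borel"
  using measurable_cvar_cost prob_D sets_D by auto

lemma measurable_Chat: "t \<in> {1..T} \<Longrightarrow> Chat t \<in> borel_measurable M"
  by (intro measurable_empirical_cvar samples_pos measurable_xhat measurable_\<xi>)

lemma abs_C'_le: "t \<in> {1..T} \<Longrightarrow> \<bar>C' t y\<bar> \<le> U"
  using abs_cvar_cost_le prob_D sets_D by auto

lemma abs_Chat_le: "t \<in> {1..T} \<Longrightarrow> \<bar>Chat t \<omega>\<bar> \<le> U"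
  by (intro abs_empirical_cvar_le samples_pos)

lemma indep_iterate_direction: "t \<in> {1..T} \<Longrightarrow> indep_pair borel (x t) borel (u t)"
  by (rule indep_info[OF past_subset _ _ iterate_info u_info[of t "{Inl t}"]])
    (auto simp: past_def sources_def)

lemma estimator_error:
  assumes t: "t \<in> {1..T}"
  shows "(LINT \<omega>|M. \<bar>Chat t \<omega> - C' t (xhat t \<omega>)\<bar>) \<le> 2 * U / \<alpha> / sqrt (real (samples t))"
proof (rule sampling_error[OF prob_space_axioms samples_pos[OF t] measurable_xhat[OF t] measurable_\<xi>[OF t]])
  fix i j assume ij: "i \<in> {1..samples t}" "j \<in> {1..samples t}" "i \<noteq> j"
  \<comment> \<open>The inputs that determine the played point together with sample i; sample j is
    not among them.\<close>
  let ?I = "past t \<union> {Inl t, Inr (t, i)}"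
  have [measurable]: "xhat t \<in> borel_measurable (info ?I)" by (rule xhat_info[OF t]) auto
  have [measurable]: "\<xi> t i \<in> borel_measurable (info ?I)" by (rule \<xi>_info) simp
  have "(\<lambda>\<omega>. (xhat t \<omega>, \<xi> t i \<omega>)) \<in> measurable (info ?I) (borel \<Otimes>\<^sub>M borel)" by measurable
  moreover have "\<xi> t j \<in> borel_measurable (info {Inr (t, j)})" by (rule \<xi>_info) simp
  moreover have "?I \<subseteq> sources" "{Inr (t, j)} \<subseteq> sources" "?I \<inter> {Inr (t, j)} = {}"
    using t ij by (auto simp: past_def sources_def)
  ultimately show "indep_pair (borel \<Otimes>\<^sub>M borel) (\<lambda>\<omega>. (xhat t \<omega>, \<xi> t i \<omega>)) borel (\<xi> t j)"
    by (intro indep_info)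
qed (use t noise in auto)

end

section \<open>Regret in expectation\<close>

context bounded_risk_run begin

lemma zero_in_X: "0 \<in> X" using ball \<delta> by auto

lemma R_nonneg: "0 \<le> R"
  using norm_X[OF zero_in_X] by simp

lemma norm_diff_X: "y \<in> X \<Longrightarrow> z \<in> X \<Longrightarrow> norm (y - z) \<le> 2 * R"
  using norm_triangle_ineq4[of y z] norm_X[of y] norm_X[of z] by linarith

lemma integrable_bounded_rv:
  fixes f :: "'m \<Rightarrow> real"
  assumes "f \<in> borel_measurable M" "\<And>\<omega>. \<omega> \<in> space M \<Longrightarrow> \<bar>f \<omega>\<bar> \<le> B"
  shows "integrable M f"
  by (rule integrable_const_bound[where B = B]) (use assms in \<open>auto intro!: AE_I2\<close>)

lemma integrable_C'_iterate: "t \<in> {1..T} \<Longrightarrow> integrable M (\<lambda>\<omega>. C' t (x t \<omega>))"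
  by (rule integrable_bounded_rv[where B = U])
    (auto intro!: measurable_compose[OF measurable_iterate measurable_C'] abs_C'_le)

lemma integrable_C'_xhat: "t \<in> {1..T} \<Longrightarrow> integrable M (\<lambda>\<omega>. C' t (xhat t \<omega>))"
  by (rule integrable_bounded_rv[where B = U])
    (auto intro!: measurable_compose[OF measurable_xhat measurable_C'] abs_C'_le)

text \<open>Given \<open>x t\<close>, the direction is uniform on the sphere, so the sphere
  inequality applies for each \<omega> and is then averaged. It is applied to the convex extension
  \<open>g\<close> rather than to \<open>C' t\<close>, whose convexity is known only on
  \<open>X\<close>; both agree at all points x + \<delta> b with norm b \<le> 1, which lie in
  \<open>X\<close>.\<close>

lemma expected_subgradient_step:
  assumes t: "t \<in> {1..T}" and y: "y \<in> S"
  shows "(LINT \<omega>|M. C' t (x t \<omega>)) - C t y - 2 * L * \<delta>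
    \<le> real DIM('a) / \<delta> * (LINT \<omega>|M. C' t (xhat t \<omega>) * (u t \<omega> \<bullet> (x t \<omega> - y)))"
proof -
  obtain g where g: "convex_on UNIV g" "L-lipschitz_on UNIV g" "\<And>z. z \<in> X \<Longrightarrow> g z = C t z"
    using convex_lipschitz_extension[OF convex_C[OF t] lipschitz_C[OF t]] y S_subset by blast
  define f where "f w = C' t (fst w + \<delta> *\<^sub>R snd w) * (snd w \<bullet> (fst w - y))" for w :: "'a \<times> 'a"
  note [measurable] = measurable_C'[OF t] measurable_iterate[OF t] measurable_xhat[OF t] direction(1)[OF t]
  have f [measurable]: "f \<in> borel_measurable (borel \<Otimes>\<^sub>M borel)"
    unfolding f_def[abs_def] by measurable
  have f_le: "\<bar>f (x t \<omega>, b)\<bar> \<le> U * (2 * R)" if "\<omega> \<in> space M" "norm b \<le> 1" for \<omega> b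
  proof -
    have "\<bar>b \<bullet> (x t \<omega> - y)\<bar> \<le> norm b * norm (x t \<omega> - y)" by (rule Cauchy_Schwarz_ineq2)
    also have "\<dots> \<le> 1 * (2 * R)"
      using iterate_in_S[OF that(1), of t] t y S_subset
      by (intro mult_mono that norm_diff_X) auto
    finally show ?thesis
      unfolding f_def by (simp only: abs_mult fst_conv snd_conv) (intro mult_mono abs_C'_le t, auto simp: U_nonneg)
  qed
  have int_f: "integrable M (\<lambda>\<omega>. f (x t \<omega>, u t \<omega>))"
    by (rule integrable_bounded_rv[where B = "U * (2 * R)"]) (use f_le norm_u t in auto)
  have pointwise: "C' t (x t \<omega>) - (C t y + 2 * L * \<delta>) \<le>
      real DIM('a) / \<delta> * (LINT b|distr M borel (u t). f (x t \<omega>, b))" if \<omega>: "\<omega> \<in> space M" for \<omega>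
  proof -
    have xS: "x t \<omega> \<in> S" using iterate_in_S[OF \<omega>] t by simp
    have gm [measurable]: "g \<in> borel_measurable borel"
      using lipschitz_on_continuous_on[OF g(2)] by (rule borel_measurable_continuous_onI)
    have "(LINT b|distr M borel (u t). f (x t \<omega>, b)) =
        (LINT b|uniform_sphere. g (x t \<omega> + \<delta> *\<^sub>R b) * (b \<bullet> (x t \<omega> - y)))"
      unfolding direction(3)[OF t]
    proof (rule integral_cong_AE)
      show "AE b in uniform_sphere. f (x t \<omega>, b) = g (x t \<omega> + \<delta> *\<^sub>R b) * (b \<bullet> (x t \<omega> - y))"
        using AE_uniform_sphere
      proof eventually_elim
        case (elim b)
        have "x t \<omega> + \<delta> *\<^sub>R b \<in> X" by (rule shrunk_set_ball[OF convex ball \<delta> xS elim])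
        then show ?case by (simp add: f_def g(3) C'_eq)
      qed
    qed simp_all
    moreover have "C' t (x t \<omega>) = g (x t \<omega>)" "C t y = g y"
      using xS y S_subset by (auto simp: g(3) C'_eq)
    ultimately show ?thesis
      using sphere_gradient_inequality[OF g(1,2) \<delta>(1), of "x t \<omega>" y] by simp
  qed
  note ind = integral_indep_pair[OF indep_iterate_direction[OF t] f int_f]
  have "(LINT \<omega>|M. C' t (x t \<omega>)) - (C t y + 2 * L * \<delta>) = (LINT \<omega>|M. C' t (x t \<omega>) - (C t y + 2 * L * \<delta>))"
    using integrable_C'_iterate[OF t] by (simp add: prob_space)
  also have "\<dots> \<le> (LINT \<omega>|M. real DIM('a) / \<delta> * (LINT b|distr M borel (u t). f (x t \<omega>, b)))"
    by (intro integral_mono pointwise integrable_mult_right ind(2)) (use integrable_C'_iterate[OF t] in auto)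
  also have "\<dots> = real DIM('a) / \<delta> * (LINT \<omega>|M. f (x t \<omega>, u t \<omega>))"
    by (simp add: ind(1))
  also have "(LINT \<omega>|M. f (x t \<omega>, u t \<omega>)) = (LINT \<omega>|M. C' t (xhat t \<omega>) * (u t \<omega> \<bullet> (x t \<omega> - y)))"
    by (intro Bochner_Integration.integral_cong) (auto simp: f_def played[OF t])
  finally show ?thesis by simp
qed

lemma integrable_ghat:
  assumes t: "t \<in> {1..T}" and y: "y \<in> X"
  shows "integrable M (\<lambda>\<omega>. Chat t \<omega> * (u t \<omega> \<bullet> (x t \<omega> - y)))"
    "integrable M (\<lambda>\<omega>. C' t (xhat t \<omega>) * (u t \<omega> \<bullet> (x t \<omega> - y)))"
    and inner_le: "\<And>\<omega>. \<omega> \<in> space M \<Longrightarrow> \<bar>u t \<omega> \<bullet> (x t \<omega> - y)\<bar> \<le> 2 * R"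
proof -
  note [measurable] = measurable_C'[OF t] measurable_iterate[OF t] measurable_xhat[OF t] direction(1)[OF t] measurable_Chat[OF t]
  show 1: "\<bar>u t \<omega> \<bullet> (x t \<omega> - y)\<bar> \<le> 2 * R" if \<omega>: "\<omega> \<in> space M" for \<omega>
    using Cauchy_Schwarz_ineq2[of "u t \<omega>" "x t \<omega> - y"] norm_u[OF \<omega> t]
      norm_diff_X[OF S_subset y] iterate_in_S[OF \<omega>, of t] t by (auto intro: order_trans)
  show "integrable M (\<lambda>\<omega>. Chat t \<omega> * (u t \<omega> \<bullet> (x t \<omega> - y)))"
    by (rule integrable_bounded_rv[where B = "U * (2 * R)"])
      (measurable, unfold abs_mult, intro mult_mono abs_Chat_le[OF t] 1, auto simp: U_nonneg)
  show "integrable M (\<lambda>\<omega>. C' t (xhat t \<omega>) * (u t \<omega> \<bullet> (x t \<omega> - y)))"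
    by (rule integrable_bounded_rv[where B = "U * (2 * R)"])
      (measurable, unfold abs_mult, intro mult_mono abs_C'_le[OF t] 1, auto simp: U_nonneg)
qed

text \<open>The exact risk at the played point is exchanged for its estimate. The inner product
  multiplying the error is at most 2 R, so the mean absolute error of the estimate is enough and no
  unbiasedness enters.\<close>

lemma expected_step:
  assumes t: "t \<in> {1..T}" and y: "y \<in> S"
  shows "(LINT \<omega>|M. C' t (x t \<omega>)) - C t y \<le> 2 * L * \<delta> +
    (LINT \<omega>|M. real DIM('a) / \<delta> * (Chat t \<omega> * (u t \<omega> \<bullet> (x t \<omega> - y)))) +
    real DIM('a) / \<delta> * (2 * R * (2 * U / \<alpha> / sqrt (real (samples t))))"
proof -
  note yX = S_subset[OF y]
  let ?v = "\<lambda>\<omega>. u t \<omega> \<bullet> (x t \<omega> - y)" and ?d = "real DIM('a) / \<delta>"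
  have err: "integrable M (\<lambda>\<omega>. \<bar>Chat t \<omega> - C' t (xhat t \<omega>)\<bar>)"
  proof (rule integrable_bounded_rv[where B = "2 * U"])
    note [measurable] = measurable_C'[OF t] measurable_xhat[OF t] measurable_Chat[OF t]
    show "(\<lambda>\<omega>. \<bar>Chat t \<omega> - C' t (xhat t \<omega>)\<bar>) \<in> borel_measurable M" by measurable
    show "\<bar>\<bar>Chat t \<omega> - C' t (xhat t \<omega>)\<bar>\<bar> \<le> 2 * U" for \<omega>
      using abs_Chat_le[OF t, of \<omega>] abs_C'_le[OF t, of "xhat t \<omega>"] by linarith
  qed
  have "(LINT \<omega>|M. C' t (xhat t \<omega>) * ?v \<omega>) \<le>
      (LINT \<omega>|M. Chat t \<omega> * ?v \<omega> + \<bar>Chat t \<omega> - C' t (xhat t \<omega>)\<bar> * (2 * R))"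
  proof (intro integral_mono integrable_ghat[OF t yX] Bochner_Integration.integrable_add integrable_mult_left err)
    fix \<omega> assume "\<omega> \<in> space M"
    from inner_le[OF t yX this]
    have "\<bar>C' t (xhat t \<omega>) - Chat t \<omega>\<bar> * \<bar>?v \<omega>\<bar> \<le> \<bar>Chat t \<omega> - C' t (xhat t \<omega>)\<bar> * (2 * R)"
      unfolding abs_minus_commute[of "C' t (xhat t \<omega>)"] by (rule mult_left_mono) simp
    then have "(C' t (xhat t \<omega>) - Chat t \<omega>) * ?v \<omega> \<le> \<bar>Chat t \<omega> - C' t (xhat t \<omega>)\<bar> * (2 * R)"
      unfolding abs_mult[symmetric] by (rule order_trans[OF abs_ge_self])
    then show "C' t (xhat t \<omega>) * ?v \<omega> \<le> Chat t \<omega> * ?v \<omega> + \<bar>Chat t \<omega> - C' t (xhat t \<omega>)\<bar> * (2 * R)"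
      by (simp add: left_diff_distrib)
  qed
  also have "\<dots> = (LINT \<omega>|M. Chat t \<omega> * ?v \<omega>) + (LINT \<omega>|M. \<bar>Chat t \<omega> - C' t (xhat t \<omega>)\<bar>) * (2 * R)"
    using integrable_ghat(1)[OF t yX] err by simp
  also have "(LINT \<omega>|M. \<bar>Chat t \<omega> - C' t (xhat t \<omega>)\<bar>) * (2 * R) \<le> 2 * U / \<alpha> / sqrt (real (samples t)) * (2 * R)"
    using estimator_error[OF t] R_nonneg by (intro mult_right_mono) auto
  finally have "?d * (LINT \<omega>|M. C' t (xhat t \<omega>) * ?v \<omega>) \<le>
      ?d * ((LINT \<omega>|M. Chat t \<omega> * ?v \<omega>) + 2 * R * (2 * U / \<alpha> / sqrt (real (samples t))))"
    using \<delta> by (intro mult_left_mono) (auto simp: mult.commute)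
  then show ?thesis using expected_subgradient_step[OF t y] by (simp add: distrib_left)
qed

text \<open>Minimisers over \<open>X\<close> may lie outside the set onto which the algorithm
  projects; scaling brings them inside at the price L \<delta> R / r.\<close>

definition shrink :: "'a \<Rightarrow> 'a" where "shrink z = (1 - \<delta> / r) *\<^sub>R z"

lemma shrink_in_S: "z \<in> X \<Longrightarrow> shrink z \<in> S"
  unfolding shrink_def using shrink_in_shrunk_set[OF convex zero_in_X \<delta>] .

lemma C_shrink_le: "t \<in> {1..T} \<Longrightarrow> z \<in> X \<Longrightarrow> C t (shrink z) \<le> C t z + L * \<delta> * R / r"
proof -
  assume t: "t \<in> {1..T}" and z: "z \<in> X"
  have L: "0 \<le> L" using lipschitz_C[OF t] by (rule lipschitz_on_nonneg)
  have "C t (shrink z) - C t z \<le> L * norm (shrink z - z)"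
    using lipschitz_onD[OF lipschitz_C[OF t] S_subset[OF shrink_in_S[OF z]] z]
    by (simp add: dist_norm dist_real_def)
  also have "shrink z - z = - ((\<delta> / r) *\<^sub>R z)" by (simp add: shrink_def algebra_simps)
  also have "L * norm (- ((\<delta> / r) *\<^sub>R z)) \<le> L * (\<delta> / r * R)"
    using \<delta> norm_X[OF z] L by (intro mult_left_mono) (auto intro!: mult_left_mono divide_right_mono)
  finally show ?thesis by simp
qed

lemma C_drift:
  assumes drift: "\<And>t z. t \<in> {2..T} \<Longrightarrow> z \<in> X \<Longrightarrow> \<bar>C t z - C (t - 1) z\<bar> \<le> W t"
    and z: "z \<in> X" and s: "1 \<le> s" "s \<le> t" "t \<le> T"
  shows "\<bar>C t z - C s z\<bar> \<le> (\<Sum>k = Suc s..t. W k)"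
  using s(2,3)
proof (induction t rule: dec_induct)
  case (step n)
  have "\<bar>C (Suc n) z - C n z\<bar> \<le> W (Suc n)" using drift[of "Suc n", OF _ z] step s by simp
  moreover have "(\<Sum>k = Suc s..Suc n. W k) = (\<Sum>k = Suc s..n. W k) + W (Suc n)"
    using step by simp
  ultimately show ?case using step by linarith
qed simp

text \<open>Of 3 L \<delta>, two parts are the loss in the sphere inequality and one comes from
  playing \<open>xhat t\<close> in place of \<open>x t\<close>; L \<delta> R / r comes from
  shrinking the comparator. \<open>N\<close> counts the batches: each restart costs at most the
  squared diameter bound 4 R^2. The bound on the gradient estimates is d U / \<delta>.\<close>

lemma expected_dynamic_regret_le:
  assumes xstar: "\<And>t. t \<in> {1..T} \<Longrightarrow> is_arg_min (C t) (\<lambda>y. y \<in> X) (xstar t)"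
    and drift: "\<And>t z. t \<in> {2..T} \<Longrightarrow> z \<in> X \<Longrightarrow> \<bar>C t z - C (t - 1) z\<bar> \<le> W t"
    and W: "\<And>t. 0 \<le> W t" and T: "1 \<le> T"
    and \<eta>: "0 < h" "\<And>t. t \<in> {1..T} \<Longrightarrow> \<eta> t = h"
  defines "N \<equiv> real (Suc ((T - 1) div \<Delta>))"
  shows "(LINT \<omega>|M. dynamic_regret C' (\<lambda>t. xhat t \<omega>) xstar T) \<le>
    real T * (3 * L * \<delta> + L * \<delta> * R / r) + 2 * real \<Delta> * (\<Sum>k = 2..T. W k) +
    N * (4 * R\<^sup>2) / (2 * h) + real T * (h / 2 * (real DIM('a) / \<delta> * U)\<^sup>2) +
    real DIM('a) / \<delta> * (2 * R * (2 * U / \<alpha>)) * (N * (\<Sum>\<tau> = 1..\<Delta>. 1 / sqrt (real (\<phi> \<tau>))))"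
proof -
  \<comment> \<open>The first round of the batch that contains round t.\<close>
  define s where "s t = (t - 1) div \<Delta> * \<Delta> + 1" for t
  define y where "y t = shrink (xstar (s t))" for t
  have s: "1 \<le> s t" "s t \<le> t" "t < s t + \<Delta>" if "t \<in> {1..T}" for t
  proof -
    have "(t - 1) div \<Delta> * \<Delta> + (t - 1) mod \<Delta> = t - 1" by simp
    moreover have "(t - 1) mod \<Delta> < \<Delta>" using \<Delta> by simp
    ultimately show "1 \<le> s t" "s t \<le> t" "t < s t + \<Delta>" using that unfolding s_def atLeastAtMost_iff by linarith+
  qed
  have xs: "xstar t \<in> X" "\<And>z. z \<in> X \<Longrightarrow> C t (xstar t) \<le> C t z" if "t \<in> {1..T}" for t
    using xstar[OF that] by (auto simp: is_arg_min_def not_less)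
  have sT: "s t \<in> {1..T}" if "t \<in> {1..T}" for t using s[OF that] that by auto
  have yS: "y t \<in> S" if "t \<in> {1..T}" for t
    unfolding y_def by (intro shrink_in_S xs sT that)
  \<comment> \<open>The drift is paid twice: once to carry \<open>xstar (s t)\<close> from round t
    back to round \<open>s t\<close>, where it is optimal, and once to return to round t at
    \<open>xstar t\<close>.\<close>
  have C_y: "C t (y t) \<le> C t (xstar t) + L * \<delta> * R / r + 2 * (\<Sum>k = Suc (s t)..t. W k)" if t: "t \<in> {1..T}" for t
  proof -
    have "C t (y t) \<le> C t (xstar (s t)) + L * \<delta> * R / r"
      unfolding y_def by (intro C_shrink_le t xs sT)
    moreover have "\<bar>C t (xstar (s t)) - C (s t) (xstar (s t))\<bar> \<le> (\<Sum>k = Suc (s t)..t. W k)"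
      using C_drift[OF drift xs(1)[OF sT[OF t]] s(1,2)[OF t]] t by simp
    moreover have "C (s t) (xstar (s t)) \<le> C (s t) (xstar t)" by (intro xs sT t)
    moreover have "\<bar>C t (xstar t) - C (s t) (xstar t)\<bar> \<le> (\<Sum>k = Suc (s t)..t. W k)"
      using C_drift[OF drift xs(1)[OF t] s(1,2)[OF t]] t by simp
    ultimately show ?thesis by linarith
  qed
  have L: "0 \<le> L" using lipschitz_C[of 1] T by (auto intro: lipschitz_on_nonneg)
  let ?d = "real DIM('a) / \<delta>"
  have d0: "0 \<le> ?d" using \<delta> by simp
  define G where "G t \<omega> = ?d * (Chat t \<omega> * (u t \<omega> \<bullet> (x t \<omega> - y t)))" for t \<omega>
  have int_G: "integrable M (G t)" if "t \<in> {1..T}" for t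
    unfolding G_def[abs_def] by (intro integrable_mult_right integrable_ghat that S_subset yS)
  have hat: "(LINT \<omega>|M. C' t (xhat t \<omega>)) \<le> (LINT \<omega>|M. C' t (x t \<omega>)) + L * \<delta>" if t: "t \<in> {1..T}" for t
  proof -
    have "(LINT \<omega>|M. C' t (xhat t \<omega>)) \<le> (LINT \<omega>|M. C' t (x t \<omega>) + L * \<delta>)"
    proof (rule integral_mono[OF integrable_C'_xhat[OF t]])
      fix \<omega> assume \<omega>: "\<omega> \<in> space M"
      have X: "xhat t \<omega> \<in> X" "x t \<omega> \<in> X"
        using xhat_in_X[OF \<omega> t] iterate_in_S[OF \<omega>, of t] t S_subset by auto
      have "\<bar>C t (xhat t \<omega>) - C t (x t \<omega>)\<bar> \<le> L * norm (xhat t \<omega> - x t \<omega>)"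
        using lipschitz_onD[OF lipschitz_C[OF t] X] by (simp add: dist_norm dist_real_def)
      also have "norm (xhat t \<omega> - x t \<omega>) = \<delta>" using played[OF t \<omega>] norm_u[OF \<omega> t] \<delta> by simp
      finally show "C' t (xhat t \<omega>) \<le> C' t (x t \<omega>) + L * \<delta>" using X by (simp add: C'_eq)
    qed (use integrable_C'_iterate[OF t] in auto)
    then show ?thesis using integrable_C'_iterate[OF t] by (simp add: prob_space)
  qed
  have C'_star: "C' t (xstar t) = C t (xstar t)" if "t \<in> {1..T}" for t
    using C'_eq xs(1)[OF that] by simp
  have per_round: "(LINT \<omega>|M. C' t (xhat t \<omega>)) - C' t (xstar t) \<le>
      (3 * L * \<delta> + L * \<delta> * R / r) + 2 * (\<Sum>k = Suc (s t)..t. W k) + (LINT \<omega>|M. G t \<omega>) +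
      ?d * (2 * R * (2 * U / \<alpha>)) * (1 / sqrt (real (samples t)))" if t: "t \<in> {1..T}" for t
    using hat[OF t] C_y[OF t] expected_step[OF t yS[OF t]] by (simp add: C'_star[OF t] G_def algebra_simps)
  have "(LINT \<omega>|M. dynamic_regret C' (\<lambda>t. xhat t \<omega>) xstar T) =
      (\<Sum>t = 1..T. LINT \<omega>|M. C' t (xhat t \<omega>)) - (\<Sum>t = 1..T. C' t (xstar t))"
  proof -
    have "(LINT \<omega>|M. (\<Sum>t = 1..T. C' t (xhat t \<omega>))) = (\<Sum>t = 1..T. LINT \<omega>|M. C' t (xhat t \<omega>))"
      by (intro Bochner_Integration.integral_sum integrable_C'_xhat)
    moreover have "integrable M (\<lambda>\<omega>. \<Sum>t = 1..T. C' t (xhat t \<omega>))"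
      by (intro Bochner_Integration.integrable_sum integrable_C'_xhat)
    ultimately show ?thesis unfolding dynamic_regret_def by (simp add: prob_space)
  qed
  also have "\<dots> = (\<Sum>t = 1..T. (LINT \<omega>|M. C' t (xhat t \<omega>)) - C' t (xstar t))"
    by (simp add: sum_subtractf)
  also have "\<dots> \<le> (\<Sum>t = 1..T. (3 * L * \<delta> + L * \<delta> * R / r) + 2 * (\<Sum>k = Suc (s t)..t. W k) + (LINT \<omega>|M. G t \<omega>) +
      ?d * (2 * R * (2 * U / \<alpha>)) * (1 / sqrt (real (samples t))))"
    by (intro sum_mono per_round)
  also have "\<dots> = real T * (3 * L * \<delta> + L * \<delta> * R / r) + 2 * (\<Sum>t = 1..T. \<Sum>k = Suc (s t)..t. W k)
      + (\<Sum>t = 1..T. LINT \<omega>|M. G t \<omega>) + ?d * (2 * R * (2 * U / \<alpha>)) * (\<Sum>t = 1..T. 1 / sqrt (real (samples t)))"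
    unfolding sum.distrib sum_distrib_left[symmetric] by (simp add: algebra_simps)
  finally have main: "(LINT \<omega>|M. dynamic_regret C' (\<lambda>t. xhat t \<omega>) xstar T) \<le>
      real T * (3 * L * \<delta> + L * \<delta> * R / r) + 2 * (\<Sum>t = 1..T. \<Sum>k = Suc (s t)..t. W k)
      + (\<Sum>t = 1..T. LINT \<omega>|M. G t \<omega>) + ?d * (2 * R * (2 * U / \<alpha>)) * (\<Sum>t = 1..T. 1 / sqrt (real (samples t)))" .
  have W_sum: "(\<Sum>t = 1..T. \<Sum>k = Suc (s t)..t. W k) \<le> real \<Delta> * (\<Sum>k = 2..T. W k)"
    by (rule batch_window_sum_le[OF W]) (use s in auto)
  have phi_sum: "(\<Sum>t = 1..T. 1 / sqrt (real (samples t))) \<le> N * (\<Sum>\<tau> = 1..\<Delta>. 1 / sqrt (real (\<phi> \<tau>)))"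
    unfolding N_def by (rule sum_epoch_le[OF \<Delta>]) simp
  have G_sum: "(\<Sum>t = 1..T. LINT \<omega>|M. G t \<omega>) \<le> N * (4 * R\<^sup>2) / (2 * h) + real T * (h / 2 * (?d * U)\<^sup>2)"
  proof -
    \<comment> \<open>The descent bound holds along every path, so the sum is first moved inside the
      integral.\<close>
    have "(\<Sum>t = 1..T. LINT \<omega>|M. G t \<omega>) = (LINT \<omega>|M. (\<Sum>t = 1..T. G t \<omega>))"
      by (rule Bochner_Integration.integral_sum[symmetric]) (rule int_G)
    also have "\<dots> \<le> N * (4 * R\<^sup>2) / (2 * h) + real T * (h / 2 * (?d * U)\<^sup>2)"
    proof (rule integral_le_const)
      show "integrable M (\<lambda>\<omega>. \<Sum>t = 1..T. G t \<omega>)" by (intro Bochner_Integration.integrable_sum int_G)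
      show "AE \<omega> in M. (\<Sum>t = 1..T. G t \<omega>) \<le> N * (4 * R\<^sup>2) / (2 * h) + real T * (h / 2 * (?d * U)\<^sup>2)"
      proof (rule AE_I2)
        fix \<omega> assume \<omega>: "\<omega> \<in> space M"
        define a where "a t = (norm (x t \<omega> - y t))\<^sup>2" for t
        define b where "b t = (norm (x (Suc t) \<omega> - y t))\<^sup>2" for t
        have G_le: "G t \<omega> \<le> (a t - b t) / (2 * h) + h / 2 * (?d * U)\<^sup>2" if t: "t \<in> {1..T}" for t
        proof -
          have "norm (ghat t \<omega>) \<le> ?d * U"
          proof -
            have "norm (ghat t \<omega>) = ?d * \<bar>Chat t \<omega>\<bar>"
              using \<delta> by (simp add: ghat_eq[OF \<omega> t] norm_u[OF \<omega> t] abs_mult)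
            then show ?thesis using mult_left_mono[OF abs_Chat_le[OF t, of \<omega>] d0] by simp
          qed
          moreover have "is_arg_min (\<lambda>z. (norm (x t \<omega> - h *\<^sub>R ghat t \<omega> - z))\<^sup>2) (\<lambda>z. z \<in> S) (x (Suc t) \<omega>)"
            using projected_step[OF t \<omega>] by (simp only: \<eta>(2)[OF t])
          ultimately have "ghat t \<omega> \<bullet> (x t \<omega> - y t) \<le> (a t - b t) / (2 * h) + h / 2 * (?d * U)\<^sup>2"
            unfolding a_def b_def
            by (intro projection_step_le[OF convex_shrunk_set[OF convex] _ yS[OF t] \<eta>(1)])
          then show ?thesis by (simp add: G_def ghat_eq[OF \<omega> t])
        qed
        have tele: "(\<Sum>t = 1..T. a t - b t) \<le> (4 * R\<^sup>2) * N"
          unfolding N_def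
        proof (rule batched_telescope_le[OF _ _ _ T])
          fix t assume t: "t \<in> {1..T}"
          have "norm (x t \<omega> - y t) \<le> 2 * R"
            using t by (intro norm_diff_X S_subset yS iterate_in_S[OF \<omega>]) auto
          then have "a t \<le> (2 * R)\<^sup>2" unfolding a_def by (intro power_mono) auto
          then show "a t \<le> 4 * R\<^sup>2" by simp
        next
          \<comment> \<open>Rounds t and t + 1 share a batch, hence a comparator.\<close>
          fix t assume "t div \<Delta> = (t - 1) div \<Delta>"
          then show "a (Suc t) = b t" by (simp add: a_def b_def y_def s_def)
        qed (auto simp: b_def)
        have "(\<Sum>t = 1..T. G t \<omega>) \<le> (\<Sum>t = 1..T. (a t - b t) / (2 * h) + h / 2 * (?d * U)\<^sup>2)"
          by (intro sum_mono G_le)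
        also have "\<dots> = (\<Sum>t = 1..T. a t - b t) / (2 * h) + real T * (h / 2 * (?d * U)\<^sup>2)"
          by (simp add: sum.distrib sum_divide_distrib)
        also have "(\<Sum>t = 1..T. a t - b t) / (2 * h) \<le> (4 * R\<^sup>2) * N / (2 * h)"
          using tele \<eta>(1) by (intro divide_right_mono) auto
        finally show "(\<Sum>t = 1..T. G t \<omega>) \<le> N * (4 * R\<^sup>2) / (2 * h) + real T * (h / 2 * (?d * U)\<^sup>2)"
          by (simp add: mult.commute)
      qed
    qed
    finally show ?thesis .
  qed
  have K0: "0 \<le> ?d * (2 * R * (2 * U / \<alpha>))"
    using R_nonneg U_nonneg level by (intro mult_nonneg_nonneg[OF d0]) simp
  show ?thesis
    using main W_sum G_sum mult_left_mono[OF phi_sum K0] by linarith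
qed

end

section \<open>Regret rate\<close>

lemma convex_on_cvar_cost:
  assumes D: "prob_space D" "\<And>x. x \<in> X \<Longrightarrow> J x \<in> borel_measurable D"
    and bounded: "\<And>x z. x \<in> X \<Longrightarrow> \<bar>J x z\<bar> \<le> U" and \<alpha>: "0 < \<alpha>" "\<alpha> \<le> 1"
    and X: "convex X" and conv: "\<And>z. convex_on X (\<lambda>x. J x z)"
  shows "convex_on X (cvar_cost \<alpha> J D)"
proof (rule convex_onI)
  fix t :: real and x y assume t: "0 < t" "t < 1" and xy: "x \<in> X" "y \<in> X"
  have B: "bounded_cost D (J x) U \<alpha>" if "x \<in> X" for x
    using D bounded \<alpha> that by (auto simp: bounded_cost_def bounded_cost_axioms_def)
  have "(1 - t) *\<^sub>R x + t *\<^sub>R y \<in> X" using X xy t by (simp add: convexD)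
  then show "cvar_cost \<alpha> J D ((1 - t) *\<^sub>R x + t *\<^sub>R y) \<le> (1 - t) * cvar_cost \<alpha> J D x + t * cvar_cost \<alpha> J D y"
    unfolding cvar_cost_def using t xy convex_onD[OF conv]
    by (intro cvar_convex_comb[OF B B B]) auto
qed (rule X)

lemma lipschitz_on_cvar_cost:
  assumes D: "prob_space D" "\<And>x. x \<in> X \<Longrightarrow> J x \<in> borel_measurable D"
    and bounded: "\<And>x z. x \<in> X \<Longrightarrow> \<bar>J x z\<bar> \<le> U" and \<alpha>: "0 < \<alpha>" "\<alpha> \<le> 1"
    and L: "0 \<le> L" "\<And>z x y. x \<in> X \<Longrightarrow> y \<in> X \<Longrightarrow> \<bar>J x z - J y z\<bar> \<le> L * norm (x - y)"
  shows "(L / \<alpha>)-lipschitz_on X (cvar_cost \<alpha> J D)"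
proof (rule lipschitz_onI)
  interpret prob_space D by fact
  have B: "bounded_cost D (J x) U \<alpha>" if "x \<in> X" for x
    using D bounded \<alpha> that by (auto simp: bounded_cost_def bounded_cost_axioms_def)
  have le: "cvar_cost \<alpha> J D x \<le> cvar_cost \<alpha> J D y + L * norm (x - y) / \<alpha>" if xy: "x \<in> X" "y \<in> X" for x y
    unfolding cvar_cost_def
  proof (rule cvar_diff_le[OF B[OF xy(1)] B[OF xy(2)]])
    fix c
    have "(LINT z|D. max 0 (J x z - c)) \<le> (LINT z|D. max 0 (J y z - c) + L * norm (x - y))"
    proof (rule integral_mono)
      fix z
      show "max 0 (J x z - c) \<le> max 0 (J y z - c) + L * norm (x - y)"
        using L(2)[OF xy, of z] L(1) by (auto simp: max_def abs_le_iff)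
    qed (auto intro!: bounded_cost.integrable_excess[OF B] xy)
    then show "(LINT z|D. max 0 (J x z - c)) \<le> (LINT z|D. max 0 (J y z - c)) + L * norm (x - y)"
      using bounded_cost.integrable_excess[OF B[OF xy(2)]] by (simp add: prob_space)
  qed
  fix x y assume "x \<in> X" "y \<in> X"
  then show "dist (cvar_cost \<alpha> J D x) (cvar_cost \<alpha> J D y) \<le> L / \<alpha> * dist x y"
    using le[of x y] le[of y x] by (simp add: dist_real_def dist_norm norm_minus_commute abs_le_iff)
qed (use L \<alpha> in simp)

text \<open>Excesses inherit the Lipschitz constant of \<open>J x\<close> in the noise, since
  cutting off at 0 is nonexpansive; the Wasserstein distance therefore bounds the change of every
  excess by the same amount.\<close>

lemma cvar_cost_drift:
  fixes J :: "'a \<Rightarrow> 'b::metric_space \<Rightarrow> real"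
  assumes D: "prob_space D" "sets D = sets borel" and D': "prob_space D'" "sets D' = sets borel"
    and bounded: "\<And>z. \<bar>J x z\<bar> \<le> U" and \<alpha>: "0 < \<alpha>" "\<alpha> \<le> 1"
    and K: "0 < K" and L: "0 < L" "L-lipschitz_on UNIV (J x)"
    and w: "wasserstein1 K D D' \<le> ereal w"
  shows "\<bar>cvar_cost \<alpha> J D' x - cvar_cost \<alpha> J D x\<bar> \<le> L * w / \<alpha>"
proof -
  have m: "J x \<in> borel_measurable borel"
    using lipschitz_on_continuous_on[OF L(2)] by (rule borel_measurable_continuous_onI)
  have B: "bounded_cost D (J x) U \<alpha>" and B': "bounded_cost D' (J x) U \<alpha>"
    using D D' bounded \<alpha> m
    by (auto simp: bounded_cost_def bounded_cost_axioms_def cong: measurable_cong_sets)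
  have diff: "(LINT z|D. f z) - (LINT z|D'. f z) \<le> L * w"
    if f: "L-lipschitz_on UNIV f" "integrable D f" "integrable D' f" for f
  proof -
    have "ereal ((LINT z|D. f z) - (LINT z|D'. f z)) \<le> ereal L * wasserstein1 K D D'"
      by (rule integral_diff_le_wasserstein1[OF K L(1) f])
    also have "\<dots> \<le> ereal L * ereal w" using L w by (intro ereal_mult_left_mono) auto
    finally show ?thesis by simp
  qed
  let ?f = "\<lambda>c z. max 0 (J x z - c)"
  \<comment> \<open>The hypothesis bounds the distance in one order of the two distributions only;
    the negated excess yields the opposite inequality.\<close>
  have lip: "L-lipschitz_on UNIV (?f c)" "L-lipschitz_on UNIV (\<lambda>z. - ?f c z)" for c
  proof -
    have *: "\<bar>?f c y - ?f c z\<bar> \<le> L * dist y z" for y z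
      using lipschitz_onD[OF L(2), of y z] by (auto simp: dist_real_def max_def)
    show "L-lipschitz_on UNIV (?f c)"
      using * L by (intro lipschitz_onI) (auto simp: dist_real_def)
    show "L-lipschitz_on UNIV (\<lambda>z. - ?f c z)"
      using * L by (intro lipschitz_onI) (auto simp: dist_real_def abs_minus_commute)
  qed
  have 1: "(LINT z|D. ?f c z) \<le> (LINT z|D'. ?f c z) + L * w" for c
    using diff[OF lip(1)[of c]] bounded_cost.integrable_excess[OF B, of c] bounded_cost.integrable_excess[OF B', of c] by simp
  have 2: "(LINT z|D'. ?f c z) \<le> (LINT z|D. ?f c z) + L * w" for c
    using diff[OF lip(2)[of c]] bounded_cost.integrable_excess[OF B, of c] bounded_cost.integrable_excess[OF B', of c] by simp
  show ?thesis
    using cvar_diff_le[OF B B' 1] cvar_diff_le[OF B' B 2] unfolding cvar_cost_def by linarith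
qed

text \<open>The terms are nonnegative extended reals, so a finite budget makes each of them finite
  and the passage to reals loses nothing. Outside the summation range only nonnegativity is claimed,
  which also holds at an infinite distance, converted to 0.\<close>

lemma sum_wasserstein1_finite:
  fixes D :: "nat \<Rightarrow> 'b::metric_space measure"
  assumes K: "0 < K" and le: "(\<Sum>t = 2..T. wasserstein1 K (D (t - 1)) (D t)) \<le> ereal V"
  defines "w \<equiv> \<lambda>t. real_of_ereal (wasserstein1 K (D (t - 1)) (D t))"
  shows "(\<Sum>t = 2..T. w t) \<le> V" and "\<And>t. t \<in> {2..T} \<Longrightarrow> wasserstein1 K (D (t - 1)) (D t) \<le> ereal (w t)"
    and "\<And>t. 0 \<le> w t"
proof -
  let ?W = "\<lambda>t. wasserstein1 K (D (t - 1)) (D t)"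
  have nn: "0 \<le> ?W t" for t by (rule wasserstein1_nonneg[OF K])
  have eq: "?W t = ereal (w t)" if t: "t \<in> {2..T}" for t
  proof -
    have "?W t \<le> (\<Sum>t = 2..T. ?W t)"
      using sum_mono2[of "{2..T}" "{t}" ?W] t nn by simp
    also have "\<dots> \<le> ereal V" by (rule le)
    finally show ?thesis using nn[of t] by (cases "?W t") (auto simp: w_def)
  qed
  show "?W t \<le> ereal (w t)" if "t \<in> {2..T}" for t using eq[OF that] by simp
  have "(\<Sum>t = 2..T. ?W t) = (\<Sum>t = 2..T. ereal (w t))" by (rule sum.cong) (use eq in auto)
  then show "(\<Sum>t = 2..T. w t) \<le> V" using le by simp
  show "0 \<le> w t" for t using nn[of t] by (simp add: w_def real_of_ereal_pos)
qed

text \<open>With \<open>\<rho> = V / T < 1\<close> and \<open>e = b / (4 + b)\<close>, one has \<open>\<delta> = \<rho> powr e\<close>, \<open>h = \<rho> powr (3 * e)\<close>,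
  and \<open>\<Delta>\<close> lies within a factor 2 of \<open>\<rho> powr (e - 1)\<close>. Every term below is then at most a constant
  times \<open>T * \<rho> powr e\<close>; the hypothesis \<open>b \<le> 1\<close> enters through \<open>1 - e \<ge> 4 * e\<close>.\<close>

lemma regret_rate:
  fixes T \<Delta> :: nat and V b c R L r d U A B :: real
  defines "\<rho> \<equiv> V / real T" and "e \<equiv> b / (4 + b)"
  assumes V: "0 < V" and b: "0 < b" "b \<le> 1" and T: "1 < \<Delta>" "\<Delta> < T"
    and \<Delta>: "int \<Delta> \<in> {\<lfloor>(real T / V) powr (4 / (4 + b))\<rfloor>, \<lceil>(real T / V) powr (4 / (4 + b))\<rceil>}"
    and SW: "SW \<le> B * V" and \<Phi>: "\<Phi> \<le> c * real \<Delta> powr (1 - b / 2)"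
    and nn: "0 \<le> B" "0 \<le> c" "0 \<le> d" "0 \<le> A"
  shows "real T * (3 * L * \<rho> powr e + L * \<rho> powr e * R / r) + 2 * real \<Delta> * SW +
      real (Suc ((T - 1) div \<Delta>)) * (4 * R\<^sup>2) / (2 * \<rho> powr (3 * e)) +
      real T * (\<rho> powr (3 * e) / 2 * (d / \<rho> powr e * U)\<^sup>2) +
      d / \<rho> powr e * A * (real (Suc ((T - 1) div \<Delta>)) * \<Phi>)
    \<le> (3 * L + L * R / r + 4 * B + 8 * R\<^sup>2 + (d * U)\<^sup>2 / 2 + 4 * d * A * c) *
      (real T powr (4 / (4 + b)) * V powr (b / (4 + b)))"
proof -
  have T0: "0 < real T" "2 \<le> real \<Delta>" using T by auto
  have \<rho>0: "0 < \<rho>" using V T0 by (simp add: \<rho>_def)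
  have p: "4 / (4 + b) = 1 - e" using b by (simp add: e_def field_simps)
  have "e \<le> 1 / 5" using b by (simp add: e_def divide_le_eq)
  \<comment> \<open>This identity fixes the exponent: \<Delta>^(-b/2) is of order \<rho>^(2 e), and
    dividing by \<delta> = \<rho>^e leaves \<rho>^e for the sampling error.\<close>
  moreover have "2 * e = (1 - e) * (b / 2)"
    unfolding p[symmetric] using b by (simp add: e_def field_simps)
  ultimately have e0: "0 < e" "4 * e \<le> 1 - e" "2 * e = (1 - e) * (b / 2)"
    using b by (simp_all add: e_def)
  define q where "q = \<rho> powr (e - 1)"
  have q_eq: "(real T / V) powr (4 / (4 + b)) = q"
  proof -
    have "real T / V = inverse \<rho>" by (simp add: \<rho>_def)
    then show ?thesis using \<rho>0 unfolding p q_def by (simp add: powr_minus[symmetric] inverse_powr)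
  qed
  \<comment> \<open>\<Delta> > 1 arises by rounding \<open>q\<close>, so \<open>q\<close> itself
    exceeds 1; this is how V < T follows.\<close>
  have q1: "1 < q"
  proof (rule ccontr)
    assume "\<not> 1 < q"
    then have "\<lfloor>q\<rfloor> \<le> 1" "\<lceil>q\<rceil> \<le> 1" by (simp_all add: floor_le_iff ceiling_le_iff)
    moreover have "int \<Delta> = \<lfloor>q\<rfloor> \<or> int \<Delta> = \<lceil>q\<rceil>" using \<Delta> unfolding q_eq by simp
    ultimately have "int \<Delta> \<le> 1" by linarith
    then show False using T by simp
  qed
  have \<rho>1: "\<rho> < 1"
  proof (rule ccontr)
    assume "\<not> \<rho> < 1"
    then have "q \<le> \<rho> powr 0" unfolding q_def using e0 by (intro powr_mono) auto
    then show False using q1 \<rho>0 by simp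
  qed
  \<comment> \<open>Rounding changes \<open>q\<close> by at most 1, which is absorbed by doubling
    because q > 1 and \<Delta> \<ge> 2.\<close>
  have \<Delta>q: "real \<Delta> \<le> 2 * q" "q \<le> 2 * real \<Delta>"
  proof -
    have "real \<Delta> = of_int (int \<Delta>)" by simp
    then have "real \<Delta> \<le> q + 1" "q - 1 \<le> real \<Delta>" using \<Delta> unfolding q_eq by (auto; linarith)+
    then show "real \<Delta> \<le> 2 * q" "q \<le> 2 * real \<Delta>" using q1 T0 by linarith+
  qed
  define Z where "Z = real T * \<rho> powr e"
  have Z0: "0 \<le> Z" by (simp add: Z_def)
  have Z_eq: "real T powr (4 / (4 + b)) * V powr (b / (4 + b)) = Z"
  proof -
    have "real T powr (1 - e) = real T * real T powr (- e)"
      using powr_add[of "real T" 1 "- e"] T0 by simp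
    moreover have "\<rho> powr e = V powr e * real T powr (- e)"
      using V T0 unfolding \<rho>_def by (simp add: powr_divide powr_minus_divide)
    ultimately show ?thesis unfolding p Z_def by (simp add: e_def)
  qed
  define N where "N = real (Suc ((T - 1) div \<Delta>))"
  \<comment> \<open>The extra batch for the remainder is covered by T / \<Delta> \<ge> 1.\<close>
  have N: "N \<le> 2 * real T / real \<Delta>"
  proof -
    have "real ((T - 1) div \<Delta>) \<le> real (T - 1) / real \<Delta>" by (rule of_nat_div_le_of_nat)
    also have "\<dots> \<le> real T / real \<Delta>" by (intro divide_right_mono) auto
    finally have "N \<le> real T / real \<Delta> + 1" by (simp add: N_def)
    also have "1 \<le> real T / real \<Delta>" using T by (simp add: le_divide_eq)
    finally show ?thesis by simp
  qed
  have N0: "0 \<le> N" by (simp add: N_def)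
  have "real T * (3 * L * \<rho> powr e + L * \<rho> powr e * R / r) = (3 * L + L * R / r) * Z"
    by (simp add: Z_def algebra_simps)
  moreover have "2 * real \<Delta> * SW \<le> 4 * B * Z"
  proof -
    have "2 * real \<Delta> * SW \<le> 2 * real \<Delta> * (B * V)" using SW by (intro mult_left_mono) auto
    also have "\<dots> \<le> 2 * (2 * q) * (B * V)" using \<Delta>q nn V by (intro mult_right_mono) auto
    also have "q * V = Z"
    proof -
      have "q * \<rho> = \<rho> powr e" unfolding q_def using \<rho>0 powr_add[of \<rho> "e - 1" 1] by simp
      moreover have "V = real T * \<rho>" using T0 by (simp add: \<rho>_def)
      ultimately show ?thesis by (simp add: Z_def mult_ac)
    qed
    then have "2 * (2 * q) * (B * V) = 4 * B * Z" by (simp add: mult_ac)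
    finally show ?thesis .
  qed
  moreover have "N * (4 * R\<^sup>2) / (2 * \<rho> powr (3 * e)) \<le> 8 * R\<^sup>2 * Z"
  proof -
    have "1 / real \<Delta> \<le> 2 / q" using \<Delta>q q1 T0 by (simp add: field_simps)
    then have "2 * real T * (1 / real \<Delta>) \<le> 2 * real T * (2 / q)" by (intro mult_left_mono) auto
    then have "N \<le> 4 * real T / q" using N by simp
    also have "\<dots> = 4 * real T * \<rho> powr (1 - e)"
      unfolding q_def by (simp add: powr_minus_divide[symmetric] divide_inverse powr_minus[symmetric])
    finally have "N * (4 * R\<^sup>2) / (2 * \<rho> powr (3 * e)) \<le> 4 * real T * \<rho> powr (1 - e) * (4 * R\<^sup>2) / (2 * \<rho> powr (3 * e))"
      by (intro divide_right_mono mult_right_mono) auto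
    also have "\<dots> = 8 * R\<^sup>2 * (real T * (\<rho> powr (1 - e) / \<rho> powr (3 * e)))" by simp
    also have "\<rho> powr (1 - e) / \<rho> powr (3 * e) = \<rho> powr (1 - 4 * e)"
      by (simp add: powr_diff[symmetric])
    also have "\<rho> powr (1 - 4 * e) \<le> \<rho> powr e"
      using \<rho>0 \<rho>1 e0 by (intro powr_mono') auto
    finally show ?thesis unfolding Z_def by (simp add: mult_left_mono)
  qed
  moreover have "real T * (\<rho> powr (3 * e) / 2 * (d / \<rho> powr e * U)\<^sup>2) = (d * U)\<^sup>2 / 2 * Z"
  proof -
    have "\<rho> powr (3 * e) = \<rho> powr e * (\<rho> powr e * \<rho> powr e)"
      by (simp add: powr_add[symmetric])
    then show ?thesis using \<rho>0 by (simp add: Z_def power2_eq_square)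
  qed
  moreover have "d / \<rho> powr e * A * (N * \<Phi>) \<le> 4 * d * A * c * Z"
  proof -
    have "N * \<Phi> \<le> N * (c * real \<Delta> powr (1 - b / 2))" using \<Phi> N0 by (rule mult_left_mono)
    also have "\<dots> \<le> 2 * real T / real \<Delta> * (c * real \<Delta> powr (1 - b / 2))"
      using N nn by (intro mult_right_mono) auto
    also have "real \<Delta> powr (1 - b / 2) = real \<Delta> * real \<Delta> powr (- (b / 2))"
      using T0 powr_add[of "real \<Delta>" 1 "- (b / 2)"] by simp
    also have "2 * real T / real \<Delta> * (c * (real \<Delta> * real \<Delta> powr (- (b / 2)))) = 2 * real T * c * real \<Delta> powr (- (b / 2))"
      using T0 by simp
    also have "real \<Delta> powr (- (b / 2)) \<le> (q / 2) powr (- (b / 2))"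
      using \<Delta>q q1 b by (intro powr_mono2') auto
    also have "(q / 2) powr (- (b / 2)) = 2 powr (b / 2) * \<rho> powr (2 * e)"
    proof -
      have "(q / 2) powr (- (b / 2)) = q powr (- (b / 2)) * 2 powr (b / 2)"
        using q1 by (simp add: powr_divide powr_minus_divide)
      also have "q powr (- (b / 2)) = \<rho> powr (2 * e)"
      proof -
        have "(e - 1) * (- (b / 2)) = (1 - e) * (b / 2)"
          by (simp only: mult_minus_right minus_mult_left minus_diff_eq)
        then show ?thesis unfolding q_def powr_powr by (simp only: e0(3))
      qed
      finally show ?thesis by simp
    qed
    also have "2 powr (b / 2) \<le> (2::real) powr 1" using b by (intro powr_mono) auto
    finally have "N * \<Phi> \<le> 2 * real T * c * (2 * \<rho> powr (2 * e))"
      using nn T0 by (simp add: mult_left_mono mult_right_mono)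
    then have "d / \<rho> powr e * A * (N * \<Phi>) \<le> d / \<rho> powr e * A * (2 * real T * c * (2 * \<rho> powr (2 * e)))"
      using nn by (intro mult_left_mono) auto
    also have "\<rho> powr (2 * e) = \<rho> powr e * \<rho> powr e" by (simp add: powr_add[symmetric])
    also have "d / \<rho> powr e * A * (2 * real T * c * (2 * (\<rho> powr e * \<rho> powr e))) = 4 * d * A * c * Z"
      using \<rho>0 by (simp add: Z_def)
    finally show ?thesis .
  qed
  ultimately show ?thesis
    unfolding Z_eq N_def[symmetric] distrib_right by linarith
qed

section \<open>From expectation to high probability\<close>

lemma (in prob_space) markov_complement:
  assumes int: "integrable M f" and nn: "\<And>\<omega>. \<omega> \<in> space M \<Longrightarrow> 0 \<le> f \<omega>"
    and le: "(LINT \<omega>|M. f \<omega>) \<le> B" and \<gamma>: "0 < \<gamma>" and B: "0 < B"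
  shows "1 - \<gamma> \<le> prob {\<omega> \<in> space M. f \<omega> \<le> B / \<gamma>}"
proof -
  have [measurable]: "f \<in> borel_measurable M" using int by simp
  have "prob {\<omega> \<in> space M. B / \<gamma> \<le> f \<omega>} \<le> (LINT \<omega>|M. f \<omega>) / (B / \<gamma>)"
    using nn \<gamma> B by (intro integral_Markov_inequality_measure[OF int sets.empty_sets]) auto
  also have "\<dots> \<le> B / (B / \<gamma>)" using le \<gamma> B by (intro divide_right_mono) auto
  also have "\<dots> = \<gamma>" using B by simp
  finally have "prob {\<omega> \<in> space M. B / \<gamma> \<le> f \<omega>} \<le> \<gamma>" .
  moreover have "prob {\<omega> \<in> space M. B / \<gamma> < f \<omega>} \<le> prob {\<omega> \<in> space M. B / \<gamma> \<le> f \<omega>}"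
    by (intro finite_measure_mono) auto
  moreover have "prob {\<omega> \<in> space M. f \<omega> \<le> B / \<gamma>} = 1 - prob {\<omega> \<in> space M. B / \<gamma> < f \<omega>}"
    by (subst prob_compl[symmetric]) (auto intro!: arg_cong[where f = prob])
  ultimately show ?thesis by linarith
qed

text \<open>Both regimes are instances, b = a if a \<le> 1 and b = 1 otherwise. \<open>Cst\<close>
  is the constant of the rate with Lipschitz constant \<open>L\<^sub>0 / \<alpha>\<close> of the
  risk in the decision and drift constant \<open>L\<^sub>\<xi> / \<alpha>\<close>; it depends on
  neither T nor V nor the run.\<close>

lemma dynamic_regret_whp:
  fixes X :: "'a::euclidean_space set" and J :: "'a \<Rightarrow> 'b::metric_space \<Rightarrow> real"
    and M :: "'m measure" and D :: "nat \<Rightarrow> 'b measure" and T \<Delta> :: nat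
    and r U L\<^sub>0 L\<^sub>\<xi> K \<alpha> b c \<gamma> R V :: real
  assumes X: "0 < r" "cball 0 r \<subseteq> X" "\<And>x. x \<in> X \<Longrightarrow> norm x \<le> R"
    and U: "0 < U" "\<And>x z. x \<in> X \<Longrightarrow> \<bar>J x z\<bar> \<le> U"
    and convex: "\<And>z. convex_on X (\<lambda>x. J x z)"
    and lipschitz: "0 < L\<^sub>0" "\<And>z x y. x \<in> X \<Longrightarrow> y \<in> X \<Longrightarrow> \<bar>J x z - J y z\<bar> \<le> L\<^sub>0 * norm (x - y)"
    and noise_lipschitz: "0 < L\<^sub>\<xi>" "\<And>x. x \<in> X \<Longrightarrow> L\<^sub>\<xi>-lipschitz_on UNIV (J x)"
    and \<alpha>: "0 < \<alpha>" "\<alpha> \<le> 1" and K: "0 < K" and b: "0 < b" "b \<le> 1" and c: "0 < c" and \<gamma>: "0 < \<gamma>"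
    and V: "0 < V"
    and D: "\<And>t. t \<in> {1..T} \<Longrightarrow> prob_space (D t)" "\<And>t. t \<in> {1..T} \<Longrightarrow> sets (D t) = sets borel"
    and variation: "(\<Sum>t = 2..T. wasserstein1 K (D (t - 1)) (D t)) \<le> ereal V"
    and T: "1 < \<Delta>" "\<Delta> < T" and \<phi>: "\<And>\<tau>. \<tau> \<in> {1..\<Delta>} \<Longrightarrow> 1 \<le> \<phi> \<tau>"
    and \<Phi>: "(\<Sum>\<tau> = 1..\<Delta>. 1 / sqrt (real (\<phi> \<tau>))) \<le> c * real \<Delta> powr (1 - b / 2)"
    and delta: "\<delta> = (V / real T) powr (b / (4 + b))" "\<delta> < r"
    and \<eta>: "\<And>t. t \<in> {1..T} \<Longrightarrow> \<eta> t = (V / real T) powr (3 * b / (4 + b))"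
    and Delta: "int \<Delta> \<in> {\<lfloor>(real T / V) powr (4 / (4 + b))\<rfloor>, \<lceil>(real T / V) powr (4 / (4 + b))\<rceil>}"
    and run: "zeroth_order_cvar_run M X J D r \<alpha> \<delta> \<eta> \<phi> \<Delta> T x1 u \<xi> xhat x"
    and xstar: "\<And>t. t \<in> {1..T} \<Longrightarrow> is_arg_min (cvar_cost \<alpha> J (D t)) (\<lambda>y. y \<in> X) (xstar t)"
  defines "Cst \<equiv> 3 * (L\<^sub>0 / \<alpha>) + L\<^sub>0 / \<alpha> * R / r + 4 * (L\<^sub>\<xi> / \<alpha>) + 8 * R\<^sup>2 +
    (real DIM('a) * U)\<^sup>2 / 2 + 4 * real DIM('a) * (2 * R * (2 * U / \<alpha>)) * c"
  shows "1 - \<gamma> \<le> measure M {\<omega> \<in> space M.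
    dynamic_regret (\<lambda>t. cvar_cost \<alpha> J (D t)) (\<lambda>t. xhat t \<omega>) xstar T
      \<le> Cst / \<gamma> * (real T powr (4 / (4 + b)) * V powr (b / (4 + b)))}"
proof -
  have X0: "0 \<in> X" using X(1,2) by auto
  have R: "0 \<le> R" using X(3)[OF X0] by simp
  have meas: "J y \<in> borel_measurable borel" if "y \<in> X" for y
    using lipschitz_on_continuous_on[OF noise_lipschitz(2)[OF that]] by (rule borel_measurable_continuous_onI)
  obtain J' where J': "case_prod J' \<in> borel_measurable (borel \<Otimes>\<^sub>M borel)"
      "\<And>y z. \<bar>J' y z\<bar> \<le> U" "\<And>y z. y \<in> X \<Longrightarrow> J' y z = J y z"
    using jointly_measurable_extension[OF _ U(2) less_imp_le[OF lipschitz(1)] lipschitz(2) meas] X0 by blast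
  have meas_D: "J y \<in> borel_measurable (D t)" if "t \<in> {1..T}" "y \<in> X" for t y
    using meas[OF that(2)] D(2)[OF that(1)] by (simp cong: measurable_cong_sets)
  have conv_X: "convex X" using convex convex_on_imp_convex by blast
  have T0: "0 < real T" using T by simp
  have pos: "0 < V / real T" using V T0 by simp
  interpret bounded_risk_run M X J D r \<alpha> \<delta> \<eta> \<phi> \<Delta> T x1 u \<xi> xhat x J' U R "L\<^sub>0 / \<alpha>"
  proof (intro bounded_risk_run.intro run bounded_risk_run_axioms.intro)
    show "measurable_cost J' U \<alpha>" using J' \<alpha> by (simp add: measurable_cost_def)
    show "0 < \<delta>" unfolding delta(1) powr_gt_zero using V T0 by simp
    show "convex_on X (cvar_cost \<alpha> J (D t))" if t: "t \<in> {1..T}" for t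
      by (rule convex_on_cvar_cost[OF D(1)[OF t] meas_D[OF t] U(2) \<alpha> conv_X convex])
    show "(L\<^sub>0 / \<alpha>)-lipschitz_on X (cvar_cost \<alpha> J (D t))" if t: "t \<in> {1..T}" for t
      by (rule lipschitz_on_cvar_cost[OF D(1)[OF t] meas_D[OF t] U(2) \<alpha> less_imp_le[OF lipschitz(1)] lipschitz(2)])
    show "1 \<le> \<Delta>" using T by simp
  qed (use delta X J' conv_X \<phi> D in auto)
  define w where "w t = real_of_ereal (wasserstein1 K (D (t - 1)) (D t))" for t
  note w = sum_wasserstein1_finite[OF K variation, folded w_def]
  define W where "W t = L\<^sub>\<xi> * w t / \<alpha>" for t
  have W0: "0 \<le> W t" for t using w(3) noise_lipschitz(1) \<alpha> by (simp add: W_def)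
  have drift: "\<bar>cvar_cost \<alpha> J (D t) z - cvar_cost \<alpha> J (D (t - 1)) z\<bar> \<le> W t" if t: "t \<in> {2..T}" and z: "z \<in> X" for t z
    unfolding W_def
  proof (rule cvar_cost_drift[where U = U])
    show "\<bar>J z y\<bar> \<le> U" for y using U(2)[OF z] .
    show "L\<^sub>\<xi>-lipschitz_on UNIV (J z)" using noise_lipschitz(2)[OF z] .
    show "wasserstein1 K (D (t - 1)) (D t) \<le> ereal (w t)" using w(2)[OF t] .
    have t': "t - 1 \<in> {1..T}" "t \<in> {1..T}" using t by auto
    show "prob_space (D (t - 1))" "sets (D (t - 1)) = sets borel" using D t' by blast+
    show "prob_space (D t)" "sets (D t) = sets borel" using D t' by blast+
  qed (fact \<alpha> K noise_lipschitz(1))+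
  have SW: "(\<Sum>k = 2..T. W k) \<le> L\<^sub>\<xi> / \<alpha> * V"
  proof -
    have "(\<Sum>k = 2..T. W k) = L\<^sub>\<xi> / \<alpha> * (\<Sum>k = 2..T. w k)" by (simp add: W_def sum_distrib_left)
    also have "\<dots> \<le> L\<^sub>\<xi> / \<alpha> * V" using w(1) noise_lipschitz(1) \<alpha> by (intro mult_left_mono) auto
    finally show ?thesis .
  qed
  let ?h = "(V / real T) powr (3 * (b / (4 + b)))"
  let ?B = "real T powr (4 / (4 + b)) * V powr (b / (4 + b))"
  let ?DR = "\<lambda>\<omega>. dynamic_regret (\<lambda>t. cvar_cost \<alpha> J' (D t)) (\<lambda>t. xhat t \<omega>) xstar T"
  have "(LINT \<omega>|M. ?DR \<omega>) \<le> real T * (3 * (L\<^sub>0 / \<alpha>) * \<delta> + L\<^sub>0 / \<alpha> * \<delta> * R / r) + 2 * real \<Delta> * (\<Sum>k = 2..T. W k) +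
      real (Suc ((T - 1) div \<Delta>)) * (4 * R\<^sup>2) / (2 * ?h) + real T * (?h / 2 * (real DIM('a) / \<delta> * U)\<^sup>2) +
      real DIM('a) / \<delta> * (2 * R * (2 * U / \<alpha>)) * (real (Suc ((T - 1) div \<Delta>)) * (\<Sum>\<tau> = 1..\<Delta>. 1 / sqrt (real (\<phi> \<tau>))))"
    by (rule expected_dynamic_regret_le[OF xstar drift W0]) (use T pos \<eta> in auto)
  also have "\<dots> \<le> Cst * ?B"
    unfolding delta(1) Cst_def
    by (rule regret_rate[OF V b T Delta SW \<Phi>]) (use noise_lipschitz(1) \<alpha> c R U in auto)
  finally have mean: "(LINT \<omega>|M. ?DR \<omega>) \<le> Cst * ?B" .
  have "0 < Cst"
    unfolding Cst_def using lipschitz(1) \<alpha> R X(1) noise_lipschitz(1) U(1) c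
    by (intro add_pos_nonneg) auto
  then have B: "0 < Cst * ?B" using T0 V by simp
  have xstar_X: "xstar t \<in> X" if "t \<in> {1..T}" for t using xstar[OF that] by (simp add: is_arg_min_def)
  \<comment> \<open>Integrability is established for the regret formed with \<open>J'\<close>;
    played points and minimisers lie in \<open>X\<close>, so it is the regret of the
    statement.\<close>
  have DR_eq: "?DR \<omega> = dynamic_regret (\<lambda>t. cvar_cost \<alpha> J (D t)) (\<lambda>t. xhat t \<omega>) xstar T" if "\<omega> \<in> space M" for \<omega>
    unfolding dynamic_regret_def using C'_eq xhat_in_X[OF that] xstar_X
    by (intro arg_cong2[where f = "(-)"] sum.cong) auto
  have "1 - \<gamma> \<le> prob {\<omega> \<in> space M. ?DR \<omega> \<le> Cst * ?B / \<gamma>}"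
  proof (rule markov_complement[OF _ _ mean \<gamma> B])
    show "integrable M ?DR"
      unfolding dynamic_regret_def
      by (intro Bochner_Integration.integrable_diff Bochner_Integration.integrable_sum integrable_C'_xhat) auto
    fix \<omega> assume \<omega>: "\<omega> \<in> space M"
    have "(\<Sum>t = 1..T. cvar_cost \<alpha> J (D t) (xstar t)) \<le> (\<Sum>t = 1..T. cvar_cost \<alpha> J (D t) (xhat t \<omega>))"
    proof (rule sum_mono)
      fix t assume t: "t \<in> {1..T}"
      show "cvar_cost \<alpha> J (D t) (xstar t) \<le> cvar_cost \<alpha> J (D t) (xhat t \<omega>)"
        using xstar[OF t] xhat_in_X[OF \<omega> t] by (auto simp: is_arg_min_def not_less)
    qed
    then show "0 \<le> ?DR \<omega>" by (subst DR_eq[OF \<omega>]) (simp add: dynamic_regret_def)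
  qed
  also have "{\<omega> \<in> space M. ?DR \<omega> \<le> Cst * ?B / \<gamma>} = {\<omega> \<in> space M.
      dynamic_regret (\<lambda>t. cvar_cost \<alpha> J (D t)) (\<lambda>t. xhat t \<omega>) xstar T \<le> Cst / \<gamma> * ?B}"
    using DR_eq by auto
  finally show ?thesis .
qed

theorem theorem1:
  fixes X :: "'a::euclidean_space set" and J :: "'a \<Rightarrow> 'b::metric_space \<Rightarrow> real"
    and r U L\<^sub>0 L\<^sub>\<xi> K \<alpha> a c \<gamma> :: real
  assumes "0 < r" "cball 0 r \<subseteq> X" "bounded X"
    and "0 < U" "\<And>x \<xi>. x \<in> X \<Longrightarrow> \<bar>J x \<xi>\<bar> \<le> U"
    and convex: "\<And>\<xi>. convex_on X (\<lambda>x. J x \<xi>)"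
    and lipschitz: "0 < L\<^sub>0" "\<And>\<xi> x y. x \<in> X \<Longrightarrow> y \<in> X \<Longrightarrow> \<bar>J x \<xi> - J y \<xi>\<bar> \<le> L\<^sub>0 * norm (x - y)"
    and noise_lipschitz: "\<And>x. x \<in> X \<Longrightarrow> L\<^sub>\<xi>-lipschitz_on UNIV (J x)"
    and "0 < \<alpha>" "\<alpha> \<le> 1" "0 < K" "0 < a" "0 < c" "0 < \<gamma>" "\<gamma> < 1"
  shows "\<exists>C>0. \<exists>k::nat.
    \<forall>(T::nat) (V\<^sub>D::real) (D :: nat \<Rightarrow> 'b measure) (\<phi> :: nat \<Rightarrow> nat) (\<Delta>::nat) (\<delta>::real) (\<eta> :: nat \<Rightarrow> real)
      (M :: 'm measure) (x1 :: 'a) (u :: nat \<Rightarrow> 'm \<Rightarrow> 'a) (\<xi> :: nat \<Rightarrow> nat \<Rightarrow> 'm \<Rightarrow> 'b)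
      (xhat :: nat \<Rightarrow> 'm \<Rightarrow> 'a) (x :: nat \<Rightarrow> 'm \<Rightarrow> 'a) (xstar :: nat \<Rightarrow> 'a).
      0 < V\<^sub>D
      \<longrightarrow> (\<forall>t\<in>{1..T}. prob_space (D t) \<and> sets (D t) = sets borel)
      \<longrightarrow> (\<Sum>t = 2..T. wasserstein1 K (D (t - 1)) (D t)) \<le> ereal V\<^sub>D
      \<longrightarrow> 1 < \<Delta> \<and> \<Delta> < T
      \<longrightarrow> (\<forall>\<tau>\<in>{1..\<Delta>}. 1 \<le> \<phi> \<tau>)
      \<longrightarrow> (\<Sum>\<tau> = 1..\<Delta>. 1 / sqrt (real (\<phi> \<tau>))) \<le> c * real \<Delta> powr (1 - a / 2)
      \<longrightarrow> \<delta> < r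
      \<longrightarrow> zeroth_order_cvar_run M X J D r \<alpha> \<delta> \<eta> \<phi> \<Delta> T x1 u \<xi> xhat x
      \<longrightarrow> (\<forall>t\<in>{1..T}. is_arg_min (cvar_cost \<alpha> J (D t)) (\<lambda>y. y \<in> X) (xstar t))
      \<longrightarrow>
        (a \<le> 1
          \<and> \<delta> = (V\<^sub>D / real T) powr (a / (4 + a))
          \<and> (\<forall>t\<in>{1..T}. \<eta> t = (V\<^sub>D / real T) powr (3 * a / (4 + a)))
          \<and> int \<Delta> \<in> {\<lfloor>(real T / V\<^sub>D) powr (4 / (4 + a))\<rfloor>, \<lceil>(real T / V\<^sub>D) powr (4 / (4 + a))\<rceil>}
          \<longrightarrow> measure M {\<omega> \<in> space M.
                dynamic_regret (\<lambda>t. cvar_cost \<alpha> J (D t)) (\<lambda>t. xhat t \<omega>) xstar T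
                  \<le> C * ln (real T) ^ k * (real T powr (4 / (4 + a)) * V\<^sub>D powr (a / (4 + a)))}
              \<ge> 1 - \<gamma>)
        \<and>
        (1 < a
          \<and> \<delta> = (V\<^sub>D / real T) powr (1 / 5)
          \<and> (\<forall>t\<in>{1..T}. \<eta> t = (V\<^sub>D / real T) powr (3 / 5))
          \<and> int \<Delta> \<in> {\<lfloor>(real T / V\<^sub>D) powr (4 / 5)\<rfloor>, \<lceil>(real T / V\<^sub>D) powr (4 / 5)\<rceil>}
          \<longrightarrow> measure M {\<omega> \<in> space M.
                dynamic_regret (\<lambda>t. cvar_cost \<alpha> J (D t)) (\<lambda>t. xhat t \<omega>) xstar T
                  \<le> C * ln (real T) ^ k * (real T powr (4 / 5) * V\<^sub>D powr (1 / 5))}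
              \<ge> 1 - \<gamma>)"
  proof -
  obtain R where R: "\<And>y. y \<in> X \<Longrightarrow> norm y \<le> R" using \<open>bounded X\<close> bounded_iff by blast
  have X0: "0 \<in> X" using assms(1,2) by auto
  have R0: "0 \<le> R" using R[OF X0] by simp
  have "0 \<le> L\<^sub>\<xi>" using noise_lipschitz[OF X0] by (rule lipschitz_on_nonneg)
  \<comment> \<open>\<open>L\<^sub>\<xi>\<close> may be 0, while dividing by the constant in the
    Wasserstein bound requires a positive one.\<close>
  define L where "L = L\<^sub>\<xi> + 1"
  have L: "0 < L" "\<And>y. y \<in> X \<Longrightarrow> L-lipschitz_on UNIV (J y)"
    using \<open>0 \<le> L\<^sub>\<xi>\<close> lipschitz_on_le[OF noise_lipschitz] by (auto simp: L_def)
  define Cst where "Cst = 3 * (L\<^sub>0 / \<alpha>) + L\<^sub>0 / \<alpha> * R / r + 4 * (L / \<alpha>) + 8 * R\<^sup>2 +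
    (real DIM('a) * U)\<^sup>2 / 2 + 4 * real DIM('a) * (2 * R * (2 * U / \<alpha>)) * c"
  have Cst: "0 < Cst"
    unfolding Cst_def using assms(1,4) lipschitz(1) L(1) R0 \<open>0 < \<alpha>\<close> \<open>0 < c\<close>
    by (intro add_pos_nonneg) auto
  note whp = dynamic_regret_whp[OF assms(1,2) R assms(4,5) convex lipschitz L \<open>0 < \<alpha>\<close> \<open>\<alpha> \<le> 1\<close> \<open>0 < K\<close>
      _ _ \<open>0 < c\<close> \<open>0 < \<gamma>\<close>, folded Cst_def]
  show ?thesis
  proof (intro exI[of _ "Cst / \<gamma>"] conjI exI[of _ 0] allI impI)
    show "0 < Cst / \<gamma>" using Cst \<open>0 < \<gamma>\<close> by simp
  next
    fix T :: nat and V :: real and D :: "nat \<Rightarrow> 'b measure" and \<phi> :: "nat \<Rightarrow> nat" and \<Delta> :: nat and \<delta> :: real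
      and \<eta> :: "nat \<Rightarrow> real" and M :: "'m measure" and x1 :: 'a and u :: "nat \<Rightarrow> 'm \<Rightarrow> 'a"
      and \<xi> :: "nat \<Rightarrow> nat \<Rightarrow> 'm \<Rightarrow> 'b" and xhat x :: "nat \<Rightarrow> 'm \<Rightarrow> 'a" and xstar :: "nat \<Rightarrow> 'a"
    assume V: "0 < V" and D: "\<forall>t\<in>{1..T}. prob_space (D t) \<and> sets (D t) = sets borel"
      and var: "(\<Sum>t = 2..T. wasserstein1 K (D (t - 1)) (D t)) \<le> ereal V"
      and \<Delta>: "1 < \<Delta> \<and> \<Delta> < T" and \<phi>: "\<forall>\<tau>\<in>{1..\<Delta>}. 1 \<le> \<phi> \<tau>"
      and \<Phi>: "(\<Sum>\<tau> = 1..\<Delta>. 1 / sqrt (real (\<phi> \<tau>))) \<le> c * real \<Delta> powr (1 - a / 2)"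
      and \<delta>: "\<delta> < r" and run: "zeroth_order_cvar_run M X J D r \<alpha> \<delta> \<eta> \<phi> \<Delta> T x1 u \<xi> xhat x"
      and xs: "\<forall>t\<in>{1..T}. is_arg_min (cvar_cost \<alpha> J (D t)) (\<lambda>y. y \<in> X) (xstar t)"
    {
      assume *: "a \<le> 1 \<and> \<delta> = (V / real T) powr (a / (4 + a))
        \<and> (\<forall>t\<in>{1..T}. \<eta> t = (V / real T) powr (3 * a / (4 + a)))
        \<and> int \<Delta> \<in> {\<lfloor>(real T / V) powr (4 / (4 + a))\<rfloor>, \<lceil>(real T / V) powr (4 / (4 + a))\<rceil>}"
      show "1 - \<gamma> \<le> measure M {\<omega> \<in> space M.
          dynamic_regret (\<lambda>t. cvar_cost \<alpha> J (D t)) (\<lambda>t. xhat t \<omega>) xstar T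
            \<le> Cst / \<gamma> * ln (real T) ^ 0 * (real T powr (4 / (4 + a)) * V powr (a / (4 + a)))}"
        unfolding power_0 mult_1_right
        by (rule whp[of a V T D \<Delta> \<phi> \<delta> \<eta> M x1 u \<xi> xhat x xstar])
          (use V D var \<Delta> \<phi> \<Phi> \<delta> run xs * \<open>0 < a\<close> in auto)
    next
      assume *: "1 < a \<and> \<delta> = (V / real T) powr (1 / 5)
        \<and> (\<forall>t\<in>{1..T}. \<eta> t = (V / real T) powr (3 / 5))
        \<and> int \<Delta> \<in> {\<lfloor>(real T / V) powr (4 / 5)\<rfloor>, \<lceil>(real T / V) powr (4 / 5)\<rceil>}"
      have five: "(4::real) + 1 = 5" by simp
      \<comment> \<open>For a > 1 the sampling hypothesis is weakened to the exponent of a = 1,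
        which is possible because \<Delta> \<ge> 1; restarts would forbid a faster rate with these
        step sizes anyway.\<close>
      have "real \<Delta> powr (1 - a / 2) \<le> real \<Delta> powr (1 - 1 / 2)"
        using \<Delta> * by (intro powr_mono) auto
      then have \<Phi>': "(\<Sum>\<tau> = 1..\<Delta>. 1 / sqrt (real (\<phi> \<tau>))) \<le> c * real \<Delta> powr (1 - 1 / 2)"
        using \<Phi> \<open>0 < c\<close> by (meson mult_left_mono less_imp_le order_trans)
      show "1 - \<gamma> \<le> measure M {\<omega> \<in> space M.
          dynamic_regret (\<lambda>t. cvar_cost \<alpha> J (D t)) (\<lambda>t. xhat t \<omega>) xstar T
            \<le> Cst / \<gamma> * ln (real T) ^ 0 * (real T powr (4 / 5) * V powr (1 / 5))}"
        unfolding power_0 mult_1_right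
        by (rule whp[of 1 V T D \<Delta> \<phi> \<delta> \<eta> M x1 u \<xi> xhat x xstar, unfolded five mult_1_right])
          (use V D var \<Delta> \<phi> \<Phi>' \<delta> run xs * in auto)
    }
  qed
qed

end
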